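(* Let $A$ be a gr-Shimoda ring over a base field $k$ of characteristic $0$. Then $\mathrm{pr\text{-}dim}(A)\leq 2$ (equivalently, the Krull dimension of $A$ is at most $3$).
   Context: A standard graded algebra over a field $k$ is a commutative ring $A=\bigoplus_{i\ge 0}A_i$ graded by the non-negative integers with $A_0=k$ and $A=k[x_1,\ldots,x_n]$ for finitely many elements $x_1,\dots,x_n$ of degree $1$. Its irrelevant ideal is $\mathcal{M}=(x_1,\ldots,x_n)A$. A homogeneous prime ideal is relevant if it does not contain $\mathcal{M}$ (i.e. it is different from $\mathcal{M}$). $\mu(I)$ denotes the minimal number of generators of an ideal $I$. A standard graded algebra $A$ over $k$ is called a gr-Shimoda ring (Shimoda ring in the graded sense) if every relevant homogeneous prime ideal $\mathfrak{p}$ of $A$ is generated by $\mathrm{height}(\mathfrak{p})$ elements. It is assumed throughout that $A$ has Krull dimension at least $2$. $\mathrm{pr\text{-}dim}(A)$ denotes the dimension of $A$ as a projective scheme, i.e. $\mathrm{pr\text{-}dim}(A)=\dim\mathrm{Proj}(A)$, which is the Krull dimension of $A$ minus $1$. *)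

theory Defs
  imports
    "HOL-Algebra.Generated_Rings"
    "HOL-Algebra.Ideal"
    "HOL-Analysis.Abstract_Topology"
    "HOL-Library.Extended_Nat"
begin

text \<open>
  \<open>chain_dim F\<close> is the supremum of all \<open>n\<close> for which \<open>F\<close> contains a strict chain
  \<open>C 0 \<subset> \<dots> \<subset> C n\<close>. It is \<open>0\<close> for empty \<open>F\<close>, so the zero ring and the empty space
  get dimension \<open>0\<close> here.
\<close>

definition chain_dim :: "'a set set \<Rightarrow> enat" where
  "chain_dim F =
     (SUP n \<in> {n. \<exists>C :: nat \<Rightarrow> 'a set. (\<forall>i\<le>n. C i \<in> F) \<and> (\<forall>i<n. C i \<subset> C (Suc i))}. enat n)"

definition krull_dim :: "('a, 'b) ring_scheme \<Rightarrow> enat" where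
  "krull_dim R = chain_dim {P. primeideal P R}"

definition height :: "('a, 'b) ring_scheme \<Rightarrow> 'a set \<Rightarrow> enat" where
  "height R p = chain_dim {P. primeideal P R \<and> P \<subseteq> p}"

definition irreducible_in :: "'a topology \<Rightarrow> 'a set \<Rightarrow> bool" where
  "irreducible_in X C \<longleftrightarrow> C \<noteq> {} \<and> C \<subseteq> topspace X \<and>
     (\<forall>D E. closedin X D \<longrightarrow> closedin X E \<longrightarrow> C \<subseteq> D \<union> E \<longrightarrow> C \<subseteq> D \<or> C \<subseteq> E)"

definition top_dim :: "'a topology \<Rightarrow> enat" where
  "top_dim X = chain_dim {C. closedin X C \<and> irreducible_in X C}"

definition char_zero_ring :: "('a, 'b) ring_scheme \<Rightarrow> bool" where
  "char_zero_ring R \<longleftrightarrow> (\<forall>n::nat. n > 0 \<longrightarrow> [n] \<cdot>\<^bsub>R\<^esub> \<one>\<^bsub>R\<^esub> \<noteq> \<zero>\<^bsub>R\<^esub>)"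

locale graded_cring = cring A for A (structure) +
  fixes \<A> :: "nat \<Rightarrow> 'a set"
  assumes component_subgroup: "additive_subgroup (\<A> i) A"
    and component_mult: "\<lbrakk>a \<in> \<A> i; b \<in> \<A> j\<rbrakk> \<Longrightarrow> a \<otimes> b \<in> \<A> (i + j)"
    and decomposition: "a \<in> carrier A \<Longrightarrow>
      \<exists>!f. (\<forall>i. f i \<in> \<A> i) \<and> finite {i. f i \<noteq> \<zero>} \<and> a = (\<Oplus>i\<in>{i. f i \<noteq> \<zero>}. f i)"

text \<open>
  The base field \<open>k\<close> is a subfield of \<open>A\<close>, so that \<open>A\<^sub>0 = k\<close> is an equality of sets.
  The list \<open>xs\<close> consists of the chosen generators \<open>x\<^sub>1, \<dots>, x\<^sub>n\<close> of degree \<open>1\<close>.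
\<close>

locale standard_graded_algebra = graded_cring A \<A> for A (structure) and \<A> +
  fixes k :: "'a set" and xs :: "'a list"
  assumes base_subfield: "subfield k A"
    and component_0: "\<A> 0 = k"
    and gens_degree_1: "set xs \<subseteq> \<A> 1"
    and generated: "carrier A = generate_ring A (k \<union> set xs)"

definition homogeneous_elements :: "(nat \<Rightarrow> 'a set) \<Rightarrow> 'a set" where
  "homogeneous_elements \<A> = (\<Union>i. \<A> i)"

definition homogeneous_ideal :: "('a, 'b) ring_scheme \<Rightarrow> (nat \<Rightarrow> 'a set) \<Rightarrow> 'a set \<Rightarrow> bool" where
  "homogeneous_ideal A \<A> I \<longleftrightarrow> ideal I A \<and> I = Idl\<^bsub>A\<^esub> (I \<inter> homogeneous_elements \<A>)"

definition irrelevant_ideal :: "('a, 'b) ring_scheme \<Rightarrow> 'a list \<Rightarrow> 'a set" where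
  "irrelevant_ideal A xs = Idl\<^bsub>A\<^esub> (set xs)"

text \<open>The points of \<open>Proj A\<close>.\<close>

definition relevant_primes ::
    "('a, 'b) ring_scheme \<Rightarrow> (nat \<Rightarrow> 'a set) \<Rightarrow> 'a list \<Rightarrow> 'a set set" where
  "relevant_primes A \<A> xs =
     {p. primeideal p A \<and> homogeneous_ideal A \<A> p \<and> \<not> irrelevant_ideal A xs \<subseteq> p}"

text \<open>
  The Zariski topology: the closed sets are \<open>V\<^sub>+(S) = {p. S \<subseteq> p}\<close> for sets \<open>S\<close> of homogeneous
  elements.
\<close>

definition Proj ::
    "('a, 'b) ring_scheme \<Rightarrow> (nat \<Rightarrow> 'a set) \<Rightarrow> 'a list \<Rightarrow> 'a set topology" where
  "Proj A \<A> xs =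
     topology (\<lambda>U. \<exists>S \<subseteq> homogeneous_elements \<A>. U = {p \<in> relevant_primes A \<A> xs. \<not> S \<subseteq> p})"

definition pr_dim :: "('a, 'b) ring_scheme \<Rightarrow> (nat \<Rightarrow> 'a set) \<Rightarrow> 'a list \<Rightarrow> enat" where
  "pr_dim A \<A> xs = top_dim (Proj A \<A> xs)"

text \<open>
  The list \<open>gs\<close> may contain repetitions. As \<open>A\<close> is Noetherian, all heights are finite.
\<close>

locale gr_shimoda_ring = standard_graded_algebra +
  assumes relevant_prime_generated: "p \<in> relevant_primes A \<A> xs \<Longrightarrow>
    \<exists>gs. set gs \<subseteq> carrier A \<and> enat (length gs) = height A p \<and> p = Idl (set gs)"

context standard_graded_algebra
begin

lemma homogeneous_elements_carrier: "homogeneous_elements \<A> \<subseteq> carrier A"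
  using component_subgroup
  by (auto simp: homogeneous_elements_def dest: additive_subgroup.a_Hcarr)

lemma homogeneous_elements_mult:
  "\<lbrakk>a \<in> homogeneous_elements \<A>; b \<in> homogeneous_elements \<A>\<rbrakk> \<Longrightarrow> a \<otimes> b \<in> homogeneous_elements \<A>"
  by (auto simp: homogeneous_elements_def intro: component_mult)

lemma one_homogeneous: "\<one> \<in> homogeneous_elements \<A>"
proof -
  have "\<one> \<in> k"
    using base_subfield
    by (meson subfield.axioms(1) subdomain.axioms(1) subcring.axioms(1) subringE(3))
  then show ?thesis
    using component_0 by (auto simp: homogeneous_elements_def)
qed

lemma istopology_Proj:
  "istopology (\<lambda>U. \<exists>S \<subseteq> homogeneous_elements \<A>. U = {p \<in> relevant_primes A \<A> xs. \<not> S \<subseteq> p})"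
  unfolding istopology_def
proof (intro conjI allI impI)
  fix U V
  assume "\<exists>S \<subseteq> homogeneous_elements \<A>. U = {p \<in> relevant_primes A \<A> xs. \<not> S \<subseteq> p}"
    and "\<exists>S \<subseteq> homogeneous_elements \<A>. V = {p \<in> relevant_primes A \<A> xs. \<not> S \<subseteq> p}"
  then obtain S T where S: "S \<subseteq> homogeneous_elements \<A>"
      "U = {p \<in> relevant_primes A \<A> xs. \<not> S \<subseteq> p}"
    and T: "T \<subseteq> homogeneous_elements \<A>" "V = {p \<in> relevant_primes A \<A> xs. \<not> T \<subseteq> p}"
    by blast
  define W where "W = {s \<otimes> t |s t. s \<in> S \<and> t \<in> T}"
  have W: "W \<subseteq> homogeneous_elements \<A>"
    using S(1) T(1) homogeneous_elements_mult by (auto simp: W_def)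
  have "W \<subseteq> p \<longleftrightarrow> S \<subseteq> p \<or> T \<subseteq> p" if p: "p \<in> relevant_primes A \<A> xs" for p
  proof -
    interpret p: primeideal p A
      using p by (simp add: relevant_primes_def)
    show ?thesis
    proof
      assume Wp: "W \<subseteq> p"
      show "S \<subseteq> p \<or> T \<subseteq> p"
      proof (rule ccontr)
        assume "\<not> (S \<subseteq> p \<or> T \<subseteq> p)"
        then obtain s t where st: "s \<in> S" "s \<notin> p" "t \<in> T" "t \<notin> p" by blast
        then have "s \<otimes> t \<in> p" using Wp by (auto simp: W_def)
        then show False
          using st S(1) T(1) homogeneous_elements_carrier p.I_prime by blast
      qed
    next
      assume "S \<subseteq> p \<or> T \<subseteq> p"
      then show "W \<subseteq> p"
        using S(1) T(1) homogeneous_elements_carrier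
        unfolding W_def by (blast intro: p.I_l_closed p.I_r_closed)
    qed
  qed
  then have "U \<inter> V = {p \<in> relevant_primes A \<A> xs. \<not> W \<subseteq> p}"
    unfolding S(2) T(2) by blast
  with W show "\<exists>S \<subseteq> homogeneous_elements \<A>. U \<inter> V = {p \<in> relevant_primes A \<A> xs. \<not> S \<subseteq> p}"
    by blast
next
  fix \<K>
  assume "\<forall>K\<in>\<K>. \<exists>S \<subseteq> homogeneous_elements \<A>. K = {p \<in> relevant_primes A \<A> xs. \<not> S \<subseteq> p}"
  then obtain S where S: "\<And>K. K \<in> \<K> \<Longrightarrow> S K \<subseteq> homogeneous_elements \<A>"
      "\<And>K. K \<in> \<K> \<Longrightarrow> K = {p \<in> relevant_primes A \<A> xs. \<not> S K \<subseteq> p}"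
    by metis
  have "\<Union>\<K> = {p \<in> relevant_primes A \<A> xs. \<not> (\<Union>K\<in>\<K>. S K) \<subseteq> p}"
    using S(2) by blast
  moreover have "(\<Union>K\<in>\<K>. S K) \<subseteq> homogeneous_elements \<A>"
    using S(1) by blast
  ultimately show "\<exists>S \<subseteq> homogeneous_elements \<A>. \<Union>\<K> = {p \<in> relevant_primes A \<A> xs. \<not> S \<subseteq> p}"
    by blast
qed

lemma openin_Proj:
  "openin (Proj A \<A> xs) U \<longleftrightarrow>
     (\<exists>S \<subseteq> homogeneous_elements \<A>. U = {p \<in> relevant_primes A \<A> xs. \<not> S \<subseteq> p})"
  unfolding Proj_def by (simp add: topology_inverse'[OF istopology_Proj])

lemma topspace_Proj: "topspace (Proj A \<A> xs) = relevant_primes A \<A> xs"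
proof -
  have "\<one> \<notin> p" if "p \<in> relevant_primes A \<A> xs" for p
    using that ideal.one_imp_carrier primeideal.I_notcarr
    by (fastforce simp: relevant_primes_def homogeneous_ideal_def)
  then have "openin (Proj A \<A> xs) (relevant_primes A \<A> xs)"
    unfolding openin_Proj using one_homogeneous by (intro exI[of _ "{\<one>}"]) auto
  then show ?thesis
    by (auto simp: topspace_def openin_Proj)
qed

end

end

theory Submission
  imports Defs "HOL-Algebra.Embedded_Algebras" "HOL-Algebra.Ring_Divisibility" "HOL-Library.Multiset_Order"
begin

text \<open>
  The bound on the Krull dimension is proved by contradiction: in an algebra with a chain of primes
  of length 4 in which relevant primes are generated by as many elements as their height, there is
  a relevant prime that needs more generators than its height.

  Let \<open>p\<close> be a maximal relevant prime, that is, a closed point of Proj. It is generated by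
  \<open>ht p\<close> elements, and graded Nakayama (\<open>homogeneous_generators\<close>) allows to take them homogeneous,
  \<open>g\<^sub>0, \<dots>, g\<^sub>s\<^sub>-\<^sub>1\<close> with \<open>s \<le> ht p\<close>. Choose a generator \<open>z\<close> of degree 1 outside \<open>p\<close>. The algebra is
  spanned by the products \<open>d z\<^sup>i g\<^sup>\<alpha>\<close> with \<open>d\<close> from a finite set, which bounds the dimension of its
  part of degree at most \<open>N\<close> by a constant times \<open>(N + 1)\<^sup>s\<^sup>+\<^sup>1\<close>. On the other hand, elements chosen
  between consecutive members of a chain of primes of length \<open>h\<close> are algebraically independent,
  which forces a growth of order \<open>N\<^sup>h\<close> (\<open>prime_chain_length_le\<close>). A chain through \<open>p\<close> that ends with
  the irrelevant ideal has length \<open>ht p + 1\<close>; so \<open>s = ht p\<close>, and also \<open>s \<ge> 3\<close>. As the two bounds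
  agree, nothing is lost: a relation between the monomials \<open>g\<^sup>\<alpha>\<close> whose initial coefficient lies
  outside \<open>p\<close> would lower the growth, so there is none (\<open>no_initial_relation\<close>). Consequently, for
  a graded complement \<open>W\<close> of \<open>p\<close> that is stable under \<open>z\<close>, every element is uniquely a sum of
  terms \<open>w g\<^sup>\<alpha>\<close> with \<open>w\<close> in \<open>W\<close>. This is the freeness over \<open>k[z, g\<^sub>0, \<dots>, g\<^sub>s\<^sub>-\<^sub>1]\<close> that the
  Cohen-Macaulay property would give.

  Now put \<open>g\<^sub>0 = \<lambda>\<^sup>3\<close>, \<open>g\<^sub>1 = \<lambda>\<^sup>4\<close>, \<open>g\<^sub>2 = \<lambda>\<^sup>5\<close>, homogenised by powers of \<open>z\<close>, and \<open>g\<^sub>i = 0\<close> for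
  \<open>i \<ge> 3\<close>. The curve \<open>(\<lambda>\<^sup>3, \<lambda>\<^sup>4, \<lambda>\<^sup>5)\<close> is the classical example of a prime of height two that needs
  three generators. The elements whose expansion vanishes under this substitution form an ideal; it
  is prime because the terms of lowest weight in \<open>\<lambda>\<close> multiply like elements of the domain \<open>A/p\<close>
  (\<open>Phi_mult_lowest\<close>, \<open>curve_prime\<close>). It is relevant and strictly contained in \<open>p\<close>, so its height is
  less than \<open>s\<close>. But it contains \<open>s\<close> elements, with terms in \<open>g\<^sub>1\<^sup>2\<close>, \<open>g\<^sub>1g\<^sub>2\<close>, \<open>g\<^sub>2\<^sup>2\<close> and
  \<open>g\<^sub>3, \<dots>, g\<^sub>s\<^sub>-\<^sub>1\<close>, that are independent modulo \<open>p\<close> times the ideal, and therefore it is not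
  generated by fewer than \<open>s\<close> elements (\<open>curve_not_generated\<close>).

  The bound on the dimension of Proj follows because its irreducible closed sets correspond to
  relevant primes, and a chain of these is lengthened by the irrelevant ideal (\<open>pr_dim_le\<close>).
\<close>

section \<open>Sums and homogeneous components\<close>

text \<open>For a set \<open>S\<close> closed under negation, as are those used below, this is the additive subgroup
  generated by \<open>S\<close>. Leaving negation out of the definition gives an induction with a single step.\<close>
inductive_set (in ring) add_span :: "'a set \<Rightarrow> 'a set" for S where
  zero: "\<zero> \<in> add_span S"
| step: "\<lbrakk>x \<in> S; y \<in> add_span S\<rbrakk> \<Longrightarrow> x \<oplus> y \<in> add_span S"

context ring
begin

lemma add_span_carrier: "S \<subseteq> carrier R \<Longrightarrow> a \<in> add_span S \<Longrightarrow> a \<in> carrier R"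
  by (rotate_tac, induction rule: add_span.induct) auto

lemma add_span_gen: "S \<subseteq> carrier R \<Longrightarrow> a \<in> S \<Longrightarrow> a \<in> add_span S"
  using add_span.step[of a S \<zero>] add_span.zero by auto

lemma add_span_add:
  assumes "S \<subseteq> carrier R" "a \<in> add_span S" "b \<in> add_span S"
  shows "a \<oplus> b \<in> add_span S"
  using assms(2)
proof (induction rule: add_span.induct)
  case zero
  then show ?case using assms add_span_carrier by simp
next
  case (step x y)
  then have "x \<oplus> y \<oplus> b = x \<oplus> (y \<oplus> b)"
    using assms add_span_carrier by (meson a_assoc subsetD)
  then show ?case using step add_span.step by simp
qed

lemma add_span_neg:
  assumes "S \<subseteq> carrier R" "\<And>x. x \<in> S \<Longrightarrow> \<ominus> x \<in> S" "a \<in> add_span S"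
  shows "\<ominus> a \<in> add_span S"
  using assms(3)
proof (induction rule: add_span.induct)
  case zero
  then show ?case by (simp add: add_span.zero)
next
  case (step x y)
  then have "\<ominus> (x \<oplus> y) = \<ominus> x \<oplus> \<ominus> y"
    using assms add_span_carrier minus_add by (meson subsetD)
  then show ?case using step assms(2) add_span.step by metis
qed

lemma add_span_additive_subgroup:
  assumes "S \<subseteq> carrier R" "\<And>x. x \<in> S \<Longrightarrow> \<ominus> x \<in> S"
  shows "additive_subgroup (add_span S) R"
proof -
  have "\<And>x. x \<in> add_span S \<Longrightarrow> \<ominus> x \<in> add_span S"
    using add_span_neg[OF assms] by blast
  then show ?thesis
    using add_span_carrier[OF assms(1)] add_span_add[OF assms(1)] add_span.zero[of S]
    by (intro additive_subgroup.intro add.subgroupI) (auto simp flip: a_inv_def)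
qed

lemma add_span_subset:
  assumes "additive_subgroup H R" "S \<subseteq> H" "a \<in> add_span S"
  shows "a \<in> H"
  using assms(3,1,2)
  by (induction rule: add_span.induct)
     (auto simp: additive_subgroup.zero_closed additive_subgroup.a_closed)

lemma finsum_add_span:
  assumes "finite F" "S \<subseteq> carrier R" "\<And>i. i \<in> F \<Longrightarrow> f i \<in> add_span S"
  shows "finsum R f F \<in> add_span S"
  using assms(1,3)
proof (induction F rule: finite_induct)
  case empty
  then show ?case by (simp add: add_span.zero)
next
  case (insert x F)
  then have "f \<in> F \<rightarrow> carrier R" "f x \<in> carrier R" using add_span_carrier[OF assms(2)] by auto
  then show ?case using insert add_span_add[OF assms(2)] by simp
qed

lemma finsum_additive_subgroup:
  assumes "additive_subgroup H R" "\<And>i. i \<in> F \<Longrightarrow> f i \<in> H"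
  shows "finsum R f F \<in> H"
proof -
  interpret additive_subgroup H R by fact
  show ?thesis
    using assms(2)
  proof (induction F rule: infinite_finite_induct)
    case (insert x F)
    then have "f \<in> F \<rightarrow> carrier R" "f x \<in> carrier R" by auto
    then show ?case using insert by simp
  qed auto
qed

lemma additive_subgroup_minus:
  assumes "additive_subgroup H R" "a \<in> H" "b \<in> H" shows "a \<ominus> b \<in> H"
  using assms by (simp add: a_minus_def additive_subgroup.a_closed additive_subgroup.a_inv_closed)

end

lemma (in cring) Idl_eq_add_span:
  assumes Y: "Y \<subseteq> carrier R"
  shows "Idl Y = add_span {b \<otimes> y |b y. b \<in> carrier R \<and> y \<in> Y}" (is "_ = add_span ?S")
proof
  have S: "?S \<subseteq> carrier R" using Y by auto
  have "\<ominus> x \<in> ?S" if "x \<in> ?S" for x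
  proof -
    from that obtain b y where "x = b \<otimes> y" "b \<in> carrier R" "y \<in> Y" by auto
    then have "\<ominus> x = (\<ominus> b) \<otimes> y" "\<ominus> b \<in> carrier R" "y \<in> Y" using Y by (auto simp: l_minus subsetD)
    then show ?thesis by blast
  qed
  then interpret additive_subgroup "add_span ?S" R
    using add_span_additive_subgroup[OF S] by blast
  have l: "x \<otimes> a \<in> add_span ?S" if "a \<in> add_span ?S" "x \<in> carrier R" for a x
    using that
  proof (induction rule: add_span.induct)
    case zero
    then show ?case by (simp add: add_span.zero)
  next
    case (step s t)
    then obtain b y where s: "s = b \<otimes> y" "b \<in> carrier R" "y \<in> Y" by auto
    have t: "t \<in> carrier R" and y: "y \<in> carrier R" using step add_span_carrier[OF S] s Y by blast+
    have "x \<otimes> (s \<oplus> t) = (x \<otimes> b) \<otimes> y \<oplus> x \<otimes> t"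
      using s step(4) t y by (simp add: r_distr m_assoc)
    moreover have "(x \<otimes> b) \<otimes> y \<in> ?S" using s step by blast
    moreover have "x \<otimes> t \<in> add_span ?S" by (rule step(3)[OF step(4)])
    ultimately show ?case by (simp only: add_span.step)
  qed
  have "ideal (add_span ?S) R"
  proof (rule idealI[OF ring_axioms a_subgroup])
    fix a x assume a: "a \<in> add_span ?S" and x: "x \<in> carrier R"
    show "x \<otimes> a \<in> add_span ?S" by (rule l[OF a x])
    then show "a \<otimes> x \<in> add_span ?S" by (simp only: m_comm[OF add_span_carrier[OF S a] x])
  qed
  moreover have "Y \<subseteq> ?S"
  proof
    fix y assume "y \<in> Y"
    then have "y = \<one> \<otimes> y" "\<one> \<in> carrier R" "y \<in> Y" using Y by auto
    then show "y \<in> ?S" by blast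
  qed
  then have "Y \<subseteq> add_span ?S" using add_span_gen[OF S] by blast
  ultimately show "Idl Y \<subseteq> add_span ?S" using genideal_minimal by blast
  interpret I: ideal "Idl Y" R using Y by (rule genideal_ideal)
  have "?S \<subseteq> Idl Y" using genideal_self[OF Y] I.I_l_closed by auto
  then show "add_span ?S \<subseteq> Idl Y" using add_span_subset[OF I.additive_subgroup_axioms] by blast
qed

lemma (in cring) Idl_induct [consumes 2, case_names zero add]:
  assumes Y: "Y \<subseteq> carrier R" and a: "a \<in> Idl Y" and "P \<zero>"
    and step: "\<And>b y r. \<lbrakk>b \<in> carrier R; y \<in> Y; r \<in> carrier R; P r\<rbrakk> \<Longrightarrow> P (b \<otimes> y \<oplus> r)"
  shows "P a"
proof -
  let ?S = "{b \<otimes> y |b y. b \<in> carrier R \<and> y \<in> Y}"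
  have S: "?S \<subseteq> carrier R" using Y by auto
  have "a \<in> add_span ?S" using a Idl_eq_add_span[OF Y] by simp
  then show ?thesis
  proof (induction rule: add_span.induct)
    case zero
    show ?case by fact
  next
    case (step x r)
    then show ?case using assms(4) add_span_carrier[OF S] by blast
  qed
qed

context graded_cring
begin

lemma comp_carrier: "a \<in> \<A> i \<Longrightarrow> a \<in> carrier A"
  using component_subgroup additive_subgroup.a_Hcarr by metis

definition component :: "nat \<Rightarrow> 'a \<Rightarrow> 'a" where
  "component n a = (THE f. (\<forall>i. f i \<in> \<A> i) \<and> finite {i. f i \<noteq> \<zero>} \<and> a = (\<Oplus>i\<in>{i. f i \<noteq> \<zero>}. f i)) n"

lemma component_props:
  assumes "a \<in> carrier A"
  shows component_in: "component n a \<in> \<A> n"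
    and component_finite: "finite {i. component i a \<noteq> \<zero>}"
    and component_sum: "a = (\<Oplus>i\<in>{i. component i a \<noteq> \<zero>}. component i a)"
  using theI'[OF decomposition[OF assms]] unfolding component_def by auto

lemma component_closed [simp]: "a \<in> carrier A \<Longrightarrow> component n a \<in> carrier A"
  using component_in comp_carrier by blast

lemma component_unique:
  assumes f: "\<And>i. f i \<in> \<A> i" and F: "finite F" "\<And>i. i \<notin> F \<Longrightarrow> f i = \<zero>"
    and a: "a = (\<Oplus>i\<in>F. f i)"
  shows "component n a = f n"
proof -
  have fc: "f i \<in> carrier A" for i using f comp_carrier by blast
  have fin: "finite {i. f i \<noteq> \<zero>}" using F by (metis (mono_tags, lifting) finite_subset mem_Collect_eq subsetI)
  have eq: "a = (\<Oplus>i\<in>{i. f i \<noteq> \<zero>}. f i)"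
    unfolding a by (rule add.finprod_mono_neutral_cong_right) (use F fc in auto)
  have ac: "a \<in> carrier A" unfolding a using fc by (intro finsum_closed) auto
  have "(THE f. (\<forall>i. f i \<in> \<A> i) \<and> finite {i. f i \<noteq> \<zero>} \<and> a = (\<Oplus>i\<in>{i. f i \<noteq> \<zero>}. f i)) = f"
    by (rule the1_equality[OF decomposition[OF ac]]) (use f fin eq in blast)
  then show ?thesis unfolding component_def by simp
qed

lemma zero_comp [simp]: "\<zero> \<in> \<A> i"
  using component_subgroup additive_subgroup.zero_closed by metis

lemma component_homogeneous:
  assumes "a \<in> \<A> n" shows "component m a = (if m = n then a else \<zero>)"
  by (rule component_unique[where F = "{n}"])
     (use assms comp_carrier in \<open>auto simp: finsum_insert\<close>)

lemma component_zero [simp]: "component n \<zero> = \<zero>"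
  using component_homogeneous[of \<zero> n n] by simp

lemma component_sum':
  assumes "a \<in> carrier A" "finite F" "{i. component i a \<noteq> \<zero>} \<subseteq> F"
  shows "a = (\<Oplus>i\<in>F. component i a)"
  by (subst component_sum[OF assms(1)], rule add.finprod_mono_neutral_cong_left)
     (use assms in auto)

lemma component_add:
  assumes "a \<in> carrier A" "b \<in> carrier A"
  shows "component n (a \<oplus> b) = component n a \<oplus> component n b"
proof -
  let ?F = "{i. component i a \<noteq> \<zero>} \<union> {i. component i b \<noteq> \<zero>}"
  have F: "finite ?F" using component_finite assms by auto
  show ?thesis
  proof (rule component_unique[OF _ F])
    show "component i a \<oplus> component i b \<in> \<A> i" for i
      using component_in assms component_subgroup additive_subgroup.a_closed by metis
    show "\<And>i. i \<notin> ?F \<Longrightarrow> component i a \<oplus> component i b = \<zero>" by auto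
    have "(\<Oplus>i\<in>?F. component i a \<oplus> component i b)
        = (\<Oplus>i\<in>?F. component i a) \<oplus> (\<Oplus>i\<in>?F. component i b)"
      using assms by (intro finsum_addf) auto
    also have "\<dots> = a \<oplus> b"
      using component_sum'[OF assms(1) F] component_sum'[OF assms(2) F] by auto
    finally show "a \<oplus> b = (\<Oplus>i\<in>?F. component i a \<oplus> component i b)" by simp
  qed
qed

lemma component_neg:
  assumes "a \<in> carrier A" shows "component n (\<ominus> a) = \<ominus> component n a"
proof -
  have "component n (\<ominus> a) \<oplus> component n a = \<zero>"
    using component_add[of "\<ominus> a" a n] assms by (simp add: l_neg)
  then show ?thesis using assms minus_equality by simp
qed

lemma component_minus:
  "a \<in> carrier A \<Longrightarrow> b \<in> carrier A \<Longrightarrow> component n (a \<ominus> b) = component n a \<ominus> component n b"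
  by (simp add: a_minus_def component_add component_neg)

lemma component_eq_zeroD:
  assumes "a \<in> carrier A" "\<And>n. component n a = \<zero>" shows "a = \<zero>"
  using component_sum[OF assms(1)] assms(2) by simp

lemma carrier_eq_add_span: "carrier A = add_span (\<Union>n. \<A> n)"
proof
  have S: "(\<Union>n. \<A> n) \<subseteq> carrier A" using comp_carrier by auto
  show "carrier A \<subseteq> add_span (\<Union>n. \<A> n)"
  proof
    fix a assume a: "a \<in> carrier A"
    show "a \<in> add_span (\<Union>n. \<A> n)"
      by (subst component_sum[OF a], rule finsum_add_span)
         (use component_finite[OF a] S component_in[OF a] add_span_gen[OF S] in blast)+
  qed
  show "add_span (\<Union>n. \<A> n) \<subseteq> carrier A" using add_span_carrier[OF S] by blast
qed

lemma graded_induct [consumes 1, case_names zero add]: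
  assumes "a \<in> carrier A" "P \<zero>"
    and "\<And>n x y. x \<in> \<A> n \<Longrightarrow> y \<in> carrier A \<Longrightarrow> P y \<Longrightarrow> P (x \<oplus> y)"
  shows "P a"
proof -
  have "a \<in> add_span (\<Union>n. \<A> n)" using assms(1) carrier_eq_add_span by simp
  then show ?thesis
  proof (induction rule: add_span.induct)
    case zero
    then show ?case using assms(2) by simp
  next
    case (step x y)
    then show ?case using assms(3) carrier_eq_add_span by auto
  qed
qed

lemma component_mult_homogeneous:
  assumes "a \<in> carrier A" "b \<in> \<A> d"
  shows "component n (a \<otimes> b) = (if d \<le> n then component (n - d) a \<otimes> b else \<zero>)"
  using assms(1)
proof (induction rule: graded_induct)
  case zero
  then show ?case using assms(2) comp_carrier by simp
next
  case (add i x y)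
  have c: "x \<in> carrier A" "b \<in> carrier A" using add assms comp_carrier by auto
  have "component n (x \<otimes> b) = (if n = i + d then x \<otimes> b else \<zero>)"
    using component_homogeneous[OF component_mult[OF add(1) assms(2)]] by auto
  moreover have "component (n - d) x = (if n - d = i then x else \<zero>)"
    using component_homogeneous[OF add(1)] by auto
  ultimately show ?case using add c by (auto simp: component_add l_distr)
qed

end

section \<open>Homogeneous ideals\<close>

lemma (in ring) minus_self [simp]: "a \<in> carrier R \<Longrightarrow> a \<ominus> a = \<zero>"
  by (simp add: minus_eq r_neg)

lemma (in ring) minus_zero_right [simp]: "a \<in> carrier R \<Longrightarrow> a \<ominus> \<zero> = a"
  by (simp add: minus_eq)

context graded_cring
begin

lemma homogeneous_idealD:
  assumes "homogeneous_ideal A \<A> I" "a \<in> I"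
  shows "component n a \<in> I"
proof -
  have I: "ideal I A" and eq: "I = Idl (I \<inter> homogeneous_elements \<A>)"
    using assms by (auto simp: homogeneous_ideal_def)
  interpret ideal I A by fact
  let ?Y = "I \<inter> homogeneous_elements \<A>"
  have Y: "?Y \<subseteq> carrier A" using Icarr by auto
  have "a \<in> Idl ?Y" using assms(2) eq by simp
  with Y show ?thesis
  proof (induction rule: Idl_induct)
    case zero
    then show ?case by simp
  next
    case (add b y r)
    then obtain d where y: "y \<in> I" "y \<in> \<A> d" by (auto simp: homogeneous_elements_def)
    have "component n (b \<otimes> y) \<in> I"
      using y add(1) component_mult_homogeneous[OF add(1) y(2)] I_l_closed by simp
    then show ?case using add y Icarr by (simp add: component_add a_closed)
  qed
qed

lemma homogeneous_idealI:
  assumes "ideal I A" "\<And>a n. a \<in> I \<Longrightarrow> component n a \<in> I"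
  shows "homogeneous_ideal A \<A> I"
proof -
  interpret ideal I A by fact
  let ?Y = "I \<inter> homogeneous_elements \<A>"
  have Y: "?Y \<subseteq> carrier A" using Icarr by auto
  interpret J: ideal "Idl ?Y" A using Y by (rule genideal_ideal)
  have "a \<in> Idl ?Y" if a: "a \<in> I" for a
  proof -
    have "component i a \<in> Idl ?Y" for i
    proof -
      have "component i a \<in> ?Y"
        using assms(2)[OF a] component_in[OF Icarr[OF a]] by (auto simp: homogeneous_elements_def)
      then show ?thesis using genideal_self[OF Y] by blast
    qed
    then show ?thesis
      by (subst component_sum[OF Icarr[OF a]])
         (intro finsum_additive_subgroup J.additive_subgroup_axioms)
  qed
  moreover have "Idl ?Y \<subseteq> I" using genideal_minimal assms(1) by blast
  ultimately show ?thesis using assms(1) by (auto simp: homogeneous_ideal_def)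
qed

lemma ideal_contains_components_imp:
  assumes "ideal I A" "a \<in> carrier A" "\<And>n. component n a \<in> I"
  shows "a \<in> I"
  by (subst component_sum[OF assms(2)])
     (intro finsum_additive_subgroup ideal.axioms(1)[OF assms(1)] assms(3))

text \<open>In a sum of products \<open>b y\<close> with homogeneous \<open>y\<close>, the component of degree \<open>N\<close> only sees
  the component of complementary degree of each coefficient \<open>b\<close>.\<close>
lemma component_Idl_homogeneous:
  assumes Y: "Y \<subseteq> homogeneous_elements \<A>" and a: "a \<in> Idl Y"
  shows "component N a \<in> add_span {b \<otimes> y |b y d. y \<in> Y \<inter> \<A> d \<and> d \<le> N \<and> b \<in> \<A> (N - d)}"
proof -
  have Yc: "Y \<subseteq> carrier A" using Y comp_carrier by (auto simp: homogeneous_elements_def)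
  let ?S = "{b \<otimes> y |b y d. y \<in> Y \<inter> \<A> d \<and> d \<le> N \<and> b \<in> \<A> (N - d)}"
  have S: "?S \<subseteq> carrier A" using Yc comp_carrier by auto
  from Yc a show ?thesis
  proof (induction rule: Idl_induct)
    case zero
    then show ?case by (simp add: add_span.zero)
  next
    case (add b y t)
    define x where "x = b \<otimes> y"
    obtain d where "y \<in> \<A> d" using Y add(2) by (auto simp: homogeneous_elements_def)
    with add x_def have x: "x = b \<otimes> y" "b \<in> carrier A" "y \<in> Y" "y \<in> \<A> d" by auto
    have eq: "component N (b \<otimes> y \<oplus> t) = component N x \<oplus> component N t"
      unfolding x_def using add Yc by (intro component_add) auto
    show ?case
    proof (cases "d \<le> N")
      case True
      then have "component N x = component (N - d) b \<otimes> y"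
        using x component_mult_homogeneous by simp
      moreover have "component (N - d) b \<otimes> y \<in> ?S"
        using x True component_in by blast
      ultimately show ?thesis unfolding eq using add(4) by (simp only: add_span.step)
    next
      case False
      then have "component N x = \<zero>" using x component_mult_homogeneous by simp
      then show ?thesis unfolding eq using add(4) add_span_carrier[OF S add(4)] by (simp only: l_zero)
    qed
  qed
qed

lemma homogeneous_Idl:
  assumes "Y \<subseteq> homogeneous_elements \<A>"
  shows "homogeneous_ideal A \<A> (Idl Y)"
proof (rule homogeneous_idealI)
  have Yc: "Y \<subseteq> carrier A" using assms comp_carrier by (auto simp: homogeneous_elements_def)
  interpret J: ideal "Idl Y" A using Yc by (rule genideal_ideal)
  show "ideal (Idl Y) A" by (rule J.ideal_axioms)
  fix a n assume a: "a \<in> Idl Y"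
  have "{b \<otimes> y |b y d. y \<in> Y \<inter> \<A> d \<and> d \<le> n \<and> b \<in> \<A> (n - d)} \<subseteq> Idl Y"
    using J.I_l_closed genideal_self[OF Yc] comp_carrier by blast
  then show "component n a \<in> Idl Y"
    using component_Idl_homogeneous[OF assms a, of n] add_span_subset[OF J.additive_subgroup_axioms] by blast
qed

definition supported :: "nat set \<Rightarrow> 'a set" where
  "supported I = {a \<in> carrier A. \<forall>n. n \<notin> I \<longrightarrow> component n a = \<zero>}"

lemma supported_eq_add_span: "supported I = add_span (\<Union>n\<in>I. \<A> n)"
proof
  have S: "(\<Union>n\<in>I. \<A> n) \<subseteq> carrier A" using comp_carrier by auto
  show "supported I \<subseteq> add_span (\<Union>n\<in>I. \<A> n)"
  proof
    fix a assume "a \<in> supported I"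
    then have a: "a \<in> carrier A" "\<And>n. n \<notin> I \<Longrightarrow> component n a = \<zero>" by (auto simp: supported_def)
    have "component n a \<in> add_span (\<Union>n\<in>I. \<A> n)" for n
    proof (cases "n \<in> I")
      case True
      then have "component n a \<in> (\<Union>n\<in>I. \<A> n)" using component_in[OF a(1)] by blast
      then show ?thesis by (rule add_span_gen[OF S])
    next
      case False
      then show ?thesis using a(2) add_span.zero by simp
    qed
    then show "a \<in> add_span (\<Union>n\<in>I. \<A> n)"
      by (subst component_sum[OF a(1)], intro finsum_add_span component_finite[OF a(1)] S)
  qed
  show "add_span (\<Union>n\<in>I. \<A> n) \<subseteq> supported I"
  proof
    fix a assume "a \<in> add_span (\<Union>n\<in>I. \<A> n)"
    then show "a \<in> supported I"
    proof (induction rule: add_span.induct)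
      case zero
      then show ?case by (simp add: supported_def)
    next
      case (step x y)
      then obtain n where n: "n \<in> I" "x \<in> \<A> n" by auto
      then show ?case using step(3) comp_carrier
        by (auto simp: supported_def component_add component_homogeneous)
    qed
  qed
qed

lemma supported_mult:
  assumes a: "a \<in> supported I" and b: "b \<in> supported J"
    and IJ: "\<And>i j. i \<in> I \<Longrightarrow> j \<in> J \<Longrightarrow> i + j \<in> K"
  shows "a \<otimes> b \<in> supported K"
proof -
  have ac: "a \<in> carrier A" using a by (simp add: supported_def)
  have S: "(\<Union>n\<in>J. \<A> n) \<subseteq> carrier A" using comp_carrier by auto
  have "b \<in> add_span (\<Union>n\<in>J. \<A> n)" using b supported_eq_add_span by simp
  then show ?thesis
  proof (induction rule: add_span.induct)
    case zero
    then show ?case using ac by (simp add: supported_def)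
  next
    case (step x y)
    then obtain n where n: "n \<in> J" "x \<in> \<A> n" by auto
    have c: "x \<in> carrier A" "y \<in> carrier A" using n comp_carrier step add_span_carrier[OF S] by auto
    have "component l (a \<otimes> x) = \<zero>" if "l \<notin> K" for l
    proof -
      have "l - n \<notin> I \<or> \<not> n \<le> l" using IJ[of "l - n" n] n(1) that by auto
      then show ?thesis using a n c ac by (auto simp: component_mult_homogeneous supported_def)
    qed
    then show ?case using step(3) c ac by (auto simp: supported_def r_distr component_add)
  qed
qed

abbreviation order_ge :: "nat \<Rightarrow> 'a set" where "order_ge m \<equiv> supported {m..}"

abbreviation degree_le :: "nat \<Rightarrow> 'a set" where "degree_le m \<equiv> supported {..m}"

lemma order_ge_def: "order_ge m = {a \<in> carrier A. \<forall>n<m. component n a = \<zero>}"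
  by (auto simp: supported_def)

lemma degree_le_def: "degree_le m = {a \<in> carrier A. \<forall>n>m. component n a = \<zero>}"
  by (auto simp: supported_def)

lemma order_ge_mult: "a \<in> order_ge i \<Longrightarrow> b \<in> order_ge j \<Longrightarrow> a \<otimes> b \<in> order_ge (i + j)"
  by (erule (1) supported_mult) simp

lemma degree_le_mult: "a \<in> degree_le i \<Longrightarrow> b \<in> degree_le j \<Longrightarrow> a \<otimes> b \<in> degree_le (i + j)"
  by (erule (1) supported_mult) simp

text \<open>The lowest components of two elements multiply without interference.\<close>
lemma component_mult_order_ge:
  assumes a: "a \<in> order_ge i" and b: "b \<in> order_ge j"
  shows "component (i + j) (a \<otimes> b) = component i a \<otimes> component j b"
proof -
  have c: "a \<in> carrier A" "b \<in> carrier A" using a b by (auto simp: order_ge_def)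
  define b' where "b' = b \<ominus> component j b"
  have b': "b' \<in> order_ge (Suc j)"
    using b c component_in[OF c(2), of j]
    by (auto simp: order_ge_def b'_def component_minus component_homogeneous less_Suc_eq)
  have b'c: "b' \<in> carrier A" using b' by (simp add: order_ge_def)
  have bb: "b = component j b \<oplus> b'" unfolding b'_def using c
    by (simp add: minus_eq a_comm[of "component j b"] a_assoc l_neg)
  have "component (i + j) (a \<otimes> b) = component (i + j) (a \<otimes> component j b) \<oplus> component (i + j) (a \<otimes> b')"
    by (subst bb, subst r_distr) (use c b'c in \<open>simp_all add: component_add\<close>)
  also have "component (i + j) (a \<otimes> component j b) = component i a \<otimes> component j b"
    using component_mult_homogeneous[OF c(1) component_in[OF c(2), of j]] by simp
  also have "component (i + j) (a \<otimes> b') = \<zero>"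
    using order_ge_mult[OF a b'] by (simp add: order_ge_def)
  finally show ?thesis using c by simp
qed

lemma homogeneous_ideal_remainder:
  assumes I: "homogeneous_ideal A \<A> I" and a: "a \<in> carrier A" "\<And>n. n < m \<Longrightarrow> component n a \<in> I"
  obtains b where "b \<in> order_ge m" "a \<ominus> b \<in> I" "component m b = component m a"
proof -
  have ide: "ideal I A" using I by (simp add: homogeneous_ideal_def)
  interpret ideal I A by fact
  define s where "s = (\<Oplus>n\<in>{..<m}. component n a)"
  have s: "s \<in> I" unfolding s_def using a by (intro finsum_additive_subgroup additive_subgroup_axioms) auto
  have cs: "component n s = (if n < m then component n a else \<zero>)" for n
    by (rule component_unique[where F = "{..<m}"])
       (use a component_in in \<open>auto simp: s_def intro!: finsum_cong'\<close>)
  have "a \<ominus> s \<in> order_ge m"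
    using a s Icarr by (auto simp: order_ge_def component_minus cs)
  moreover have "a \<ominus> (a \<ominus> s) = s"
    using a s Icarr by (simp add: minus_eq minus_add a_assoc[symmetric] r_neg)
  moreover have "component m (a \<ominus> s) = component m a"
    using a s Icarr by (auto simp: component_minus cs)
  ultimately show ?thesis using that s by metis
qed

text \<open>For a homogeneous ideal, primality can be tested on homogeneous elements. Of two arbitrary
  elements outside the ideal, compare the first components outside it: the components below can be
  removed modulo the ideal, and then these two are the lowest ones.\<close>
lemma homogeneous_primeideal:
  assumes I: "homogeneous_ideal A \<A> I" and proper: "I \<noteq> carrier A"
    and pr: "\<And>i j a b. a \<in> \<A> i \<Longrightarrow> b \<in> \<A> j \<Longrightarrow> a \<otimes> b \<in> I \<Longrightarrow> a \<in> I \<or> b \<in> I"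
  shows "primeideal I A"
proof (rule primeidealI)
  show ide: "ideal I A" using I by (simp add: homogeneous_ideal_def)
  show "cring A" by (rule cring_axioms)
  show "carrier A \<noteq> I" using proper by simp
  interpret ideal I A by fact
  have ex: "\<exists>m a'. a' \<in> order_ge m \<and> a \<ominus> a' \<in> I \<and> component m a' \<notin> I"
    if a: "a \<in> carrier A" "a \<notin> I" for a
  proof -
    define m where "m = (LEAST n. component n a \<notin> I)"
    have "\<exists>n. component n a \<notin> I" using ideal_contains_components_imp[OF ide a(1)] a(2) by blast
    then have m: "component m a \<notin> I" "\<And>n. n < m \<Longrightarrow> component n a \<in> I"
      unfolding m_def using LeastI_ex not_less_Least by metis+
    show ?thesis using homogeneous_ideal_remainder[OF I a(1) m(2)] m(1) by metis
  qed
  fix a b assume a: "a \<in> carrier A" and b: "b \<in> carrier A" and ab: "a \<otimes> b \<in> I"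
  show "a \<in> I \<or> b \<in> I"
  proof (rule ccontr)
    assume "\<not> ?thesis"
    then obtain m a' n b' where a': "a' \<in> order_ge m" "a \<ominus> a' \<in> I" "component m a' \<notin> I"
      and b': "b' \<in> order_ge n" "b \<ominus> b' \<in> I" "component n b' \<notin> I"
      using ex[OF a] ex[OF b] by blast
    have c: "a' \<in> carrier A" "b' \<in> carrier A" using a' b' by (auto simp: order_ge_def)
    have "a' \<otimes> b' = a \<otimes> b \<ominus> ((a \<ominus> a') \<otimes> b \<oplus> a' \<otimes> (b \<ominus> b'))"
      using a b c by algebra
    then have "a' \<otimes> b' \<in> I"
      using ab a' b' c b I_l_closed I_r_closed additive_subgroup_minus[OF additive_subgroup_axioms]
      by auto
    then have "component m a' \<otimes> component n b' \<in> I"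
      using homogeneous_idealD[OF I] component_mult_order_ge[OF a'(1) b'(1)] by metis
    then show False using pr component_in c a' b' by metis
  qed
qed

text \<open>The largest homogeneous ideal inside a prime is again prime. This is how primes found by
  ideal-theoretic means are made into points of Proj.\<close>
lemma homogeneous_core:
  assumes "primeideal P A"
  defines "P' \<equiv> {a \<in> carrier A. \<forall>n. component n a \<in> P}"
  shows "primeideal P' A" "homogeneous_ideal A \<A> P'" "P' \<subseteq> P"
    "\<And>I. homogeneous_ideal A \<A> I \<Longrightarrow> I \<subseteq> P \<Longrightarrow> I \<subseteq> P'"
proof -
  interpret P: primeideal P A by fact
  have ide: "ideal P' A"
  proof (rule idealI[OF ring_axioms])
    show "subgroup P' (add_monoid A)"
      by (rule add.subgroupI)
         (auto simp: P'_def component_add component_neg simp flip: a_inv_def intro: exI[of _ \<zero>])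
    fix a x assume a: "a \<in> P'" and x: "x \<in> carrier A"
    then have ac: "a \<in> carrier A" by (simp add: P'_def)
    from x have "a \<otimes> x \<in> P'"
    proof (induction rule: graded_induct)
      case zero
      then show ?case using ac by (simp add: P'_def)
    next
      case (add n s t)
      then show ?case using a comp_carrier P.I_r_closed
        by (auto simp: P'_def r_distr component_add component_mult_homogeneous)
    qed
    then show "a \<otimes> x \<in> P'" "x \<otimes> a \<in> P'" using m_comm x ac by auto
  qed
  show hom: "homogeneous_ideal A \<A> P'"
    by (rule homogeneous_idealI[OF ide])
       (auto simp: P'_def component_homogeneous[OF component_in])
  show sub: "P' \<subseteq> P"
    using ideal_contains_components_imp[OF P.ideal_axioms] by (auto simp: P'_def)
  show "I \<subseteq> P'" if "homogeneous_ideal A \<A> I" "I \<subseteq> P" for I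
    using that homogeneous_idealD ideal.Icarr by (fastforce simp: P'_def homogeneous_ideal_def)
  show "primeideal P' A"
  proof (rule homogeneous_primeideal[OF hom])
    show "P' \<noteq> carrier A" using sub P.I_notcarr P.Icarr by blast
    have hP: "a \<in> P' \<longleftrightarrow> a \<in> P" if "a \<in> \<A> i" for a i
      using that comp_carrier by (auto simp: P'_def component_homogeneous)
    fix i j a b assume "a \<in> \<A> i" "b \<in> \<A> j" "a \<otimes> b \<in> P'"
    then show "a \<in> P' \<or> b \<in> P'" using hP component_mult comp_carrier P.I_prime by metis
  qed
qed

end

section \<open>Chains of primes, and monomials\<close>

lemma length_le_chain_dim:
  assumes "\<And>i. i \<le> n \<Longrightarrow> C i \<in> F" "\<And>i. i < n \<Longrightarrow> C i \<subset> C (Suc i)"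
  shows "enat n \<le> chain_dim F"
  unfolding chain_dim_def by (rule SUP_upper) (use assms in blast)

text \<open>A finite supremum of natural numbers belongs to the set.\<close>
lemma chain_dim_attained:
  assumes "chain_dim F = enat r" "F \<noteq> {}"
  obtains C where "\<And>i. i \<le> r \<Longrightarrow> C i \<in> F" "\<And>i. i < r \<Longrightarrow> C i \<subset> C (Suc i)"
proof -
  let ?S = "{n. \<exists>C :: nat \<Rightarrow> 'a set. (\<forall>i\<le>n. C i \<in> F) \<and> (\<forall>i<n. C i \<subset> C (Suc i))}"
  have "r \<in> ?S"
  proof (rule ccontr)
    assume r: "r \<notin> ?S"
    obtain X where "X \<in> F" using assms(2) by blast
    have "0 \<in> ?S"
      by (intro CollectI, intro exI[where x = "\<lambda>_. X"]) (simp add: \<open>X \<in> F\<close>)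
    then have "r \<noteq> 0" using r by (intro notI) simp
    then have r0: "r > 0" by simp
    have "enat n \<le> enat (r - 1)" if "n \<in> ?S" for n
    proof -
      have "enat n \<le> enat r" using SUP_upper[OF that, of enat] assms(1) unfolding chain_dim_def by simp
      moreover have "n \<noteq> r" using that r by blast
      ultimately show ?thesis by simp
    qed
    then have "chain_dim F \<le> enat (r - 1)" unfolding chain_dim_def by (rule SUP_least)
    then show False using assms(1) r0 by simp
  qed
  then show ?thesis using that by blast
qed

lemma chain_dim_leI:
  assumes "\<And>C :: nat \<Rightarrow> 'a set. \<lbrakk>\<And>i. i \<le> Suc n \<Longrightarrow> C i \<in> F; \<And>i. i < Suc n \<Longrightarrow> C i \<subset> C (Suc i)\<rbrakk> \<Longrightarrow> False"
  shows "chain_dim F \<le> enat n"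
  unfolding chain_dim_def
proof (rule SUP_least)
  fix m assume "m \<in> {n. \<exists>C :: nat \<Rightarrow> 'a set. (\<forall>i\<le>n. C i \<in> F) \<and> (\<forall>i<n. C i \<subset> C (Suc i))}"
  then obtain C :: "nat \<Rightarrow> 'a set" where C: "\<forall>i\<le>m. C i \<in> F" "\<forall>i<m. C i \<subset> C (Suc i)" by blast
  show "enat m \<le> enat n"
  proof (rule ccontr)
    assume "\<not> ?thesis"
    then have "Suc n \<le> m" by simp
    then show False using assms[of C] C by auto
  qed
qed

text \<open>Every chain of primes inside \<open>q\<close> is lengthened by \<open>p\<close>.\<close>
lemma height_strict_mono:
  assumes "primeideal q A" "primeideal p A" "q \<subset> p" "height A p = enat r"
  shows "\<exists>r'<r. height A q = enat r'"
proof -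
  have ext: "n < r" if C: "\<forall>i\<le>n. C i \<in> {P. primeideal P A \<and> P \<subseteq> q}" "\<forall>i<n. C i \<subset> C (Suc i)" for n C
  proof -
    let ?C = "\<lambda>i. if i \<le> n then C i else p"
    have "enat (Suc n) \<le> height A p" unfolding height_def
    proof (rule length_le_chain_dim)
      show "?C i \<in> {P. primeideal P A \<and> P \<subseteq> p}" if "i \<le> Suc n" for i
        using C(1) assms by auto
      show "?C i \<subset> ?C (Suc i)" if "i < Suc n" for i
      proof (cases "i = n")
        case True
        then have "C i \<subseteq> q" using C(1) by auto
        then show ?thesis using True assms(3) by auto
      next
        case False
        then show ?thesis using that C(2) by auto
      qed
    qed
    then show ?thesis using assms(4) by simp
  qed
  have r0: "0 < r" using ext[of 0 "\<lambda>_. q"] assms(1) by simp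
  have "height A q \<le> enat (r - 1)" unfolding height_def
  proof (rule chain_dim_leI)
    fix C assume "\<And>i. i \<le> Suc (r - 1) \<Longrightarrow> C i \<in> {P. primeideal P A \<and> P \<subseteq> q}"
      "\<And>i. i < Suc (r - 1) \<Longrightarrow> C i \<subset> C (Suc i)"
    then have "Suc (r - 1) < r" using ext[of "Suc (r - 1)" C] by auto
    then show False by simp
  qed
  then show ?thesis using r0 by (metis Suc_pred' enat_ile le_imp_less_Suc enat_ord_simps(1))
qed

context cring
begin

text \<open>Exponent vectors are multisets of indices: the sum of vectors is the sum of multisets,
  divisibility of monomials is inclusion, and the multiset order serves as a monomial order.\<close>
definition powprod :: "(nat \<Rightarrow> 'a) \<Rightarrow> nat multiset \<Rightarrow> 'a" where
  "powprod h \<alpha> = (\<Otimes>i\<in>set_mset \<alpha>. h i [^] count \<alpha> i)"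

context
  fixes h :: "nat \<Rightarrow> 'a"
  assumes h_fun: "h \<in> UNIV \<rightarrow> carrier R"
begin

lemma base_closed: "h i \<in> carrier R"
  using h_fun by auto

lemma powprod_closed [simp]: "powprod h \<alpha> \<in> carrier R"
  unfolding powprod_def using base_closed by (intro finprod_closed) auto

lemma powprod_empty [simp]: "powprod h {#} = \<one>"
  by (simp add: powprod_def)

lemma powprod_add_mset: "powprod h (add_mset i \<alpha>) = h i \<otimes> powprod h \<alpha>"
proof -
  let ?f = "\<lambda>\<alpha> j. h j [^] count \<alpha> j"
  have ext: "powprod h \<beta> = (\<Otimes>j\<in>insert i (set_mset \<alpha>). ?f \<beta> j)"
    if "set_mset \<beta> \<subseteq> insert i (set_mset \<alpha>)" for \<beta>
    unfolding powprod_def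
    by (rule finprod_mono_neutral_cong_left) (use that base_closed in \<open>auto simp: not_in_iff\<close>)
  let ?T = "set_mset \<alpha> - {i}"
  have split: "(\<Otimes>j\<in>insert i (set_mset \<alpha>). ?f \<beta> j) = ?f \<beta> i \<otimes> (\<Otimes>j\<in>?T. ?f \<beta> j)" for \<beta>
    using finprod_insert[of ?T i "?f \<beta>"] base_closed by (simp add: Pi_def)
  have eq: "(\<Otimes>j\<in>?T. ?f (add_mset i \<alpha>) j) = (\<Otimes>j\<in>?T. ?f \<alpha> j)"
    by (rule finprod_cong') (use base_closed in auto)
  have c: "(\<Otimes>j\<in>?T. ?f \<alpha> j) \<in> carrier R" using base_closed by (intro finprod_closed) auto
  show ?thesis
    using ext[of "add_mset i \<alpha>"] ext[of \<alpha>, OF subset_insertI] split[of "add_mset i \<alpha>"] split[of \<alpha>] eq base_closed[of i] c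
    by (simp add: m_ac)
qed

lemma powprod_single [simp]: "powprod h {#i#} = h i"
  using base_closed by (simp add: powprod_add_mset)

lemma powprod_union: "powprod h (\<alpha> + \<beta>) = powprod h \<alpha> \<otimes> powprod h \<beta>"
  by (induction \<alpha>) (use base_closed in \<open>auto simp: powprod_add_mset m_assoc\<close>)

lemma powprod_subset:
  assumes "\<beta> \<subseteq># \<alpha>" shows "powprod h \<alpha> = powprod h (\<alpha> - \<beta>) \<otimes> powprod h \<beta>"
  using powprod_union[of "\<alpha> - \<beta>" \<beta>] assms by simp

lemma powprod_replicate: "powprod h (replicate_mset n i) = h i [^] n"
  by (induction n) (use base_closed in \<open>auto simp: powprod_add_mset m_comm nat_pow_mult\<close>)

lemma pow_dvd_powprod:
  "\<exists>b\<in>carrier R. powprod h \<alpha> = b \<otimes> h i [^] count \<alpha> i"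
proof -
  have "replicate_mset (count \<alpha> i) i \<subseteq># \<alpha>" by (simp flip: count_le_replicate_mset_subset_eq)
  then show ?thesis using powprod_subset powprod_replicate powprod_closed by metis
qed

end

end

lemma (in graded_cring) powprod_homogeneous:
  assumes "\<And>i. h i \<in> \<A> (c i)" "\<one> \<in> \<A> 0"
  shows "powprod h \<alpha> \<in> \<A> (sum_mset (image_mset c \<alpha>))"
proof -
  have "h \<in> UNIV \<rightarrow> carrier A" using assms comp_carrier by blast
  then show ?thesis
    by (induction \<alpha>) (use assms component_mult in \<open>auto simp: powprod_add_mset\<close>)
qed

section \<open>The irrelevant ideal of a standard graded algebra\<close>

context standard_graded_algebra
begin

abbreviation mm :: "'a set" where "mm \<equiv> irrelevant_ideal A xs"

lemma subring_k: "subring k A"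
  using subfieldE(1)[OF base_subfield] .

lemmas k_props = subringE[OF subring_k]

lemma k_unit:
  assumes "u \<in> k" "u \<noteq> \<zero>"
  shows "inv u \<in> k" "inv u \<otimes> u = \<one>"
  using subfield_m_inv[OF base_subfield, of u] assms by auto

lemma one_neq_zero: "\<one> \<noteq> \<zero>"
  using subfieldE(6)[OF base_subfield] .

lemma one_comp: "\<one> \<in> \<A> 0"
  using component_0 k_props(3) by simp

lemma ideal_unit:
  assumes "ideal I A" "u \<in> k" "u \<noteq> \<zero>" "u \<in> I"
  shows "I = carrier A"
proof -
  have "inv u \<otimes> u \<in> I"
    using ideal.I_l_closed[OF assms(1,4)] k_unit[OF assms(2,3)] k_props(1) by blast
  then show ?thesis using k_unit[OF assms(2,3)] ideal.one_imp_carrier[OF assms(1)] by simp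
qed

lemma prime_Int_k:
  assumes "primeideal P A" "u \<in> k" "u \<in> P" shows "u = \<zero>"
  using ideal_unit[OF primeideal.axioms(1)[OF assms(1)] assms(2) _ assms(3)]
    primeideal.I_notcarr[OF assms(1)] by auto

lemma xs_carrier: "set xs \<subseteq> carrier A"
  using gens_degree_1 comp_carrier by auto

definition products :: "nat \<Rightarrow> 'a set" where
  "products n = {x \<otimes> b |x b. x \<in> set xs \<and> b \<in> \<A> n}"

lemma products_subset: "products n \<subseteq> \<A> (Suc n)"
  unfolding products_def using component_mult[of _ 1 _ n] gens_degree_1 by auto

lemma products_neg: "x \<in> products n \<Longrightarrow> \<ominus> x \<in> products n"
proof -
  assume "x \<in> products n"
  then obtain y b where x: "x = y \<otimes> b" "y \<in> set xs" "b \<in> \<A> n" by (auto simp: products_def)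
  have "\<ominus> x = y \<otimes> (\<ominus> b)" using x xs_carrier comp_carrier by (simp add: r_minus subsetD)
  moreover have "\<ominus> b \<in> \<A> n"
    using additive_subgroup.a_inv_closed[OF component_subgroup x(3)] .
  ultimately show ?thesis using x unfolding products_def by blast
qed

lemma products_mult:
  assumes "a \<in> add_span (products n)" "b \<in> \<A> m"
  shows "a \<otimes> b \<in> add_span (products (n + m))"
proof -
  have S: "products n \<subseteq> carrier A" using products_subset comp_carrier by blast
  have b: "b \<in> carrier A" using assms comp_carrier by auto
  from assms(1) show ?thesis
  proof (induction rule: add_span.induct)
    case zero
    then show ?case using b by (simp add: add_span.zero)
  next
    case (step x t)
    then obtain y c where x: "x = y \<otimes> c" "y \<in> set xs" "c \<in> \<A> n" by (auto simp: products_def)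
    have "x \<otimes> b = y \<otimes> (c \<otimes> b)" using x xs_carrier comp_carrier b by (simp add: m_assoc subsetD)
    then have "x \<otimes> b \<in> products (n + m)"
      unfolding products_def using x component_mult[OF x(3) assms(2)] by blast
    moreover have "(x \<oplus> t) \<otimes> b = x \<otimes> b \<oplus> t \<otimes> b"
      using x step S add_span_carrier[OF S step(2)] b by (intro l_distr) auto
    ultimately show ?case using step(3) by (simp only: add_span.step)
  qed
qed

text \<open>The elements whose components of positive degree are sums of products of a generator with an
  element one degree below form a subring; it contains \<open>k\<close> and the generators, so it is everything.\<close>
lemma comp_Suc:
  assumes "a \<in> \<A> (Suc n)" shows "a \<in> add_span (products n)"
proof -
  have S: "products n \<subseteq> carrier A" for n using products_subset comp_carrier by blast
  define G where "G = (\<lambda>n. case n of 0 \<Rightarrow> k | Suc m \<Rightarrow> add_span (products m))"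
  have Gsub: "additive_subgroup (G n) A" for n
    unfolding G_def using component_subgroup[of 0] component_0 add_span_additive_subgroup[OF S] products_neg
    by (cases n) auto
  have GA: "G n \<subseteq> \<A> n" for n
    unfolding G_def using component_0 add_span_subset[OF component_subgroup products_subset]
    by (cases n) auto
  have Gmult: "a \<otimes> b \<in> G (i + j)" if "a \<in> G i" "b \<in> G j" for a b i j
  proof -
    have *: "a \<otimes> b \<in> G (i + j)" if ab: "a \<in> G i" "b \<in> G j" "i \<noteq> 0" for a b i j
    proof -
      obtain l where l: "i = Suc l" using ab(3) by (cases i) auto
      then have "a \<in> add_span (products l)" "b \<in> \<A> j" using ab GA by (auto simp: G_def)
      then show ?thesis using products_mult l by (auto simp: G_def)
    qed
    show ?thesis
    proof (cases "i = 0 \<and> j = 0")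
      case True
      then show ?thesis using that k_props(6) by (simp add: G_def)
    next
      case False
      have "a \<otimes> b = b \<otimes> a" using that GA comp_carrier m_comm by blast
      then show ?thesis using False *[OF that] *[OF that(2,1)] by (metis add.commute)
    qed
  qed
  define X where "X = {a \<in> carrier A. \<forall>n. component n a \<in> G n}"
  have GX: "a \<in> X" if "a \<in> G n" for a n
    using that GA Gsub comp_carrier additive_subgroup.zero_closed
    by (fastforce simp: X_def component_homogeneous subset_iff)
  have Xsub: "additive_subgroup X A"
  proof (intro additive_subgroup.intro add.subgroupI)
    show "X \<subseteq> carrier A" by (auto simp: X_def)
    show "X \<noteq> {}" using additive_subgroup.zero_closed[OF Gsub] by (auto simp: X_def intro!: exI[of _ \<zero>])
    show "\<ominus> a \<in> X" if "a \<in> X" for a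
      using that additive_subgroup.a_inv_closed[OF Gsub] by (auto simp: X_def component_neg simp flip: a_inv_def)
    show "a \<oplus> b \<in> X" if "a \<in> X" "b \<in> X" for a b
      using that additive_subgroup.a_closed[OF Gsub] by (auto simp: X_def component_add)
  qed
  have Xmult: "a \<otimes> b \<in> X" if ab: "a \<in> X" "b \<in> X" for a b
  proof -
    have c: "a \<in> carrier A" "b \<in> carrier A" using ab by (auto simp: X_def)
    let ?F = "{i. component i a \<noteq> \<zero>}" and ?H = "{i. component i b \<noteq> \<zero>}"
    have "a \<otimes> b = (\<Oplus>i\<in>?F. component i a) \<otimes> (\<Oplus>i\<in>?H. component i b)"
      using component_sum c by metis
    also have "\<dots> = (\<Oplus>i\<in>?F. component i a \<otimes> (\<Oplus>j\<in>?H. component j b))"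
      using c component_finite by (intro finsum_ldistr) auto
    also have "\<dots> = (\<Oplus>i\<in>?F. \<Oplus>j\<in>?H. component i a \<otimes> component j b)"
      using c component_finite by (intro finsum_cong' finsum_rdistr) auto
    also have "\<dots> \<in> X"
    proof (intro finsum_additive_subgroup[OF Xsub])
      fix i j
      have "component i a \<in> G i" "component j b \<in> G j" using ab by (auto simp: X_def)
      then show "component i a \<otimes> component j b \<in> X" using GX Gmult by blast
    qed
    finally show ?thesis .
  qed
  have "subring X A"
    using Xmult GX[of \<one> 0] k_props(3) additive_subgroup.a_closed[OF Xsub] additive_subgroup.a_inv_closed[OF Xsub]
    by (intro subringI) (auto simp: G_def, auto simp: X_def)
  moreover have "set xs \<subseteq> X"
  proof
    fix x assume x: "x \<in> set xs"
    then have "x = x \<otimes> \<one>" using xs_carrier by auto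
    then have "x \<in> products 0" using x one_comp unfolding products_def by blast
    then have "x \<in> G (Suc 0)" using add_span_gen[OF S] by (simp add: G_def)
    then show "x \<in> X" by (rule GX)
  qed
  moreover have "k \<subseteq> X" using GX[of _ 0] by (auto simp: G_def)
  ultimately have "carrier A \<subseteq> X"
    using generate_ring_min_subring1[of "k \<union> set xs" X] generated xs_carrier k_props(1) by auto
  then have "component (Suc n) a \<in> G (Suc n)" using assms comp_carrier by (auto simp: X_def)
  then show ?thesis using assms by (simp add: component_homogeneous G_def)
qed

lemma component_0_mult:
  assumes "a \<in> carrier A" "b \<in> carrier A"
  shows "component 0 (a \<otimes> b) = component 0 a \<otimes> component 0 b"
  using component_mult_order_ge[of a 0 b 0] assms by (simp add: supported_def)

lemma ideal_mm: "ideal mm A"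
  unfolding irrelevant_ideal_def using xs_carrier by (rule genideal_ideal)

lemma positive_degree_in_mm:
  assumes "a \<in> \<A> n" "n > 0" shows "a \<in> mm"
proof -
  interpret ideal mm A by (rule ideal_mm)
  obtain m where m: "n = Suc m" using assms(2) gr0_implies_Suc by blast
  have "products m \<subseteq> mm"
    unfolding products_def using genideal_self[OF xs_carrier] comp_carrier I_r_closed
    by (auto simp: irrelevant_ideal_def)
  then show ?thesis using comp_Suc assms(1) m add_span_subset[OF additive_subgroup_axioms] by blast
qed

lemma mm_eq: "mm = {a \<in> carrier A. component 0 a = \<zero>}"
proof
  interpret ideal mm A by (rule ideal_mm)
  have "ideal {a \<in> carrier A. component 0 a = \<zero>} A"
    by (rule idealI[OF ring_axioms], rule add.subgroupI)
       (auto simp: component_add component_neg component_0_mult simp flip: a_inv_def)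
  moreover have "set xs \<subseteq> {a \<in> carrier A. component 0 a = \<zero>}"
    using gens_degree_1 comp_carrier component_homogeneous[of _ 1 0] by auto
  ultimately show "mm \<subseteq> {a \<in> carrier A. component 0 a = \<zero>}"
    unfolding irrelevant_ideal_def by (rule genideal_minimal)
  show "{a \<in> carrier A. component 0 a = \<zero>} \<subseteq> mm"
  proof safe
    fix a assume a: "a \<in> carrier A" "component 0 a = \<zero>"
    have "component n a \<in> mm" for n
      using a component_in positive_degree_in_mm[of "component n a" n] by (cases "n = 0") auto
    then show "a \<in> mm" using ideal_contains_components_imp[OF ideal_mm a(1)] by blast
  qed
qed

lemma component_0_in_k: "a \<in> carrier A \<Longrightarrow> component 0 a \<in> k"
  using component_in[of a 0] component_0 by simp

text \<open>The irrelevant ideal is maximal: modulo it, every element is a constant, and nonzero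
  constants are units.\<close>
lemma ideal_not_in_mm:
  assumes "ideal J A" "mm \<subset> J" shows "J = carrier A"
proof -
  interpret J: ideal J A by fact
  obtain a where a: "a \<in> J" "a \<notin> mm" using assms by blast
  have ac: "a \<in> carrier A" using a by auto
  have "a \<ominus> component 0 a \<in> mm"
    using ac by (auto simp: mm_eq component_minus component_homogeneous[OF component_in])
  then have "a \<ominus> (a \<ominus> component 0 a) \<in> J"
    using assms a additive_subgroup_minus[OF J.additive_subgroup_axioms] by blast
  moreover have "a \<ominus> (a \<ominus> component 0 a) = component 0 a" using ac
    by (simp add: minus_eq minus_add a_assoc[symmetric] r_neg)
  ultimately show ?thesis
    using ideal_unit[OF assms(1) component_0_in_k[OF ac]] a ac by (auto simp: mm_eq)
qed

lemma primeideal_mm: "primeideal mm A"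
proof (rule primeidealI[OF ideal_mm cring_axioms])
  show "carrier A \<noteq> mm"
  proof
    assume "carrier A = mm"
    then have "\<one> \<in> mm" using one_closed by blast
    then have "component 0 \<one> = \<zero>" by (simp add: mm_eq)
    then show False using one_neq_zero component_homogeneous[OF one_comp, of 0] by simp
  qed
  fix a b assume ab: "a \<in> carrier A" "b \<in> carrier A" "a \<otimes> b \<in> mm"
  then have "component 0 a \<otimes> component 0 b = \<zero>" by (simp add: mm_eq component_0_mult)
  then show "a \<in> mm \<or> b \<in> mm"
    using ab component_0_in_k subfieldE(5)[OF base_subfield] by (auto simp: mm_eq)
qed

lemma homogeneous_prime_in_mm:
  assumes "primeideal p A" "homogeneous_ideal A \<A> p"
  shows "p \<subseteq> mm"
proof
  fix a assume a: "a \<in> p"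
  then have ac: "a \<in> carrier A" using ideal.Icarr primeideal.axioms(1)[OF assms(1)] by metis
  have "component 0 a = \<zero>"
    using homogeneous_idealD[OF assms(2) a] component_0_in_k[OF ac] prime_Int_k[OF assms(1)] by blast
  then show "a \<in> mm" using ac by (simp add: mm_eq)
qed

lemma relevant_primesD:
  assumes "p \<in> relevant_primes A \<A> xs"
  shows "primeideal p A" "homogeneous_ideal A \<A> p" "p \<subset> mm" "ideal p A"
  using assms homogeneous_prime_in_mm by (auto simp: relevant_primes_def homogeneous_ideal_def)

text \<open>The graded form of the fact that elements outside the maximal ideal of a local ring are
  units: only the degree zero part of \<open>c\<close> matters in the degree of \<open>b\<close>.\<close>
lemma homogeneous_cancel_unit:
  assumes J: "homogeneous_ideal A \<A> J" and b: "b \<in> \<A> d"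
    and c: "c \<in> carrier A" "c \<notin> mm" and cb: "c \<otimes> b \<in> J"
  shows "b \<in> J"
proof -
  interpret ideal J A using J by (simp add: homogeneous_ideal_def)
  have "component 0 c \<otimes> b \<in> J"
    using homogeneous_idealD[OF J cb, of d] component_mult_homogeneous[OF c(1) b, of d] by simp
  moreover have u: "component 0 c \<in> k" "component 0 c \<noteq> \<zero>" using c component_0_in_k by (auto simp: mm_eq)
  ultimately have "inv (component 0 c) \<otimes> (component 0 c \<otimes> b) \<in> J"
    using I_l_closed k_unit k_props(1) by blast
  moreover have "inv (component 0 c) \<otimes> (component 0 c \<otimes> b) = b"
    using k_unit[OF u] u k_props(1) comp_carrier[OF b] by (simp add: m_assoc[symmetric] subset_iff)
  ultimately show ?thesis by simp
qed

end

section \<open>Linear dependence modulo a prime, and exponent vectors\<close>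

context cring
begin

lemma Idl_insertE:
  assumes "q \<in> carrier R" "S \<subseteq> carrier R" "a \<in> Idl (insert q S)"
  obtains b a' where "b \<in> carrier R" "a' \<in> Idl S" "a = b \<otimes> q \<oplus> a'"
proof -
  have I: "ideal (PIdl q) R" "ideal (Idl S) R"
    using cgenideal_ideal genideal_ideal assms by auto
  interpret I1: ideal "PIdl q" R by fact
  interpret I2: ideal "Idl S" R by fact
  have "insert q S \<subseteq> PIdl q \<union> Idl S"
    using cgenideal_self[OF assms(1)] genideal_self[OF assms(2)] by blast
  also have "\<dots> \<subseteq> Idl (PIdl q \<union> Idl S)"
    using I1.Icarr I2.Icarr by (intro genideal_self) blast
  also have "\<dots> = PIdl q <+> Idl S" by (rule union_genideal[OF I])
  finally have "insert q S \<subseteq> PIdl q <+> Idl S" .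
  then have "a \<in> PIdl q <+> Idl S"
    using genideal_minimal[OF add_ideals[OF I]] assms(3) by blast
  then show ?thesis using that unfolding set_add_def' cgenideal_def by auto
qed

text \<open>In a module with fewer than \<open>n\<close> generators, any \<open>n\<close> elements are dependent over the residue
  field at \<open>p\<close>. The proof eliminates one generator after the other, as in Gaussian elimination. The
  conclusion is stated with an additive subgroup \<open>X\<close> containing all products of \<open>p\<close> with the ideal,
  instead of that product itself. It is applied twice: with the irrelevant ideal for \<open>p\<close> it gives
  Nakayama's lemma, and with a relevant prime it bounds a number of generators from below.\<close>
lemma dependent_modulo_prime:
  fixes I :: "'i set"
  assumes p: "primeideal p R" and X: "additive_subgroup X R"
    and qs: "set qs \<subseteq> carrier R" and I: "finite I" "length qs < card I"
    and y: "\<And>i. i \<in> I \<Longrightarrow> y i \<in> Idl (set qs)"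
    and pX: "\<And>a q. a \<in> p \<Longrightarrow> q \<in> Idl (set qs) \<Longrightarrow> a \<otimes> q \<in> X"
  shows "\<exists>\<kappa>. (\<forall>i. \<kappa> i \<in> carrier R) \<and> (\<exists>i\<in>I. \<kappa> i \<notin> p) \<and> (\<Oplus>i\<in>I. \<kappa> i \<otimes> y i) \<in> X"
  using qs I y pX
proof (induction qs arbitrary: I y)
  case Nil
  interpret p: primeideal p R by fact
  interpret X: additive_subgroup X R by fact
  have "Idl (set []) \<subseteq> {\<zero>}" using genideal_minimal[OF zeroideal, of "{}"] by simp
  then have "y i = \<zero>" if "i \<in> I" for i using Nil(4)[OF that] by auto
  then have "(\<Oplus>i\<in>I. \<one> \<otimes> y i) = \<zero>" by (intro add.finprod_one_eqI) simp
  moreover have "\<one> \<notin> p" using p.one_imp_carrier p.I_notcarr by blast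
  moreover obtain i where "i \<in> I" using Nil(3) by fastforce
  ultimately have "(\<forall>i. (\<lambda>_. \<one>) i \<in> carrier R) \<and> (\<exists>i\<in>I. (\<lambda>_. \<one>) i \<notin> p) \<and> (\<Oplus>i\<in>I. (\<lambda>_. \<one>) i \<otimes> y i) \<in> X"
    by auto
  then show ?case by (rule exI[where x = "\<lambda>_. \<one>"])
next
  case (Cons q qs)
  interpret p: primeideal p R by fact
  interpret X: additive_subgroup X R by fact
  have q: "q \<in> carrier R" "set qs \<subseteq> carrier R" using Cons by auto
  interpret J: ideal "Idl (set qs)" R using q by (intro genideal_ideal)
  have sub: "Idl (set qs) \<subseteq> Idl (set (q # qs))"
    using subset_Idl_subset[of "set (q # qs)" "set qs"] q by auto
  have qin: "q \<in> Idl (set (q # qs))" using genideal_self[of "set (q # qs)"] q by auto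
  have "\<exists>b y'. b \<in> carrier R \<and> y' \<in> Idl (set qs) \<and> y i = b \<otimes> q \<oplus> y'" if "i \<in> I" for i
  proof -
    have "y i \<in> Idl (insert q (set qs))" using Cons(5)[OF that] by simp
    then show ?thesis by (rule Idl_insertE[OF q]) blast
  qed
  then have "\<forall>i\<in>I. \<exists>b y'. b \<in> carrier R \<and> y' \<in> Idl (set qs) \<and> y i = b \<otimes> q \<oplus> y'" by blast
  from bchoice[OF this] obtain b where
    "\<forall>i\<in>I. \<exists>y'. b i \<in> carrier R \<and> y' \<in> Idl (set qs) \<and> y i = b i \<otimes> q \<oplus> y'" by blast
  from bchoice[OF this] obtain y' where
    by': "\<And>i. i \<in> I \<Longrightarrow> b i \<in> carrier R \<and> y' i \<in> Idl (set qs) \<and> y i = b i \<otimes> q \<oplus> y' i" by blast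
  show ?case
  proof (cases "\<forall>i\<in>I. b i \<in> p")
    case True
    have "length qs < card I" using Cons(4) by simp
    then obtain \<kappa> where \<kappa>: "\<And>i. \<kappa> i \<in> carrier R" "\<exists>i\<in>I. \<kappa> i \<notin> p" "(\<Oplus>i\<in>I. \<kappa> i \<otimes> y' i) \<in> X"
      using Cons.IH[OF q(2) Cons(3), of y'] by' Cons(6) sub by blast
    have "(\<Oplus>i\<in>I. \<kappa> i \<otimes> y i) = (\<Oplus>i\<in>I. \<kappa> i \<otimes> b i \<otimes> q \<oplus> \<kappa> i \<otimes> y' i)"
      using by' \<kappa>(1) q J.Icarr by (intro finsum_cong') (auto simp: r_distr m_assoc)
    also have "\<dots> = (\<Oplus>i\<in>I. \<kappa> i \<otimes> b i \<otimes> q) \<oplus> (\<Oplus>i\<in>I. \<kappa> i \<otimes> y' i)"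
      using by' \<kappa>(1) q J.Icarr by (intro finsum_addf) auto
    also have "\<dots> \<in> X"
    proof (rule X.a_closed)
      show "(\<Oplus>i\<in>I. \<kappa> i \<otimes> b i \<otimes> q) \<in> X"
        using True \<kappa>(1) p.I_l_closed Cons(6) qin by (intro finsum_additive_subgroup[OF X]) blast
    qed (rule \<kappa>(3))
    finally show ?thesis using \<kappa> by blast
  next
    case False
    then obtain j where j: "j \<in> I" "b j \<notin> p" by blast
    define I' where "I' = I - {j}"
    \<comment> \<open>The generator \<open>q\<close> cancels from these combinations, and the coefficient \<open>b j\<close> of \<open>y i\<close>
      lies outside \<open>p\<close>.\<close>
    define z where "z i = b j \<otimes> y i \<ominus> b i \<otimes> y j" for i
    have ins: "I = insert j I'" "j \<notin> I'" "finite I'" using j Cons(3) by (auto simp: I'_def)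
    have yc: "y i \<in> carrier R" "b i \<in> carrier R" "y' i \<in> carrier R" if "i \<in> I" for i
      using by'[OF that] q J.Icarr by auto
    have zJ: "z i \<in> Idl (set qs)" if "i \<in> I'" for i
    proof -
      have i: "i \<in> I" using that by (simp add: I'_def)
      have "z i = b j \<otimes> (b i \<otimes> q \<oplus> y' i) \<ominus> b i \<otimes> (b j \<otimes> q \<oplus> y' j)"
        unfolding z_def using by'[OF i] by'[OF j(1)] by simp
      also have "\<dots> = b j \<otimes> y' i \<ominus> b i \<otimes> y' j"
        using yc[OF i] yc[OF j(1)] q by algebra
      finally show ?thesis
        using by'[OF i] by'[OF j(1)] J.I_l_closed additive_subgroup_minus[OF J.additive_subgroup_axioms] by auto
    qed
    have len: "length qs < card I'" using Cons(3,4) j by (simp add: I'_def)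
    have "\<exists>\<kappa>. (\<forall>i. \<kappa> i \<in> carrier R) \<and> (\<exists>i\<in>I'. \<kappa> i \<notin> p) \<and> (\<Oplus>i\<in>I'. \<kappa> i \<otimes> z i) \<in> X"
      by (rule Cons.IH[OF q(2) ins(3) len]) (use zJ Cons(6) sub in blast)+
    then obtain \<kappa> where \<kappa>: "\<And>i. \<kappa> i \<in> carrier R" "\<exists>i\<in>I'. \<kappa> i \<notin> p" "(\<Oplus>i\<in>I'. \<kappa> i \<otimes> z i) \<in> X"
      by blast
    define \<kappa>' where "\<kappa>' i = (if i = j then \<ominus> (\<Oplus>i\<in>I'. \<kappa> i \<otimes> b i) else if i \<in> I' then \<kappa> i \<otimes> b j else \<zero>)" for i
    have I'I: "i \<in> I" if "i \<in> I'" for i using that by (simp add: I'_def)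
    have S: "(\<Oplus>i\<in>I'. \<kappa> i \<otimes> b i) \<in> carrier R" using \<kappa> yc I'I by (intro finsum_closed) auto
    have \<kappa>'c: "\<kappa>' i \<in> carrier R" for i using S \<kappa> yc j by (auto simp: \<kappa>'_def)
    obtain i where i: "i \<in> I'" "\<kappa> i \<notin> p" using \<kappa>(2) by blast
    then have "\<kappa> i \<otimes> b j \<notin> p" using p.I_prime[OF \<kappa>(1)[of i] yc(2)[OF j(1)]] j(2) by blast
    moreover have "\<kappa>' i = \<kappa> i \<otimes> b j" using i(1) ins(2) by (auto simp: \<kappa>'_def)
    ultimately have "\<kappa>' i \<notin> p" by simp
    moreover have "(\<Oplus>i\<in>I. \<kappa>' i \<otimes> y i) = (\<Oplus>i\<in>I'. \<kappa> i \<otimes> z i)"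
    proof -
      have s1: "(\<Oplus>i\<in>I'. \<kappa>' i \<otimes> y i) = (\<Oplus>i\<in>I'. \<kappa> i \<otimes> (b j \<otimes> y i))"
        using ins \<kappa> yc I'I j by (intro finsum_cong') (auto simp: \<kappa>'_def m_assoc)
      have s2: "(\<Oplus>i\<in>I'. \<kappa> i \<otimes> z i) = (\<Oplus>i\<in>I'. \<kappa> i \<otimes> (b j \<otimes> y i) \<oplus> \<kappa> i \<otimes> b i \<otimes> (\<ominus> y j))"
      proof (rule finsum_cong')
        fix i assume "i \<in> I'"
        then show "\<kappa> i \<otimes> z i = \<kappa> i \<otimes> (b j \<otimes> y i) \<oplus> \<kappa> i \<otimes> b i \<otimes> (\<ominus> y j)"
          unfolding z_def using \<kappa>(1)[of i] yc[OF I'I, of i] yc[OF j(1)] by algebra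
      qed (use \<kappa> yc I'I j in auto)
      also have "\<dots> = (\<Oplus>i\<in>I'. \<kappa> i \<otimes> (b j \<otimes> y i)) \<oplus> (\<Oplus>i\<in>I'. \<kappa> i \<otimes> b i \<otimes> (\<ominus> y j))"
        using \<kappa> yc I'I j by (intro finsum_addf) auto
      also have "(\<Oplus>i\<in>I'. \<kappa> i \<otimes> b i \<otimes> (\<ominus> y j)) = (\<Oplus>i\<in>I'. \<kappa> i \<otimes> b i) \<otimes> (\<ominus> y j)"
        using \<kappa> yc I'I j ins by (intro finsum_ldistr[symmetric]) auto
      also have "\<dots> = \<kappa>' j \<otimes> y j" using S yc[OF j(1)] by (simp add: \<kappa>'_def l_minus r_minus)
      finally have s3: "(\<Oplus>i\<in>I'. \<kappa> i \<otimes> z i) = (\<Oplus>i\<in>I'. \<kappa> i \<otimes> (b j \<otimes> y i)) \<oplus> \<kappa>' j \<otimes> y j" .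
      have "(\<Oplus>i\<in>I. \<kappa>' i \<otimes> y i) = \<kappa>' j \<otimes> y j \<oplus> (\<Oplus>i\<in>I'. \<kappa>' i \<otimes> y i)"
        unfolding ins(1) using ins(2,3) \<kappa>'c yc I'I j by (intro finsum_insert) auto
      also have "\<dots> = (\<Oplus>i\<in>I'. \<kappa> i \<otimes> z i)"
        unfolding s1 s3 using \<kappa>'c \<kappa> yc I'I j by (intro a_comm) (auto intro!: finsum_closed)
      finally show ?thesis .
    qed
    ultimately have "\<exists>i\<in>I. \<kappa>' i \<notin> p" "(\<Oplus>i\<in>I. \<kappa>' i \<otimes> y i) \<in> X" using i(1) I'I \<kappa>(3) by auto
    then show ?thesis using \<kappa>'c by blast
  qed
qed

text \<open>Krull's lemma: an ideal maximal among those that contain no power of \<open>x\<close> is prime.\<close>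
lemma prime_avoiding_powers:
  assumes I: "ideal I R" and x: "x \<in> carrier R" "\<And>n::nat. x [^] n \<notin> I"
  obtains P where "primeideal P R" "I \<subseteq> P" "x \<notin> P"
proof -
  define F where "F = {J. ideal J R \<and> I \<subseteq> J \<and> (\<forall>n::nat. x [^] n \<notin> J)}"
  have "\<exists>M\<in>F. \<forall>J\<in>F. M \<subseteq> J \<longrightarrow> J = M"
  proof (rule subset_Zorn_nonempty)
    show "F \<noteq> {}" using I x by (auto simp: F_def)
    fix C assume C: "C \<noteq> {}" "subset.chain F C"
    then have "subset.chain {I. ideal I R} C" by (auto simp: F_def subset.chain_def)
    then have "ideal (\<Union>C) R" using chain_Union_is_ideal[of C] C(1) by simp
    then show "\<Union>C \<in> F" using C by (fastforce simp: F_def subset.chain_def)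
  qed
  then obtain P where PF: "P \<in> F" and max: "\<And>J. J \<in> F \<Longrightarrow> P \<subseteq> J \<Longrightarrow> J = P" by blast
  then have P: "ideal P R" "I \<subseteq> P" "\<And>n::nat. x [^] n \<notin> P" by (auto simp: F_def)
  interpret P: ideal P R by fact
  have power: "\<exists>(n::nat) c. c \<in> carrier R \<and> x [^] n \<ominus> c \<otimes> a \<in> P" if a: "a \<in> carrier R" "a \<notin> P" for a
  proof -
    let ?J = "Idl (insert a P)"
    have sub: "insert a P \<subseteq> carrier R" using a P.Icarr by auto
    have J: "ideal ?J R" by (rule genideal_ideal[OF sub])
    have "P \<subseteq> ?J" "a \<in> ?J" using genideal_self[OF sub] by auto
    then have "?J \<notin> F" using max a(2) by blast
    then obtain n :: nat where "x [^] n \<in> ?J" using J \<open>P \<subseteq> ?J\<close> P(2) by (auto simp: F_def)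
    then obtain c d where c: "c \<in> carrier R" "d \<in> Idl P" "x [^] n = c \<otimes> a \<oplus> d"
      using Idl_insertE[OF a(1), of P] P.Icarr by blast
    have d: "d \<in> P" using c(2) genideal_minimal[OF P(1), of P] by auto
    have "x [^] n \<ominus> c \<otimes> a = d" using c(1,3) a P.Icarr[OF d] by algebra
    then show ?thesis using c(1) d by auto
  qed
  have "primeideal P R"
  proof (rule primeidealI[OF P(1) cring_axioms])
    show "carrier R \<noteq> P" using P(3)[of 0] by auto
    fix a b assume ab: "a \<in> carrier R" "b \<in> carrier R" "a \<otimes> b \<in> P"
    show "a \<in> P \<or> b \<in> P"
    proof (rule ccontr)
      assume "\<not> ?thesis"
      then obtain n m :: nat and c d where c: "c \<in> carrier R" "x [^] n \<ominus> c \<otimes> a \<in> P"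
        and d: "d \<in> carrier R" "x [^] m \<ominus> d \<otimes> b \<in> P" using power ab by meson
      define u v where "u = x [^] n" and "v = x [^] m"
      have uv: "u \<in> carrier R" "v \<in> carrier R" using x by (auto simp: u_def v_def)
      have "u \<otimes> v = (u \<ominus> c \<otimes> a) \<otimes> v \<oplus> (c \<otimes> a) \<otimes> (v \<ominus> d \<otimes> b) \<oplus> (c \<otimes> d) \<otimes> (a \<otimes> b)"
        using uv c(1) d(1) ab(1,2) by algebra
      also have "\<dots> \<in> P" using c d ab uv P.I_l_closed P.I_r_closed P.a_closed
        unfolding u_def[symmetric] v_def[symmetric] by simp
      finally show False using P(3)[of "n + m"] x by (simp add: u_def v_def nat_pow_mult)
    qed
  qed
  moreover have "x \<notin> P" using P(3)[of 1] x by simp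
  ultimately show ?thesis using that P by blast
qed

end

definition exps :: "nat \<Rightarrow> nat multiset set" where
  "exps s = {\<alpha>. set_mset \<alpha> \<subseteq> {..<s}}"

lemma exps_union [simp]: "\<alpha> + \<beta> \<in> exps s \<longleftrightarrow> \<alpha> \<in> exps s \<and> \<beta> \<in> exps s"
  by (auto simp: exps_def)

lemma exps_empty [simp]: "{#} \<in> exps s"
  by (simp add: exps_def)

lemma exps_add_mset [simp]: "add_mset i \<alpha> \<in> exps s \<longleftrightarrow> i < s \<and> \<alpha> \<in> exps s"
  by (auto simp: exps_def)

lemma exps_diff: "\<alpha> \<in> exps s \<Longrightarrow> \<alpha> - \<beta> \<in> exps s"
  by (auto simp: exps_def dest: in_diffD)

lemma exps_count: "\<alpha> \<in> exps s \<Longrightarrow> s \<le> i \<Longrightarrow> count \<alpha> i = 0"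
  by (auto simp: exps_def not_in_iff[symmetric])

text \<open>Exponent vectors with entries at most \<open>N\<close> are easier to count than those of bounded degree,
  and the difference does not affect the order of growth.\<close>
definition box :: "nat \<Rightarrow> nat \<Rightarrow> nat multiset set" where
  "box s N = {\<alpha> \<in> exps s. \<forall>i. count \<alpha> i \<le> N}"

lemma bij_box: "bij_betw (\<lambda>\<alpha>. restrict (count \<alpha>) {..<s}) (box s N) (PiE {..<s} (\<lambda>_. {..N}))"
proof (rule bij_betwI[where g = "\<lambda>f. \<Sum>i<s. replicate_mset (f i) i"])
  have cnt: "count (\<Sum>i<s. replicate_mset (f i) i) j = (if j < s then f j else 0)" for f :: "nat \<Rightarrow> nat" and j
    by (auto simp: count_sum)
  show "(\<lambda>\<alpha>. restrict (count \<alpha>) {..<s}) \<in> box s N \<rightarrow> PiE {..<s} (\<lambda>_. {..N})"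
    by (auto simp: box_def)
  show "(\<lambda>f. \<Sum>i<s. replicate_mset (f i) i) \<in> PiE {..<s} (\<lambda>_. {..N}) \<rightarrow> box s N"
  proof
    fix f assume f: "f \<in> PiE {..<s} (\<lambda>_. {..N})"
    have "set_mset (\<Sum>i<s. replicate_mset (f i) i) \<subseteq> {..<s}"
    proof
      fix j assume "j \<in># (\<Sum>i<s. replicate_mset (f i) i)"
      then have "count (\<Sum>i<s. replicate_mset (f i) i) j > 0" by simp
      then show "j \<in> {..<s}" unfolding cnt by (auto split: if_splits)
    qed
    then show "(\<Sum>i<s. replicate_mset (f i) i) \<in> box s N"
      using f by (auto simp: box_def exps_def cnt)
  qed
  show "(\<Sum>i<s. replicate_mset (restrict (count \<alpha>) {..<s} i) i) = \<alpha>" if "\<alpha> \<in> box s N" for \<alpha>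
    by (rule multiset_eqI) (use that exps_count in \<open>auto simp: cnt box_def\<close>)
  show "restrict (count (\<Sum>i<s. replicate_mset (f i) i)) {..<s} = f" if "f \<in> PiE {..<s} (\<lambda>_. {..N})" for f
    by (rule ext) (use that in \<open>auto simp: cnt restrict_def PiE_def extensional_def\<close>)
qed

lemma finite_box: "finite (box s N)" and card_box: "card (box s N) = (N + 1) ^ s"
  using bij_betw_finite[OF bij_box] bij_betw_same_card[OF bij_box, of s N] by (simp_all add: finite_PiE card_PiE)

lemma size_box:
  assumes "\<alpha> \<in> box s N" shows "size \<alpha> \<le> s * N"
proof -
  have "size \<alpha> = sum (count \<alpha>) (set_mset \<alpha>)" by (simp add: size_multiset_overloaded_eq)
  also have "\<dots> \<le> card (set_mset \<alpha>) * N"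
    using sum_bounded_above[of "set_mset \<alpha>" "count \<alpha>" N] assms by (simp add: box_def)
  also have "\<dots> \<le> s * N"
    using assms card_mono[of "{..<s}" "set_mset \<alpha>"] by (auto simp: box_def exps_def)
  finally show ?thesis .
qed

section \<open>Chains of primes force growth\<close>

lemma less_multiset_count_top:
  fixes \<beta> \<gamma> :: "nat multiset"
  assumes "\<beta> < \<gamma>" "\<gamma> \<in> exps (Suc j)"
  shows "count \<beta> j \<le> count \<gamma> j"
proof (rule ccontr)
  assume "\<not> ?thesis"
  then obtain x where "x > j" "count \<beta> x < count \<gamma> x"
    using assms(1) unfolding less_multiset\<^sub>H\<^sub>O by (meson not_le)
  then show False using exps_count[OF assms(2), of x] by simp
qed

lemma exps_Suc_split:
  assumes "\<gamma> \<in> exps (Suc j)"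
  shows "filter_mset (\<lambda>i. i \<noteq> j) \<gamma> \<in> exps j"
    "\<gamma> = filter_mset (\<lambda>i. i \<noteq> j) \<gamma> + replicate_mset (count \<gamma> j) j"
proof -
  show "filter_mset (\<lambda>i. i \<noteq> j) \<gamma> \<in> exps j"
    using assms by (force simp: exps_def less_Suc_eq)
  show "\<gamma> = filter_mset (\<lambda>i. i \<noteq> j) \<gamma> + replicate_mset (count \<gamma> j) j"
    by (rule multiset_eqI) simp
qed

context cring
begin

text \<open>The ideal generated by the monomials that follow \<open>\<beta>\<close> in the multiset order. In that order
  the multiplicity of the largest index counts first, the empty exponent comes first, and addition is
  monotone, so a monomial times a further generator always moves into this ideal.\<close>
definition higher :: "(nat \<Rightarrow> 'a) \<Rightarrow> nat \<Rightarrow> nat multiset \<Rightarrow> 'a set" where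
  "higher h s \<beta> = Idl (powprod h ` {\<gamma> \<in> exps s. \<beta> < \<gamma>})"

lemma higher_ideal:
  assumes "h \<in> UNIV \<rightarrow> carrier R" shows "ideal (higher h s \<beta>) R"
  unfolding higher_def using powprod_closed[OF assms] by (intro genideal_ideal) auto

lemma powprod_in_higher:
  assumes "h \<in> UNIV \<rightarrow> carrier R" "\<gamma> \<in> exps s" "\<beta> < \<gamma>"
  shows "powprod h \<gamma> \<in> higher h s \<beta>"
  unfolding higher_def
  using genideal_self[of "powprod h ` {\<gamma> \<in> exps s. \<beta> < \<gamma>}"] powprod_closed[OF assms(1)] assms(2,3) by blast

lemma powprod_Suc_split:
  assumes t: "t \<in> UNIV \<rightarrow> carrier R" and "\<gamma> \<in> exps (Suc j)"
  shows "powprod t \<gamma> = powprod t (filter_mset (\<lambda>i. i \<noteq> j) \<gamma>) \<otimes> t j [^] count \<gamma> j"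
proof -
  have "powprod t \<gamma> = powprod t (filter_mset (\<lambda>i. i \<noteq> j) \<gamma> + replicate_mset (count \<gamma> j) j)"
    by (rule arg_cong[OF exps_Suc_split(2)[OF assms(2)]])
  then show ?thesis by (simp only: powprod_union[OF t] powprod_replicate[OF t])
qed

text \<open>The index \<open>j\<close> dominates the order on exponents over \<open>0, \<dots>, j\<close>. So a monomial beyond \<open>\<beta>\<close>
  is divisible by the power of \<open>t j\<close> occurring in \<open>\<beta>\<close>, and after division it is either divisible by
  \<open>t j\<close> or beyond the rest of \<open>\<beta>\<close>.\<close>
lemma higher_Suc:
  assumes t: "t \<in> UNIV \<rightarrow> carrier R" and u: "u \<in> higher t (Suc j) \<beta>"
  shows "\<exists>v b. v \<in> higher t j (filter_mset (\<lambda>i. i \<noteq> j) \<beta>) \<and> b \<in> carrier R \<and>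
    u = t j [^] count \<beta> j \<otimes> (v \<oplus> t j \<otimes> b)"
proof -
  let ?\<beta>' = "filter_mset (\<lambda>i. i \<noteq> j) \<beta>" and ?m = "count \<beta> j"
  let ?Y = "powprod t ` {\<gamma> \<in> exps (Suc j). \<beta> < \<gamma>}"
  have Y: "?Y \<subseteq> carrier R" using powprod_closed[OF t] by auto
  interpret V: ideal "higher t j ?\<beta>'" R using t by (rule higher_ideal)
  have tt: "t j \<in> carrier R" using t by auto
  then have tm: "t j [^] n \<in> carrier R" for n :: nat by simp
  have gen: "\<exists>v b. v \<in> higher t j ?\<beta>' \<and> b \<in> carrier R \<and> x = t j [^] ?m \<otimes> (v \<oplus> t j \<otimes> b)"
    if bx: "b0 \<in> carrier R" "y \<in> ?Y" "x = b0 \<otimes> y" for x b0 y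
  proof -
    obtain \<gamma> where \<gamma>: "\<gamma> \<in> exps (Suc j)" "\<beta> < \<gamma>" "y = powprod t \<gamma>" using bx by blast
    let ?\<gamma>' = "filter_mset (\<lambda>i. i \<noteq> j) \<gamma>"
    have y: "y = powprod t ?\<gamma>' \<otimes> t j [^] count \<gamma> j"
      using powprod_Suc_split[OF t \<gamma>(1)] \<gamma>(3) by simp
    have mc: "powprod t ?\<gamma>' \<in> carrier R" using powprod_closed[OF t] by blast
    show ?thesis
    proof (cases "count \<gamma> j = ?m")
      case True
      have \<beta>eq: "\<beta> = ?\<beta>' + replicate_mset ?m j" by (rule multiset_eqI) simp
      have "?\<beta>' + replicate_mset ?m j < ?\<gamma>' + replicate_mset ?m j"
        by (rule ord_eq_less_trans[OF \<beta>eq[symmetric] less_le_trans[OF \<gamma>(2)]])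
           (use exps_Suc_split(2)[OF \<gamma>(1)] True in \<open>simp only: order_refl\<close>)
      then have "?\<beta>' < ?\<gamma>'" by (simp only: add_less_cancel_right)
      then have "powprod t ?\<gamma>' \<in> higher t j ?\<beta>'"
        using powprod_in_higher[OF t] exps_Suc_split(1)[OF \<gamma>(1)] by blast
      then have "b0 \<otimes> powprod t ?\<gamma>' \<in> higher t j ?\<beta>'" using bx(1) V.I_l_closed by blast
      moreover have "x = t j [^] ?m \<otimes> (b0 \<otimes> powprod t ?\<gamma>' \<oplus> t j \<otimes> \<zero>)"
        using bx y True mc tt tm by (simp add: m_ac)
      ultimately show ?thesis by blast
    next
      case False
      then have "count \<gamma> j > ?m" using less_multiset_count_top[OF \<gamma>(2,1)] by simp
      then obtain d where d: "count \<gamma> j = ?m + Suc d" using less_imp_Suc_add by auto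
      define B P d' where "B = powprod t ?\<gamma>'" and "P = t j [^] ?m" and "d' = t j [^] d"
      have c: "B \<in> carrier R" "P \<in> carrier R" "d' \<in> carrier R" using mc tm by (auto simp: B_def P_def d'_def)
      have "t j [^] count \<gamma> j = P \<otimes> (d' \<otimes> t j)"
        unfolding d P_def d'_def using tt by (simp add: nat_pow_mult[symmetric] m_assoc)
      then have "x = b0 \<otimes> (B \<otimes> (P \<otimes> (d' \<otimes> t j)))" using bx(3) y by (simp add: B_def)
      also have "\<dots> = P \<otimes> (\<zero> \<oplus> t j \<otimes> (d' \<otimes> (b0 \<otimes> B)))" using c bx(1) tt by algebra
      finally have "x = t j [^] ?m \<otimes> (\<zero> \<oplus> t j \<otimes> (d' \<otimes> (b0 \<otimes> B)))" by (simp only: P_def)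
      moreover have "d' \<otimes> (b0 \<otimes> B) \<in> carrier R" using c bx(1) by simp
      ultimately show ?thesis using V.zero_closed by blast
    qed
  qed
  from Y u[unfolded higher_def] show ?thesis
  proof (induction rule: Idl_induct)
    case zero
    have "\<zero> = t j [^] ?m \<otimes> (\<zero> \<oplus> t j \<otimes> \<zero>)" using tt tm by simp
    then show ?case using V.zero_closed by blast
  next
    case (add b0 y r)
    define x where "x = b0 \<otimes> y"
    obtain v b where v: "v \<in> higher t j ?\<beta>'" "b \<in> carrier R" "x = t j [^] ?m \<otimes> (v \<oplus> t j \<otimes> b)"
      using gen[OF add(1,2) x_def] by blast
    obtain v' b' where v': "v' \<in> higher t j ?\<beta>'" "b' \<in> carrier R" "r = t j [^] ?m \<otimes> (v' \<oplus> t j \<otimes> b')"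
      using add(4) by blast
    define T where "T = t j [^] ?m"
    have T: "T \<in> carrier R" "t j \<in> carrier R" using tt tm by (auto simp: T_def)
    have "x \<oplus> r = T \<otimes> ((v \<oplus> v') \<oplus> t j \<otimes> (b \<oplus> b'))"
      unfolding v(3) v'(3) T_def[symmetric] using T v(1,2) v'(1,2) V.Icarr by algebra
    moreover have "v \<oplus> v' \<in> higher t j ?\<beta>'" "b \<oplus> b' \<in> carrier R"
      using v(1,2) v'(1,2) V.a_closed by auto
    ultimately show ?case unfolding T_def x_def by blast
  qed
qed

text \<open>Let \<open>D 0, D 1, \<dots>\<close> be a descending chain of primes and \<open>t i\<close> an element of \<open>D i\<close> outside
  \<open>D (i + 1)\<close>. A relation modulo \<open>D (j + 1)\<close> can be divided by the power of \<open>t j\<close> in its first monomial,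
  because \<open>t j\<close> is not in this prime; afterwards it can be read modulo the larger prime \<open>D j\<close>, which
  kills \<open>t j\<close>. By induction on \<open>j\<close>, a first coefficient of a relation lies in \<open>D 0\<close>.\<close>
lemma prime_chain_initial_forms:
  assumes D: "\<And>i. i \<le> h \<Longrightarrow> primeideal (D i) R" and sub: "\<And>i. i < h \<Longrightarrow> D (Suc i) \<subseteq> D i"
    and t: "t \<in> UNIV \<rightarrow> carrier R" "\<And>i. i < h \<Longrightarrow> t i \<in> D i \<and> t i \<notin> D (Suc i)"
    and "j \<le> h" "\<beta> \<in> exps j" "c \<in> carrier R" "c \<notin> D 0" "e \<in> D j"
  shows "c \<otimes> powprod t \<beta> \<ominus> e \<notin> higher t j \<beta>"
  using assms(5-)
proof (induction j arbitrary: \<beta> e)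
  case 0
  then have \<beta>: "\<beta> = {#}" by (auto simp: exps_def)
  interpret primeideal "D 0" R using D 0 by blast
  have e: "e \<in> carrier R" "e \<in> D 0" using 0 by auto
  have "{\<gamma> \<in> exps 0. \<beta> < \<gamma>} = {}" by (auto simp: exps_def \<beta>)
  then have "powprod t ` {\<gamma> \<in> exps 0. \<beta> < \<gamma>} \<subseteq> {\<zero>}" by (simp only: image_empty empty_subsetI)
  then have "higher t 0 \<beta> \<subseteq> {\<zero>}" unfolding higher_def by (rule genideal_minimal[OF zeroideal])
  moreover have "c \<otimes> powprod t \<beta> \<ominus> e \<noteq> \<zero>"
  proof
    assume "c \<otimes> powprod t \<beta> \<ominus> e = \<zero>"
    then have "c = e" using 0 e t \<beta> by (simp add: r_right_minus_eq)
    then show False using 0 by blast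
  qed
  ultimately show ?case by blast
next
  case (Suc j)
  interpret P: primeideal "D (Suc j)" R using D Suc by blast
  interpret P': primeideal "D j" R using D Suc by auto
  let ?\<beta>' = "filter_mset (\<lambda>i. i \<noteq> j) \<beta>"
  define T where "T = t j [^] count \<beta> j"
  have T: "T \<in> carrier R" "t j \<in> carrier R" using t by (auto simp: T_def)
  have tj: "t j \<in> D j" "t j \<notin> D (Suc j)" using t Suc by auto
  have Tn: "T \<notin> D (Suc j)"
  proof -
    have "t j [^] (n::nat) \<notin> D (Suc j)" for n
    proof (induction n)
      case 0
      then show ?case using P.one_imp_carrier P.I_notcarr by auto
    next
      case (Suc n)
      then show ?case using P.I_prime T tj by (metis nat_pow_Suc nat_pow_closed)
    qed
    then show ?thesis by (simp add: T_def)
  qed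
  have mc: "powprod t ?\<beta>' \<in> carrier R" using powprod_closed[OF t(1)] by blast
  have mon: "powprod t \<beta> = powprod t ?\<beta>' \<otimes> T"
    unfolding T_def by (rule powprod_Suc_split[OF t(1) Suc(3)])
  have ec: "e \<in> carrier R" using Suc by auto
  show ?case
  proof
    assume "c \<otimes> powprod t \<beta> \<ominus> e \<in> higher t (Suc j) \<beta>"
    then obtain v b where v: "v \<in> higher t j ?\<beta>'" "b \<in> carrier R" "c \<otimes> powprod t \<beta> \<ominus> e = T \<otimes> (v \<oplus> t j \<otimes> b)"
      using higher_Suc[OF t(1)] unfolding T_def by blast
    have vc: "v \<in> carrier R" using ideal.Icarr[OF higher_ideal[OF t(1)] v(1)] .
    define w where "w = c \<otimes> powprod t ?\<beta>' \<ominus> (v \<oplus> t j \<otimes> b)"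
    have wc: "w \<in> carrier R" unfolding w_def using Suc mc vc v T by simp
    define B where "B = powprod t ?\<beta>'"
    have B: "B \<in> carrier R" "c \<in> carrier R" "b \<in> carrier R" using mc Suc(4) v(2) by (auto simp: B_def)
    have "T \<otimes> w = c \<otimes> powprod t \<beta> \<ominus> T \<otimes> (v \<oplus> t j \<otimes> b)"
      unfolding w_def mon B_def[symmetric] using B vc T by algebra
    also have "\<dots> = e" unfolding v(3)[symmetric]
      using Suc(4) powprod_closed[OF t(1)] ec by (simp add: minus_eq minus_add a_assoc[symmetric] r_neg)
    finally have "T \<otimes> w \<in> D (Suc j)" using Suc by simp
    then have "w \<in> D (Suc j)" using P.I_prime[OF T(1) wc] Tn by blast
    then have "w \<in> D j" using sub[of j] Suc by auto
    then have "w \<oplus> t j \<otimes> b \<in> D j" using tj v P'.I_r_closed P'.a_closed by blast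
    moreover have "c \<otimes> powprod t ?\<beta>' \<ominus> (w \<oplus> t j \<otimes> b) = v"
      unfolding w_def B_def[symmetric] using B vc T by algebra
    ultimately show False
      using Suc.IH[of ?\<beta>' "w \<oplus> t j \<otimes> b"] exps_Suc_split(1)[OF Suc(3)] Suc v by auto
  qed
qed

end

context graded_cring
begin

lemma degree_le_mono: "a \<in> degree_le i \<Longrightarrow> i \<le> j \<Longrightarrow> a \<in> degree_le j"
  by (auto simp: degree_le_def)

lemma degree_le_powprod:
  assumes t: "t \<in> UNIV \<rightarrow> degree_le m" and one: "\<one> \<in> \<A> 0"
  shows "powprod t \<gamma> \<in> degree_le (m * size \<gamma>)"
proof -
  have tc: "t \<in> UNIV \<rightarrow> carrier A" using t by (auto simp: degree_le_def)
  show ?thesis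
  proof (induction \<gamma>)
    case empty
    then show ?case using component_homogeneous[OF one] powprod_empty[OF tc] by (auto simp: supported_def)
  next
    case (add i \<gamma>)
    have "t i \<in> degree_le m" using t by blast
    then show ?case using degree_le_mult[OF _ add, of "t i" m] by (simp add: powprod_add_mset[OF tc])
  qed
qed

lemma degree_le_exists: "a \<in> carrier A \<Longrightarrow> \<exists>m. a \<in> degree_le m"
proof -
  assume a: "a \<in> carrier A"
  obtain m where "\<forall>n\<in>{i. component i a \<noteq> \<zero>}. n \<le> m"
    using component_finite[OF a] finite_nat_set_iff_bounded_le by blast
  then have "a \<in> degree_le m" using a by (auto simp: degree_le_def)
  then show ?thesis by blast
qed

end

context standard_graded_algebra
begin

lemma Span_subset:
  assumes "set L \<subseteq> H" "additive_subgroup H A" "\<And>c a. c \<in> k \<Longrightarrow> a \<in> H \<Longrightarrow> c \<otimes> a \<in> H"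
  shows "Span k L \<subseteq> H"
  using assms(1)
proof (induction L)
  case Nil
  then show ?case using additive_subgroup.zero_closed[OF assms(2)] by simp
next
  case (Cons u L)
  then show ?case
    using assms(3) additive_subgroup.a_closed[OF assms(2)] by (fastforce simp: line_extension_mem_iff)
qed

lemma spanning_list_base:
  assumes "set L \<subseteq> carrier A"
  shows "\<exists>Vs. independent k Vs \<and> Span k Vs = Span k L \<and> length Vs \<le> length L"
  using assms
proof (induction L)
  case Nil
  then show ?case by (intro exI[where x = "[]"]) auto
next
  case (Cons u L)
  then obtain Vs where Vs: "independent k Vs" "Span k Vs = Span k L" "length Vs \<le> length L" by auto
  show ?case
  proof (cases "u \<in> Span k L")
    case True
    have uL: "set (u # L) \<subseteq> Span k L" using True Cons(2) Span_base_incl[OF base_subfield, of L] by auto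
    have "Span k (u # L) = Span k L"
    proof
      show "Span k (u # L) \<subseteq> Span k L"
        using mono_Span_subset[OF base_subfield uL] Cons(2) by auto
      show "Span k L \<subseteq> Span k (u # L)" using mono_Span[OF base_subfield, of L u] Cons(2) by auto
    qed
    then have "independent k Vs \<and> Span k Vs = Span k (u # L) \<and> length Vs \<le> length (u # L)" using Vs by simp
    then show ?thesis by blast
  next
    case False
    then have "independent k (u # Vs)" using Vs Cons(2) by (intro li_Cons) auto
    moreover have "Span k (u # Vs) = Span k (u # L)" using Vs(2) by simp
    moreover have "length (u # Vs) \<le> length (u # L)" using Vs(3) by simp
    ultimately show ?thesis by blast
  qed
qed

text \<open>Suppose that the part of degree at most \<open>N\<close> has dimension \<open>O(N\<^sup>e)\<close>. Elements taken between
  consecutive members of a chain of length \<open>h\<close> have, by the preceding lemma, linearly independent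
  monomials. There are \<open>(N + 1)\<^sup>h\<close> monomials with exponents at most \<open>N\<close>, and their degrees are at most a
  constant times \<open>N\<close>; hence \<open>h \<le> e\<close>.\<close>
lemma prime_chain_length_le:
  assumes spans: "\<And>N. \<exists>L. set L \<subseteq> carrier A \<and> length L \<le> c * (N + 1) ^ e \<and> (\<forall>n\<le>N. \<A> n \<subseteq> Span k L)"
    and C: "\<And>i. i \<le> h \<Longrightarrow> primeideal (C i) A" "\<And>i. i < h \<Longrightarrow> C i \<subset> C (Suc i)"
  shows "h \<le> e"
proof (rule ccontr)
  assume "\<not> h \<le> e"
  then have he: "e < h" by simp
  \<comment> \<open>Reversed, so that the index of an element increases as the prime shrinks.\<close>
  define D where "D i = C (h - i)" for i
  have D: "primeideal (D i) A" if "i \<le> h" for i using C(1) by (simp add: D_def)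
  have Ds: "D (Suc i) \<subset> D i" if "i < h" for i
  proof -
    have "C (h - Suc i) \<subset> C (Suc (h - Suc i))" using that by (intro C(2)) simp
    moreover have "Suc (h - Suc i) = h - i" using that by simp
    ultimately show ?thesis by (simp add: D_def)
  qed
  define t where "t i = (if i < h then SOME a. a \<in> D i \<and> a \<notin> D (Suc i) else \<zero>)" for i
  have t: "t i \<in> D i \<and> t i \<notin> D (Suc i)" if "i < h" for i
  proof -
    have "\<exists>a. a \<in> D i \<and> a \<notin> D (Suc i)" using Ds[OF that] by blast
    from someI_ex[OF this] show ?thesis using that by (simp add: t_def)
  qed
  have tc': "t i \<in> carrier A" for i
  proof (cases "i < h")
    case True
    then show ?thesis using t[OF True] ideal.Icarr[OF primeideal.axioms(1)[OF D[of i]]] by simp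
  qed (simp add: t_def)
  then have tc: "t \<in> UNIV \<rightarrow> carrier A" by blast
  interpret D0: primeideal "D 0" A using D by simp
  have one: "\<one> \<notin> D 0" using D0.one_imp_carrier D0.I_notcarr by blast
  have LI: "powprod t \<beta> \<notin> higher t h \<beta>" if "\<beta> \<in> exps h" for \<beta>
  proof -
    interpret Dh: primeideal "D h" A using D by simp
    have "\<one> \<otimes> powprod t \<beta> \<ominus> \<zero> \<notin> higher t h \<beta>"
      by (rule prime_chain_initial_forms[where D = D and h = h])
         (use D Ds t tc one that in auto)
    then show ?thesis using powprod_closed[OF tc] by simp
  qed
  have "\<exists>m. \<forall>i. t i \<in> degree_le m"
  proof -
    have "\<forall>i. \<exists>m. t i \<in> degree_le m" using degree_le_exists tc' by blast
    then obtain f where f: "\<And>i. t i \<in> degree_le (f i)" by metis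
    have "t i \<in> degree_le (\<Sum>i<h. f i)" for i
    proof (cases "i < h")
      case True
      then have "f i \<le> (\<Sum>i<h. f i)" by (intro member_le_sum) auto
      then show ?thesis using f[of i] by (auto simp: degree_le_def)
    next
      case False
      then show ?thesis by (simp add: t_def degree_le_def)
    qed
    then show ?thesis by blast
  qed
  then obtain m where m: "t \<in> UNIV \<rightarrow> degree_le m" by blast
  have key: "(N + 1) ^ h \<le> c * (m * (h * N) + 1) ^ e" for N
  proof -
    obtain L where L: "set L \<subseteq> carrier A" "length L \<le> c * (m * (h * N) + 1) ^ e"
      "\<And>n. n \<le> m * (h * N) \<Longrightarrow> \<A> n \<subseteq> Span k L" using spans[of "m * (h * N)"] by blast
    have indep: "independent k (map (powprod t) l)" if "sorted_wrt (<) l" "set l \<subseteq> exps h" for l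
      using that
    proof (induction l)
      case Nil
      then show ?case by simp
    next
      case (Cons \<beta> l)
      interpret H: ideal "higher t h \<beta>" A using higher_ideal[OF tc] .
      have "Span k (map (powprod t) l) \<subseteq> higher t h \<beta>"
        by (rule Span_subset)
           (use Cons powprod_in_higher[OF tc] H.additive_subgroup_axioms H.I_l_closed k_props(1) in auto)
      then have "powprod t \<beta> \<notin> Span k (map (powprod t) l)" using LI[of \<beta>] Cons(3) by auto
      moreover have "independent k (map (powprod t) l)" using Cons by simp
      ultimately show ?case unfolding list.map by (intro li_Cons powprod_closed[OF tc])
    qed
    define l where "l = sorted_list_of_set (box h N)"
    have l: "sorted_wrt (<) l" "set l = box h N" "length l = (N + 1) ^ h"
      using finite_box card_box by (simp_all add: l_def)
    have ind: "independent k (map (powprod t) l)" using indep[OF l(1)] l(2) by (auto simp: box_def)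
    obtain Vs where Vs: "set Vs \<subseteq> carrier A" "independent k Vs" "Span k Vs = Span k L" "length Vs \<le> length L"
      using spanning_list_base[OF L(1)] independent_in_carrier by blast
    have "set (map (powprod t) l) \<subseteq> Span k Vs"
    proof
      fix x assume "x \<in> set (map (powprod t) l)"
      then obtain \<gamma> where \<gamma>: "\<gamma> \<in> box h N" "x = powprod t \<gamma>" using l(2) by auto
      have "m * size \<gamma> \<le> m * (h * N)" using size_box[OF \<gamma>(1)] by (intro mult_left_mono) auto
      then have "x \<in> degree_le (m * (h * N))"
        using degree_le_mono[OF degree_le_powprod[OF m one_comp]] \<gamma>(2) by blast
      then have "x \<in> add_span (\<Union>n\<in>{..m * (h * N)}. \<A> n)" by (simp only: supported_eq_add_span)
      moreover have "(\<Union>n\<in>{..m * (h * N)}. \<A> n) \<subseteq> Span k L" using L(3) by auto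
      moreover have "additive_subgroup (Span k L) A"
        using Span_is_add_subgroup[OF base_subfield L(1)] by (rule additive_subgroup.intro)
      ultimately show "x \<in> Span k Vs" using add_span_subset Vs(3) by blast
    qed
    then have "length (map (powprod t) l) \<le> length Vs"
      using independent_length_le[OF base_subfield ind Vs(2)] by simp
    then show ?thesis using l(3) Vs(4) L(2) by simp
  qed
  \<comment> \<open>Large enough for the power with the larger exponent to win.\<close>
  define N where "N = c * (m * h + 1) ^ e"
  have "(N + 1) ^ e * (N + 1) \<le> (N + 1) ^ h"
    using power_increasing[of "Suc e" h "N + 1"] he by (simp add: mult.commute)
  also have "\<dots> \<le> c * (m * (h * N) + 1) ^ e" by (rule key)
  also have "\<dots> \<le> c * ((m * h + 1) * (N + 1)) ^ e"
    by (intro mult_left_mono power_mono) (auto simp: algebra_simps)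
  also have "\<dots> = N * (N + 1) ^ e"
    by (simp only: power_mult_distrib mult.assoc[symmetric] N_def[symmetric])
  finally have "(N + 1) ^ e * (N + 1) \<le> (N + 1) ^ e * N" by (simp add: mult.commute)
  then show False by simp
qed

end

section \<open>Relevant primes and their generators\<close>

context standard_graded_algebra
begin

text \<open>The list of generators, padded by zero so that it is total; zero is homogeneous of every
  degree.\<close>
definition gen :: "nat \<Rightarrow> 'a" where
  "gen i = (if i < length xs then xs ! i else \<zero>)"

lemma gen_degree: "gen i \<in> \<A> 1"
  using gens_degree_1 by (auto simp: gen_def)

lemma gen_carrier: "gen \<in> UNIV \<rightarrow> carrier A"
  using gen_degree comp_carrier by blast

lemma comp_powprods:
  assumes "a \<in> \<A> n"
  shows "a \<in> add_span {c \<otimes> powprod gen \<alpha> |c \<alpha>. c \<in> k \<and> \<alpha> \<in> exps (length xs) \<and> size \<alpha> = n}"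
  using assms
proof (induction n arbitrary: a)
  case 0
  let ?S = "{c \<otimes> powprod gen \<alpha> |c \<alpha>. c \<in> k \<and> \<alpha> \<in> exps (length xs) \<and> size \<alpha> = 0}"
  have "?S \<subseteq> carrier A" using k_props(1) powprod_closed[OF gen_carrier] by auto
  moreover have "a = a \<otimes> powprod gen {#}" using 0 comp_carrier powprod_empty[OF gen_carrier] by auto
  then have "a \<in> ?S" using 0 component_0 by force
  ultimately show ?case by (rule add_span_gen)
next
  case (Suc n)
  let ?S = "\<lambda>n. {c \<otimes> powprod gen \<alpha> |c \<alpha>. c \<in> k \<and> \<alpha> \<in> exps (length xs) \<and> size \<alpha> = n}"
  have S: "?S n \<subseteq> carrier A" for n using k_props(1) powprod_closed[OF gen_carrier] by auto
  have mult: "x \<otimes> b \<in> add_span (?S (Suc n))" if x: "x \<in> set xs" and b: "b \<in> add_span (?S n)" for x b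
    using b
  proof (induction rule: add_span.induct)
    case zero
    then show ?case using x xs_carrier add_span.zero[of "?S (Suc n)"] by auto
  next
    case (step y r)
    obtain i where i: "i < length xs" "x = gen i" using x by (auto simp: in_set_conv_nth gen_def)
    obtain c \<alpha> where y: "y = c \<otimes> powprod gen \<alpha>" "c \<in> k" "\<alpha> \<in> exps (length xs)" "size \<alpha> = n"
      using step(1) by blast
    have cc: "c \<in> carrier A" "powprod gen \<alpha> \<in> carrier A" "x \<in> carrier A" "r \<in> carrier A"
      using y k_props(1) powprod_closed[OF gen_carrier] x xs_carrier add_span_carrier[OF S step(2)] by auto
    have "x \<otimes> y = c \<otimes> (x \<otimes> powprod gen \<alpha>)"
      unfolding y(1) using cc(1-3) by (simp add: m_ac)
    also have "\<dots> = c \<otimes> powprod gen (add_mset i \<alpha>)" using i powprod_add_mset[OF gen_carrier] by simp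
    finally have "x \<otimes> y = c \<otimes> powprod gen (add_mset i \<alpha>)" .
    moreover have "add_mset i \<alpha> \<in> exps (length xs)" "size (add_mset i \<alpha>) = Suc n" using y i by auto
    ultimately have "x \<otimes> y \<in> ?S (Suc n)" using y(2) by blast
    moreover have "x \<otimes> (y \<oplus> r) = x \<otimes> y \<oplus> x \<otimes> r" using cc y(1) by (simp add: r_distr)
    ultimately show ?case using step(3) by (simp only: add_span.step)
  qed
  have "a \<in> add_span (products n)" using comp_Suc Suc by blast
  then show ?case
  proof (induction rule: add_span.induct)
    case zero
    then show ?case by (rule add_span.zero)
  next
    case (step x r)
    then obtain y b where "x = y \<otimes> b" "y \<in> set xs" "b \<in> \<A> n" by (auto simp: products_def)
    then have "x \<in> add_span (?S (Suc n))" using mult Suc.IH by blast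
    then show ?case using step(3) add_span_add[OF S] by blast
  qed
qed

text \<open>A prime that misses a generator contains a point of Proj.\<close>
lemma relevant_core:
  assumes P: "primeideal P A" "homogeneous_ideal A \<A> I" "I \<subseteq> P" and x: "x \<in> set xs" "x \<notin> P"
  shows "\<exists>p\<in>relevant_primes A \<A> xs. I \<subseteq> p \<and> p \<subseteq> P"
proof -
  let ?p = "{a \<in> carrier A. \<forall>n. component n a \<in> P}"
  note c = homogeneous_core[OF P(1)]
  have "x \<in> mm" using x genideal_self[OF xs_carrier] by (auto simp: irrelevant_ideal_def)
  then have "?p \<in> relevant_primes A \<A> xs" unfolding relevant_primes_def using c(1-3) x(2) by blast
  then show ?thesis using c(3) c(4)[OF P(2,3)] by blast
qed

text \<open>The projective Nullstellensatz. If no power of a generator \<open>x\<close> lay in \<open>I\<close>, some prime over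
  \<open>I\<close> would miss \<open>x\<close>, and its homogeneous core would be a relevant prime over \<open>I\<close>. So all generators are
  nilpotent modulo \<open>I\<close>, and a monomial of large degree contains a large power of one of them.\<close>
lemma no_relevant_prime_imp_large_degrees:
  assumes I: "homogeneous_ideal A \<A> I" and no: "\<And>p. p \<in> relevant_primes A \<A> xs \<Longrightarrow> \<not> I \<subseteq> p"
  shows "\<exists>N. \<forall>n\<ge>N. \<A> n \<subseteq> I"
proof -
  have Ii: "ideal I A" using I by (simp add: homogeneous_ideal_def)
  interpret ideal I A by fact
  have "\<exists>e::nat. gen i [^] e \<in> I" for i
  proof (cases "i < length xs")
    case True
    show ?thesis
    proof (rule ccontr)
      assume "\<not> ?thesis"
      then obtain P where "primeideal P A" "I \<subseteq> P" "gen i \<notin> P"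
        using prime_avoiding_powers[OF Ii, of "gen i"] gen_carrier by blast
      then show False using relevant_core[OF _ I] no True by (metis gen_def nth_mem)
    qed
  next
    case False
    then have "gen i [^] (1::nat) \<in> I" by (simp add: gen_def)
    then show ?thesis by blast
  qed
  then obtain e where e: "\<And>i. gen i [^] (e i :: nat) \<in> I" by metis
  define E where "E = (\<Sum>i<length xs. e i)"
  have "\<A> n \<subseteq> I" if n: "n \<ge> length xs * E + 1" for n
  proof
    fix a assume "a \<in> \<A> n"
    then have "a \<in> add_span {c \<otimes> powprod gen \<alpha> |c \<alpha>. c \<in> k \<and> \<alpha> \<in> exps (length xs) \<and> size \<alpha> = n}"
      by (rule comp_powprods)
    moreover have "{c \<otimes> powprod gen \<alpha> |c \<alpha>. c \<in> k \<and> \<alpha> \<in> exps (length xs) \<and> size \<alpha> = n} \<subseteq> I"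
    proof safe
      fix c \<alpha> assume c: "c \<in> k" and \<alpha>: "\<alpha> \<in> exps (length xs)" "n = size \<alpha>"
      have "\<alpha> \<notin> box (length xs) E" using size_box[of \<alpha> "length xs" E] n \<alpha>(2) by auto
      then obtain i where i: "count \<alpha> i > E" using \<alpha>(1) by (auto simp: box_def not_le)
      then have "i < length xs" using exps_count[OF \<alpha>(1), of i] by (cases "i < length xs") auto
      then have "e i \<le> E" unfolding E_def by (intro member_le_sum) auto
      with i obtain d where d: "count \<alpha> i = e i + d" using le_Suc_ex by (meson less_imp_le_nat order_trans)
      obtain b where b: "b \<in> carrier A" "powprod gen \<alpha> = b \<otimes> gen i [^] count \<alpha> i"
        using pow_dvd_powprod[OF gen_carrier] by blast
      have g: "gen i \<in> carrier A" using gen_carrier by blast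
      have "gen i [^] count \<alpha> i = gen i [^] e i \<otimes> gen i [^] d" unfolding d using g by (simp add: nat_pow_mult)
      then have "gen i [^] count \<alpha> i \<in> I" using e[of i] g I_r_closed by simp
      then show "c \<otimes> powprod gen \<alpha> \<in> I" unfolding b(2) using b(1) c k_props(1) I_l_closed by blast
    qed
    ultimately show "a \<in> I" using add_span_subset[OF additive_subgroup_axioms] by blast
  qed
  then show ?thesis by blast
qed

text \<open>Unions of chains of relevant primes stay relevant because the irrelevant ideal is finitely
  generated.\<close>
lemma maximal_relevant_prime_exists:
  assumes q: "q \<in> relevant_primes A \<A> xs"
  shows "\<exists>p\<in>relevant_primes A \<A> xs. \<forall>p'\<in>relevant_primes A \<A> xs. p \<subseteq> p' \<longrightarrow> p' = p"
proof (rule subset_Zorn_nonempty)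
  show "relevant_primes A \<A> xs \<noteq> {}" using q by blast
  fix C assume C: "C \<noteq> {}" "subset.chain (relevant_primes A \<A> xs) C"
  have CR: "p \<in> relevant_primes A \<A> xs" if "p \<in> C" for p using that C by (auto simp: subset.chain_def)
  then have "subset.chain {I. ideal I A} C" using C relevant_primesD(4) by (auto simp: subset.chain_def)
  then have U: "ideal (\<Union>C) A" using chain_Union_is_ideal[of C] C(1) by simp
  have hom: "homogeneous_ideal A \<A> (\<Union>C)"
    using U CR relevant_primesD(2) homogeneous_idealD by (intro homogeneous_idealI) blast+
  have no: "\<not> set xs \<subseteq> \<Union>C"
  proof
    assume "set xs \<subseteq> \<Union>C"
    then obtain p where p: "p \<in> C" "set xs \<subseteq> p"
      using finite_subset_Union_chain[OF _ _ C(1) C(2), of "set xs"] by auto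
    have "mm \<subseteq> p" unfolding irrelevant_ideal_def
      using genideal_minimal relevant_primesD(4)[OF CR[OF p(1)]] p(2) by blast
    then show False using relevant_primesD(3)[OF CR[OF p(1)]] by blast
  qed
  have "primeideal (\<Union>C) A"
  proof (rule primeidealI[OF U cring_axioms])
    show "carrier A \<noteq> \<Union>C" using no xs_carrier by blast
    fix a b assume "a \<in> carrier A" "b \<in> carrier A" "a \<otimes> b \<in> \<Union>C"
    then show "a \<in> \<Union>C \<or> b \<in> \<Union>C"
      using primeideal.I_prime[OF relevant_primesD(1)[OF CR]] by blast
  qed
  moreover have "\<not> mm \<subseteq> \<Union>C"
    using no genideal_self[OF xs_carrier] unfolding irrelevant_ideal_def by blast
  ultimately show "\<Union>C \<in> relevant_primes A \<A> xs" using hom by (simp add: relevant_primes_def)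
qed

lemma relevant_prime_exists:
  assumes "primeideal P A" "primeideal P' A" "P \<subset> P'"
  shows "relevant_primes A \<A> xs \<noteq> {}"
proof -
  have "ideal P A" "ideal P' A" using assms(1,2) by (auto intro: primeideal.axioms(1))
  have "\<not> set xs \<subseteq> P"
  proof
    assume "set xs \<subseteq> P"
    then have "mm \<subseteq> P" unfolding irrelevant_ideal_def using genideal_minimal \<open>ideal P A\<close> by blast
    then have "P' = carrier A" using ideal_not_in_mm[OF \<open>ideal P' A\<close>] assms(3) by blast
    then show False using primeideal.I_notcarr[OF assms(2)] by blast
  qed
  then obtain x where x: "x \<in> set xs" "x \<notin> P" by blast
  have "homogeneous_ideal A \<A> {\<zero>}" by (rule homogeneous_idealI[OF zeroideal]) auto
  moreover have "{\<zero>} \<subseteq> P" using assms(1) by (simp add: additive_subgroup.zero_closed ideal.axioms(1) primeideal.axioms(1))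
  ultimately show ?thesis using relevant_core[OF assms(1) _ _ x] by blast
qed

text \<open>Graded Nakayama: a homogeneous generating set of least size has at most as many elements as
  any other generating set. If it had more, it would be dependent modulo the irrelevant ideal times \<open>p\<close>,
  and an element with a coefficient outside the irrelevant ideal could be cancelled.\<close>
lemma homogeneous_generators:
  assumes p: "p \<in> relevant_primes A \<A> xs" and gs: "set gs \<subseteq> carrier A" "p = Idl (set gs)"
  shows "\<exists>hs. set hs \<subseteq> homogeneous_elements \<A> \<and> p = Idl (set hs) \<and> length hs \<le> length gs"
proof -
  note pd = relevant_primesD[OF p]
  interpret p: primeideal p A using pd by blast
  interpret m: primeideal mm A by (rule primeideal_mm)
  have gsp: "set gs \<subseteq> p" using gs genideal_self by blast
  define F where "F = {H. finite H \<and> H \<subseteq> homogeneous_elements \<A> \<and> Idl H = p}"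
  let ?H0 = "\<Union>g\<in>set gs. (\<lambda>n. component n g) ` {n. component n g \<noteq> \<zero>}"
  have "?H0 \<in> F"
  proof -
    have H0p: "?H0 \<subseteq> p" using gsp homogeneous_idealD[OF pd(2)] by auto
    have H0c: "?H0 \<subseteq> carrier A" using gs(1) by auto
    have H0h: "?H0 \<subseteq> homogeneous_elements \<A>"
      using gs(1) component_in by (auto simp: homogeneous_elements_def)
    interpret J: ideal "Idl ?H0" A using H0c by (rule genideal_ideal)
    have "g \<in> Idl ?H0" if g: "g \<in> set gs" for g
    proof (rule ideal_contains_components_imp[OF J.ideal_axioms])
      show "g \<in> carrier A" using g gs(1) by blast
      fix n show "component n g \<in> Idl ?H0"
      proof (cases "component n g = \<zero>")
        case False
        then have "component n g \<in> ?H0" using g by blast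
        then show ?thesis using genideal_self[OF H0c] by blast
      qed simp
    qed
    then have "p \<subseteq> Idl ?H0" unfolding gs(2) by (intro genideal_minimal J.ideal_axioms) blast
    moreover have "Idl ?H0 \<subseteq> p" using H0p by (intro genideal_minimal p.ideal_axioms)
    ultimately show ?thesis using H0h component_finite gs(1) by (auto simp: F_def)
  qed
  then obtain H where H: "H \<in> F" "\<And>H'. H' \<in> F \<Longrightarrow> card H \<le> card H'"
    using ex_has_least_nat[of "\<lambda>H. H \<in> F" ?H0 card] by blast
  then have Hp: "finite H" "H \<subseteq> homogeneous_elements \<A>" "Idl H = p" by (auto simp: F_def)
  have Hc: "H \<subseteq> carrier A" using Hp homogeneous_elements_carrier by blast
  have "card H \<le> length gs"
  proof (rule ccontr)
    assume "\<not> ?thesis"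
    then have len: "length gs < card H" by simp
    define X where "X = add_span {a \<otimes> q |a q. a \<in> mm \<and> q \<in> p}"
    have Sc: "{a \<otimes> q |a q. a \<in> mm \<and> q \<in> p} \<subseteq> carrier A" using m.Icarr p.Icarr by auto
    have neg: "\<ominus> x \<in> {a \<otimes> q |a q. a \<in> mm \<and> q \<in> p}" if x: "x \<in> {a \<otimes> q |a q. a \<in> mm \<and> q \<in> p}" for x
    proof -
      obtain a q where "x = a \<otimes> q" "a \<in> mm" "q \<in> p" using x by blast
      then have "\<ominus> x = (\<ominus> a) \<otimes> q" "\<ominus> a \<in> mm" "q \<in> p" using m.Icarr p.Icarr by (auto simp: l_minus)
      then show ?thesis by blast
    qed
    have X: "additive_subgroup X A" unfolding X_def by (rule add_span_additive_subgroup[OF Sc neg])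
    have "\<exists>\<kappa>. (\<forall>i. \<kappa> i \<in> carrier A) \<and> (\<exists>i\<in>H. \<kappa> i \<notin> mm) \<and> (\<Oplus>i\<in>H. \<kappa> i \<otimes> i) \<in> X"
    proof (rule dependent_modulo_prime[OF primeideal_mm X gs(1) Hp(1) len])
      show "i \<in> Idl (set gs)" if "i \<in> H" for i using that genideal_self[OF Hc] Hp(3) gs(2) by auto
      show "a \<otimes> q \<in> X" if "a \<in> mm" "q \<in> Idl (set gs)" for a q
        unfolding X_def by (rule add_span_gen[OF Sc]) (use that gs(2) in blast)
    qed
    then obtain \<kappa> b where \<kappa>: "\<And>i. \<kappa> i \<in> carrier A" "b \<in> H" "\<kappa> b \<notin> mm" "(\<Oplus>i\<in>H. \<kappa> i \<otimes> i) \<in> X" by blast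
    define H' where "H' = H - {b}"
    have H': "H = insert b H'" "b \<notin> H'" "finite H'" "H' \<subseteq> homogeneous_elements \<A>" "H' \<subseteq> carrier A"
      using \<kappa>(2) Hp Hc by (auto simp: H'_def)
    have bc: "b \<in> carrier A" using \<kappa>(2) Hc by blast
    define J where "J = Idl H'"
    have Jh: "homogeneous_ideal A \<A> J" unfolding J_def by (rule homogeneous_Idl[OF H'(4)])
    interpret J: ideal J A using Jh by (simp add: homogeneous_ideal_def)
    have H'J: "H' \<subseteq> J" unfolding J_def by (rule genideal_self[OF H'(5)])
    have XJ: "\<exists>m\<in>mm. x \<ominus> m \<otimes> b \<in> J" if "x \<in> X" for x
      using that unfolding X_def
    proof (induction rule: add_span.induct)
      case zero
      have "\<zero> \<ominus> \<zero> \<otimes> b \<in> J" using bc by simp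
      then show ?case using m.zero_closed by blast
    next
      case (step x r)
      obtain m where m: "m \<in> mm" "r \<ominus> m \<otimes> b \<in> J" using step(3) by blast
      obtain a q where x: "x = a \<otimes> q" "a \<in> mm" "q \<in> p" using step(1) by blast
      have "q \<in> Idl (insert b H')" using x(3) Hp(3) H'(1) by simp
      then obtain c d where q: "c \<in> carrier A" "d \<in> J" "q = c \<otimes> b \<oplus> d"
        using Idl_insertE[OF bc H'(5)] unfolding J_def by blast
      have rc: "r \<in> carrier A" using add_span_carrier[OF Sc step(2)] .
      have "a \<otimes> c \<oplus> m \<in> mm" using x(2) q(1) m(1) m.I_r_closed m.a_closed by blast
      moreover have "x \<oplus> r \<ominus> (a \<otimes> c \<oplus> m) \<otimes> b = a \<otimes> d \<oplus> (r \<ominus> m \<otimes> b)"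
        unfolding x(1) q(3) using m.Icarr[OF x(2)] q(1) J.Icarr[OF q(2)] m.Icarr[OF m(1)] rc bc by algebra
      moreover have "a \<otimes> d \<oplus> (r \<ominus> m \<otimes> b) \<in> J"
        using J.I_l_closed[OF q(2) m.Icarr[OF x(2)]] m(2) J.a_closed by blast
      ultimately show ?case by metis
    qed
    have sumJ: "(\<Oplus>i\<in>H'. \<kappa> i \<otimes> i) \<in> J"
      using H'J \<kappa>(1) J.I_l_closed by (intro finsum_additive_subgroup[OF J.additive_subgroup_axioms]) blast
    have "(\<Oplus>i\<in>H. \<kappa> i \<otimes> i) = \<kappa> b \<otimes> b \<oplus> (\<Oplus>i\<in>H'. \<kappa> i \<otimes> i)"
      unfolding H'(1) using H' \<kappa>(1) bc by (intro finsum_insert) auto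
    moreover obtain m where m: "m \<in> mm" "(\<Oplus>i\<in>H. \<kappa> i \<otimes> i) \<ominus> m \<otimes> b \<in> J" using XJ[OF \<kappa>(4)] by blast
    ultimately have *: "\<kappa> b \<otimes> b \<oplus> (\<Oplus>i\<in>H'. \<kappa> i \<otimes> i) \<ominus> m \<otimes> b \<in> J" by simp
    define S where "S = (\<Oplus>i\<in>H'. \<kappa> i \<otimes> i)"
    have "(\<kappa> b \<ominus> m) \<otimes> b = (\<kappa> b \<otimes> b \<oplus> S \<ominus> m \<otimes> b) \<ominus> S"
      using \<kappa>(1)[of b] m.Icarr[OF m(1)] bc J.Icarr[OF sumJ] unfolding S_def[symmetric] by algebra
    also have "\<dots> \<in> J" using * sumJ unfolding S_def[symmetric]
      by (rule additive_subgroup_minus[OF J.additive_subgroup_axioms])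
    finally have cJ: "(\<kappa> b \<ominus> m) \<otimes> b \<in> J" .
    have "\<kappa> b \<ominus> m \<notin> mm"
    proof
      assume "\<kappa> b \<ominus> m \<in> mm"
      then have "(\<kappa> b \<ominus> m) \<oplus> m \<in> mm" using m(1) m.a_closed by blast
      moreover have "(\<kappa> b \<ominus> m) \<oplus> m = \<kappa> b" using \<kappa>(1)[of b] m.Icarr[OF m(1)] by algebra
      ultimately show False using \<kappa>(3) by simp
    qed
    moreover obtain d where "b \<in> \<A> d" using \<kappa>(2) Hp(2) by (auto simp: homogeneous_elements_def)
    ultimately have "b \<in> J" using homogeneous_cancel_unit[OF Jh] cJ \<kappa>(1) m.Icarr[OF m(1)] by blast
    then have "insert b H' \<subseteq> J" using H'J by blast
    then have "p \<subseteq> J" unfolding Hp(3)[symmetric] H'(1) by (intro genideal_minimal J.ideal_axioms)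
    moreover have "J \<subseteq> p" unfolding J_def Hp(3)[symmetric] using subset_Idl_subset[OF Hc] H'(1) by blast
    ultimately have "H' \<in> F" using H' by (auto simp: F_def J_def)
    then have "card H \<le> card H'" using H(2) by blast
    then show False using H' by simp
  qed
  moreover obtain hs where "set hs = H" "distinct hs" using finite_distinct_list[OF Hp(1)] by blast
  ultimately show ?thesis using Hp distinct_card by (intro exI[where x = hs]) force
qed

end

section \<open>Analytic independence of the generators at a closed point\<close>

lemma card_box_restricted:
  assumes "i < s"
  shows "card {\<alpha> \<in> box s N. count \<alpha> i < m} \<le> m * (N + 1) ^ (s - 1)"
proof -
  let ?r = "\<lambda>\<alpha>. restrict (count \<alpha>) {..<s}" and ?B = "\<lambda>j. if j = i then {..<m} else {..N}"
  have fin: "finite (PiE {..<s} ?B)" by (intro finite_PiE) auto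
  have "inj_on ?r {\<alpha> \<in> box s N. count \<alpha> i < m}"
    using bij_betw_imp_inj_on[OF bij_box] by (rule inj_on_subset) auto
  moreover have "?r ` {\<alpha> \<in> box s N. count \<alpha> i < m} \<subseteq> PiE {..<s} ?B"
    by (auto simp: box_def PiE_def extensional_def)
  ultimately have "card {\<alpha> \<in> box s N. count \<alpha> i < m} \<le> card (PiE {..<s} ?B)"
    by (rule card_inj_on_le[OF _ _ fin])
  also have "\<dots> = (\<Prod>j\<in>{..<s}. card (?B j))" by (rule card_PiE) simp
  also have "\<dots> = m * (\<Prod>j\<in>{..<s} - {i}. card (?B j))"
    using assms by (subst prod.remove[of _ i]) auto
  also have "(\<Prod>j\<in>{..<s} - {i}. card (?B j)) = (\<Prod>j\<in>{..<s} - {i}. N + 1)"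
    by (rule prod.cong) auto
  also have "\<dots> = (N + 1) ^ (s - 1)" using assms by simp
  finally show ?thesis .
qed

context cring
begin

lemma higher_shift:
  assumes h: "h \<in> UNIV \<rightarrow> carrier R" and u: "u \<in> higher h s \<beta>" and \<delta>: "\<delta> \<in> exps s"
  shows "u \<otimes> powprod h \<delta> \<in> higher h s (\<beta> + \<delta>)"
proof -
  let ?Y = "powprod h ` {\<gamma> \<in> exps s. \<beta> < \<gamma>}"
  have Y: "?Y \<subseteq> carrier R" using powprod_closed[OF h] by auto
  interpret J: ideal "higher h s (\<beta> + \<delta>)" R using h by (rule higher_ideal)
  have d: "powprod h \<delta> \<in> carrier R" by (rule powprod_closed[OF h])
  from Y u[unfolded higher_def] show ?thesis
  proof (induction rule: Idl_induct)
    case zero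
    then show ?case using d by simp
  next
    case (add b y r)
    define x where "x = b \<otimes> y"
    obtain \<gamma> where "y = powprod h \<gamma>" "\<gamma> \<in> exps s" "\<beta> < \<gamma>" using add(2) by blast
    with add(1) x_def have x: "x = b \<otimes> powprod h \<gamma>" "b \<in> carrier R" "\<gamma> \<in> exps s" "\<beta> < \<gamma>" by auto
    have g: "powprod h \<gamma> \<in> carrier R" by (rule powprod_closed[OF h])
    have r: "r \<in> carrier R" by (rule add(3))
    have "x \<otimes> powprod h \<delta> = b \<otimes> powprod h (\<gamma> + \<delta>)"
      unfolding x(1) powprod_union[OF h] using x(2) g d by (simp add: m_assoc)
    moreover have "powprod h (\<gamma> + \<delta>) \<in> higher h s (\<beta> + \<delta>)"
      using x \<delta> by (intro powprod_in_higher[OF h]) auto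
    ultimately have "x \<otimes> powprod h \<delta> \<in> higher h s (\<beta> + \<delta>)" using x(2) J.I_l_closed by simp
    moreover have "(x \<oplus> r) \<otimes> powprod h \<delta> = x \<otimes> powprod h \<delta> \<oplus> r \<otimes> powprod h \<delta>"
      using x(1,2) g r d by (simp add: l_distr)
    ultimately show ?case using add(4) J.a_closed unfolding x_def by simp
  qed
qed

end

text \<open>A closed point \<open>p\<close> of Proj, homogeneous generators \<open>g 0, \<dots>, g (s - 1)\<close> of it, and a
  coordinate \<open>z\<close> that does not vanish there. Outside the index range \<open>g\<close> may be zero, which has every
  degree; this makes it possible to ask for positive degrees throughout.\<close>
locale maximal_relevant = standard_graded_algebra +
  fixes p :: "'a set" and g :: "nat \<Rightarrow> 'a" and c :: "nat \<Rightarrow> nat" and s :: nat and z :: 'a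
  assumes relevant: "p \<in> relevant_primes A \<A> xs"
    and maximal: "\<And>p'. p' \<in> relevant_primes A \<A> xs \<Longrightarrow> p \<subseteq> p' \<Longrightarrow> p' = p"
    and g_degree: "\<And>i. g i \<in> \<A> (c i)"
    and c_pos: "\<And>i. c i > 0"
    and p_gen: "p = Idl (g ` {..<s})"
    and z: "z \<in> set xs" "z \<notin> p"
begin

sublocale p: primeideal p A
  using relevant_primesD(1)[OF relevant] .

definition deg :: "nat multiset \<Rightarrow> nat" where
  "deg \<alpha> = sum_mset (image_mset c \<alpha>)"

lemma deg_simps [simp]: "deg {#} = 0" "deg (add_mset i \<alpha>) = c i + deg \<alpha>" "deg (\<alpha> + \<beta>) = deg \<alpha> + deg \<beta>"
  by (auto simp: deg_def)

lemma g_fun: "g \<in> UNIV \<rightarrow> carrier A"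
  using g_degree comp_carrier by blast

abbreviation gp :: "nat multiset \<Rightarrow> 'a" where "gp \<equiv> powprod g"

lemmas gp_carrier [simp] = powprod_closed[OF g_fun]
lemmas gp_simps = powprod_empty[OF g_fun] powprod_add_mset[OF g_fun] powprod_union[OF g_fun]

lemma gp_degree: "gp \<alpha> \<in> \<A> (deg \<alpha>)"
  unfolding deg_def using g_degree one_comp by (rule powprod_homogeneous)

lemma z_degree: "z \<in> \<A> 1" and z_carrier [simp]: "z \<in> carrier A"
  using z gens_degree_1 comp_carrier by auto

lemma zpow_degree: "z [^] (i::nat) \<in> \<A> i"
proof (induction i)
  case 0
  then show ?case using one_comp by simp
next
  case (Suc i)
  then show ?case using component_mult[OF Suc z_degree] by simp
qed

lemma count_le_deg: "count \<alpha> i \<le> deg \<alpha>"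
proof (induction \<alpha>)
  case (add j \<alpha>)
  then show ?case using c_pos[of j] by auto
qed simp

lemma deg_box: "\<alpha> \<in> exps s \<Longrightarrow> deg \<alpha> \<le> N \<Longrightarrow> \<alpha> \<in> box s N"
  unfolding box_def using le_trans[OF count_le_deg] by blast

lemma higher_homogeneous: "homogeneous_ideal A \<A> (higher g s \<alpha>)"
  unfolding higher_def
  by (rule homogeneous_Idl) (use gp_degree in \<open>auto simp: homogeneous_elements_def\<close>)

lemma prime_mult_in_higher:
  assumes "q \<in> p" "\<alpha> \<in> exps s" shows "q \<otimes> gp \<alpha> \<in> higher g s \<alpha>"
proof -
  have "g ` {..<s} \<subseteq> powprod g ` {\<gamma> \<in> exps s. {#} < \<gamma>}"
  proof
    fix y assume "y \<in> g ` {..<s}"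
    then obtain i where i: "i < s" "y = gp {#i#}" using gp_simps powprod_single[OF g_fun] by auto
    moreover have "{#} < {#i#}" by simp
    ultimately show "y \<in> powprod g ` {\<gamma> \<in> exps s. {#} < \<gamma>}" by (intro image_eqI[of _ _ "{#i#}"]) auto
  qed
  then have "p \<subseteq> higher g s {#}"
    unfolding p_gen higher_def by (intro subset_Idl_subset) auto
  then show ?thesis using higher_shift[OF g_fun _ assms(2), of q "{#}"] assms(1) by auto
qed

text \<open>An element \<open>e\<close> outside \<open>p\<close> has no zeros at a closed point: by maximality no relevant prime
  contains both \<open>p\<close> and \<open>e\<close>.\<close>
lemma large_degree_decomposition:
  assumes "e \<in> \<A> d" "e \<notin> p"
  shows "\<exists>N. \<forall>n\<ge>N. \<forall>a\<in>\<A> n. \<exists>b q. b \<in> carrier A \<and> q \<in> p \<and> a = b \<otimes> e \<oplus> q"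
proof -
  have ec: "e \<in> carrier A" using assms comp_carrier by blast
  let ?Y = "insert e (p \<inter> homogeneous_elements \<A>)"
  have Y: "?Y \<subseteq> homogeneous_elements \<A>" using assms by (auto simp: homogeneous_elements_def)
  have Yc: "?Y \<subseteq> carrier A" using Y homogeneous_elements_carrier by blast
  have peq: "p = Idl (p \<inter> homogeneous_elements \<A>)"
    using relevant_primesD(2)[OF relevant] by (simp add: homogeneous_ideal_def)
  have "\<not> Idl ?Y \<subseteq> p'" if p': "p' \<in> relevant_primes A \<A> xs" for p'
  proof
    assume sub: "Idl ?Y \<subseteq> p'"
    then have "?Y \<subseteq> p'" using genideal_self[OF Yc] by blast
    moreover have "p \<subseteq> p'"
      by (subst peq, rule genideal_minimal[OF relevant_primesD(4)[OF p']]) (use \<open>?Y \<subseteq> p'\<close> in blast)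
    ultimately show False using maximal[OF p'] assms(2) by blast
  qed
  then obtain N where N: "\<And>n. n \<ge> N \<Longrightarrow> \<A> n \<subseteq> Idl ?Y"
    using no_relevant_prime_imp_large_degrees[OF homogeneous_Idl[OF Y]] by blast
  have "\<exists>b q. b \<in> carrier A \<and> q \<in> p \<and> a = b \<otimes> e \<oplus> q" if "n \<ge> N" "a \<in> \<A> n" for n a
  proof -
    have "a \<in> Idl ?Y" using N that by blast
    then obtain b q where "b \<in> carrier A" "q \<in> Idl (p \<inter> homogeneous_elements \<A>)" "a = b \<otimes> e \<oplus> q"
      using Idl_insertE[OF ec, of "p \<inter> homogeneous_elements \<A>"] Yc by blast
    then show ?thesis using peq by blast
  qed
  then show ?thesis by blast
qed

text \<open>Division with remainder by the monomials in \<open>g\<close>. The span of \<open>d z\<^sup>i g\<^sup>\<alpha>\<close> is shown to contain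
  \<open>a g\<^sup>\<alpha>\<close> by downward induction on \<open>\<alpha>\<close>, which is possible since only finitely many exponents have degree
  at most \<open>N\<close>. Modulo \<open>p\<close>, powers of \<open>z\<close> can be split off from \<open>a\<close> until its degree is less than \<open>N0\<close>;
  the part in \<open>p\<close> leads to later monomials. For \<open>\<alpha>\<close> outside \<open>G\<close>, all \<open>a\<close> of degree at least \<open>N0\<close> lead to
  later monomials at once, so that no power of \<open>z\<close> is needed. With all exponents in \<open>G\<close> this gives the
  obvious bound on the growth; a smaller \<open>G\<close> gives a better one.\<close>
lemma spanning_products:
  assumes N0: "N0 > 0" and D: "set D \<subseteq> carrier A" "\<And>n. n < N0 \<Longrightarrow> \<A> n \<subseteq> Span k D"
    and zdec: "\<And>n a. n \<ge> N0 \<Longrightarrow> a \<in> \<A> n \<Longrightarrow> \<exists>b q. b \<in> carrier A \<and> q \<in> p \<and> a = b \<otimes> z \<oplus> q"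
    and G: "\<And>\<alpha> n a. \<alpha> \<in> exps s \<Longrightarrow> \<alpha> \<notin> G \<Longrightarrow> n \<ge> N0 \<Longrightarrow> a \<in> \<A> n \<Longrightarrow> a \<otimes> gp \<alpha> \<in> higher g s \<alpha>"
    and T: "set T \<subseteq> carrier A"
      "\<And>d i \<alpha>. \<lbrakk>d \<in> set D; i \<le> N; \<alpha> \<in> exps s; deg \<alpha> \<le> N; \<alpha> \<in> G \<or> i = 0\<rbrakk> \<Longrightarrow> d \<otimes> z [^] i \<otimes> gp \<alpha> \<in> set T"
    and n: "n \<le> N"
  shows "\<A> n \<subseteq> Span k T"
proof -
  have Tsub: "additive_subgroup (Span k T) A"
    using Span_is_add_subgroup[OF base_subfield T(1)] by (rule additive_subgroup.intro)
  interpret T: additive_subgroup "Span k T" A by (rule Tsub)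
  have Tk: "\<kappa> \<otimes> a \<in> Span k T" if "\<kappa> \<in> k" "a \<in> Span k T" for \<kappa> a
    using Span_smult_closed[OF base_subfield T(1)] that by blast
  have base: "a \<otimes> z [^] i \<otimes> gp \<alpha> \<in> Span k T"
    if a: "a \<in> \<A> n" "n < N0" and i: "i \<le> N" "\<alpha> \<in> exps s" "deg \<alpha> \<le> N" "\<alpha> \<in> G \<or> i = 0" for a n i \<alpha>
  proof -
    define u where "u = z [^] i \<otimes> gp \<alpha>"
    have u: "u \<in> carrier A" by (simp add: u_def)
    have "Span k D \<subseteq> {a \<in> carrier A. a \<otimes> u \<in> Span k T}"
    proof (rule Span_subset)
      show "set D \<subseteq> {a \<in> carrier A. a \<otimes> u \<in> Span k T}"
      proof safe
        fix d assume d: "d \<in> set D"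
        then show dc: "d \<in> carrier A" using D(1) by blast
        have "d \<otimes> z [^] i \<otimes> gp \<alpha> \<in> Span k T"
          using T(2)[OF d i] Span_base_incl[OF base_subfield T(1)] by blast
        then show "d \<otimes> u \<in> Span k T" unfolding u_def using dc by (simp add: m_assoc)
      qed
      show "additive_subgroup {a \<in> carrier A. a \<otimes> u \<in> Span k T} A"
      proof (intro additive_subgroup.intro add.subgroupI)
        have "\<zero> \<in> {a \<in> carrier A. a \<otimes> u \<in> Span k T}" using u T.zero_closed by (simp del: Span.simps)
        then show "{a \<in> carrier A. a \<otimes> u \<in> Span k T} \<noteq> {}" by blast
      qed (use u T.a_closed T.a_inv_closed in \<open>auto simp: l_distr l_minus simp del: Span.simps\<close>)
      show "\<kappa> \<otimes> a \<in> {a \<in> carrier A. a \<otimes> u \<in> Span k T}"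
        if "\<kappa> \<in> k" "a \<in> {a \<in> carrier A. a \<otimes> u \<in> Span k T}" for \<kappa> a
        using that Tk[of \<kappa> "a \<otimes> u"] k_props(1) u by (auto simp: m_assoc subset_iff simp del: Span.simps)
    qed
    then show ?thesis using a D(2) comp_carrier unfolding u_def by (auto simp: m_assoc simp del: Span.simps)
  qed
  have main: "a \<otimes> gp \<alpha> \<in> Span k T" if "\<alpha> \<in> exps s" "a \<in> \<A> n" "n + deg \<alpha> \<le> N" for \<alpha> a n
  proof (rule ccontr)
    assume neg: "a \<otimes> gp \<alpha> \<notin> Span k T"
    define bad where "bad = {\<alpha> \<in> exps s. \<exists>n a. a \<in> \<A> n \<and> n + deg \<alpha> \<le> N \<and> a \<otimes> gp \<alpha> \<notin> Span k T}"
    have "bad \<subseteq> box s N" unfolding bad_def using deg_box by auto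
    then have fin: "finite bad" using finite_box finite_subset by blast
    have "bad \<noteq> {}" using that neg unfolding bad_def by blast
    define \<beta> where "\<beta> = Max bad"
    have \<beta>: "\<beta> \<in> bad" unfolding \<beta>_def using fin \<open>bad \<noteq> {}\<close> by (rule Max_in)
    have ok: "a \<otimes> gp \<gamma> \<in> Span k T" if "\<gamma> \<in> exps s" "\<beta> < \<gamma>" "a \<in> \<A> n" "n + deg \<gamma> \<le> N" for \<gamma> a n
    proof (rule ccontr)
      assume "\<not> ?thesis"
      then have "\<gamma> \<in> bad" unfolding bad_def using that by blast
      then have "\<gamma> \<le> \<beta>" unfolding \<beta>_def using fin by (intro Max_ge)
      then show False using that(2) by simp
    qed
    have high: "u \<in> Span k T" if u: "u \<in> \<A> M" "M \<le> N" "u \<in> higher g s \<beta>" for u M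
    proof -
      let ?Y = "powprod g ` {\<gamma> \<in> exps s. \<beta> < \<gamma>}"
      have Y: "?Y \<subseteq> homogeneous_elements \<A>" using gp_degree by (auto simp: homogeneous_elements_def)
      have "component M u = u" using component_homogeneous[OF u(1), of M] by simp
      then have "u \<in> add_span {b \<otimes> y |b y d. y \<in> ?Y \<inter> \<A> d \<and> d \<le> M \<and> b \<in> \<A> (M - d)}"
        using component_Idl_homogeneous[OF Y, of u M] u(3) by (simp add: higher_def)
      moreover have "{b \<otimes> y |b y d. y \<in> ?Y \<inter> \<A> d \<and> d \<le> M \<and> b \<in> \<A> (M - d)} \<subseteq> Span k T"
      proof safe
        fix b d \<gamma> assume b: "gp \<gamma> \<in> \<A> d" "d \<le> M" "b \<in> \<A> (M - d)" and \<gamma>: "\<gamma> \<in> exps s" "\<beta> < \<gamma>"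
        show "b \<otimes> gp \<gamma> \<in> Span k T"
        proof (cases "gp \<gamma> = \<zero>")
          case True
          then show ?thesis using b(3) comp_carrier T.zero_closed by (simp del: Span.simps)
        next
          case False
          then have "d = deg \<gamma>"
            using component_homogeneous[OF b(1), of "deg \<gamma>"] component_homogeneous[OF gp_degree[of \<gamma>], of "deg \<gamma>"]
            by (auto split: if_splits)
          then show ?thesis using ok[OF \<gamma> b(3)] b(2) u(2) by simp
        qed
      qed
      ultimately show ?thesis using add_span_subset[OF Tsub] by blast
    qed
    obtain n a where a: "\<beta> \<in> exps s" "a \<in> \<A> n" "n + deg \<beta> \<le> N" "a \<otimes> gp \<beta> \<notin> Span k T"
      using \<beta> unfolding bad_def by blast
    have ac: "a \<in> carrier A" using a comp_carrier by blast
    show False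
    proof (cases "\<beta> \<in> G")
      case False
      show False
      proof (cases "n < N0")
        case True
        have "a \<otimes> z [^] (0::nat) \<otimes> gp \<beta> \<in> Span k T" using base[OF a(2) True, of 0 \<beta>] a by (simp del: Span.simps)
        then show False using a(4) ac by (simp del: Span.simps)
      next
        case False
        then show False
          using high[OF component_mult[OF a(2) gp_degree[of \<beta>]] a(3)] G[OF a(1) \<open>\<beta> \<notin> G\<close> _ a(2)] a(4) by auto
      qed
    next
      case True
      have "a \<otimes> z [^] i \<otimes> gp \<beta> \<in> Span k T" if "a \<in> \<A> n" "n + i + deg \<beta> \<le> N" for a n i
        using that
      proof (induction n arbitrary: a i rule: less_induct)
        case (less n)
        show ?case
        proof (cases "n < N0")
          case True
          then show ?thesis using base[OF less(2) True, of i \<beta>] less(3) a(1) \<open>\<beta> \<in> G\<close> by (simp del: Span.simps)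
        next
          case False
          then obtain m where m: "n = Suc m" using N0 by (cases n) auto
          obtain b q where b: "b \<in> carrier A" "q \<in> p" "a = b \<otimes> z \<oplus> q" using zdec[OF _ less(2)] False by auto
          define b' q' where "b' = component m b" and "q' = component n q"
          have "a = component n (b \<otimes> z \<oplus> q)" using component_homogeneous[OF less(2), of n] b(3) by simp
          also have "\<dots> = b' \<otimes> z \<oplus> q'"
            using b(1) p.Icarr[OF b(2)] component_mult_homogeneous[OF b(1) z_degree, of n]
            by (simp add: component_add m b'_def q'_def)
          finally have aeq: "a = b' \<otimes> z \<oplus> q'" .
          have b': "b' \<in> \<A> m" "b' \<in> carrier A" using b(1) component_in by (auto simp: b'_def)
          have q': "q' \<in> p" "q' \<in> \<A> n" "q' \<in> carrier A"
            using b(2) homogeneous_idealD[OF relevant_primesD(2)[OF relevant]] p.Icarr component_in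
            by (auto simp: q'_def)
          define Z B where "Z = z [^] i" and "B = gp \<beta>"
          have ZB: "Z \<in> carrier A" "B \<in> carrier A" by (auto simp: Z_def B_def)
          have "b' \<otimes> z [^] Suc i \<otimes> gp \<beta> \<in> Span k T" using less(1)[OF _ b'(1), of "Suc i"] m less(3) by (simp del: Span.simps)
          then have 1: "b' \<otimes> (Z \<otimes> z) \<otimes> B \<in> Span k T" by (simp add: Z_def B_def del: Span.simps)
          have "q' \<otimes> Z \<otimes> B \<in> \<A> (n + i + deg \<beta>)"
            unfolding Z_def B_def using q'(2) zpow_degree gp_degree by (intro component_mult)
          moreover have "(q' \<otimes> Z) \<otimes> B \<in> higher g s \<beta>"
            unfolding B_def by (rule prime_mult_in_higher[OF p.I_r_closed[OF q'(1) ZB(1)] a(1)])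
          ultimately have 2: "q' \<otimes> Z \<otimes> B \<in> Span k T" using high less(3) by blast
          have "a \<otimes> Z \<otimes> B = b' \<otimes> (Z \<otimes> z) \<otimes> B \<oplus> q' \<otimes> Z \<otimes> B"
            unfolding aeq using b'(2) q'(3) ZB z_carrier by algebra
          then show ?thesis using 1 2 T.a_closed unfolding Z_def B_def by (simp del: Span.simps)
        qed
      qed
      from this[OF a(2), of 0] show False using a(3,4) ac by (simp del: Span.simps)
    qed
  qed
  show ?thesis
  proof
    fix a assume a: "a \<in> \<A> n"
    have "a \<otimes> gp {#} \<in> Span k T" using main[of "{#}" a n] a n by (simp del: Span.simps)
    then show "a \<in> Span k T" using a comp_carrier gp_simps(1) by (simp del: Span.simps)
  qed
qed

lemma low_degree_span: "\<exists>D. set D \<subseteq> carrier A \<and> (\<forall>n<N. \<A> n \<subseteq> Span k D)"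
proof -
  define D where "D = map (powprod gen) (sorted_list_of_set (box (length xs) N))"
  have Dc: "set D \<subseteq> carrier A" using powprod_closed[OF gen_carrier] by (auto simp: D_def)
  have Dsub: "additive_subgroup (Span k D) A"
    using Span_is_add_subgroup[OF base_subfield Dc] by (rule additive_subgroup.intro)
  have "\<A> n \<subseteq> Span k D" if "n < N" for n
  proof
    fix a assume "a \<in> \<A> n"
    then have a: "a \<in> add_span {c \<otimes> powprod gen \<alpha> |c \<alpha>. c \<in> k \<and> \<alpha> \<in> exps (length xs) \<and> size \<alpha> = n}"
      by (rule comp_powprods)
    have "{c \<otimes> powprod gen \<alpha> |c \<alpha>. c \<in> k \<and> \<alpha> \<in> exps (length xs) \<and> size \<alpha> = n} \<subseteq> Span k D"
    proof safe
      fix \<kappa> \<alpha> assume \<alpha>: "\<kappa> \<in> k" "\<alpha> \<in> exps (length xs)" "n = size \<alpha>"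
      have "count \<alpha> i \<le> N" for i using \<alpha>(3) that by (metis count_le_size le_trans less_imp_le_nat)
      then have "powprod gen \<alpha> \<in> set D" using \<alpha>(2) finite_box by (auto simp: D_def box_def)
      then show "\<kappa> \<otimes> powprod gen \<alpha> \<in> Span k D"
        using Span_smult_closed[OF base_subfield Dc \<alpha>(1)] Span_base_incl[OF base_subfield Dc] by blast
    qed
    then show "a \<in> Span k D" using add_span_subset[OF Dsub _ a] by blast
  qed
  then show ?thesis using Dc by blast
qed

text \<open>The span of the previous lemma has at most a constant times \<open>(N + 1)\<^sup>s\<close> elements with \<open>i = 0\<close>,
  and those with \<open>i > 0\<close> are counted by \<open>G\<close>.\<close>
lemma growth_bound:
  assumes G: "\<And>\<alpha> n a. \<alpha> \<in> exps s \<Longrightarrow> \<alpha> \<notin> G \<Longrightarrow> n \<ge> N1 \<Longrightarrow> a \<in> \<A> n \<Longrightarrow> a \<otimes> gp \<alpha> \<in> higher g s \<alpha>"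
    and cardG: "\<And>N. card (box s N \<inter> G) * (N + 1) \<le> m * (N + 1) ^ e" and se: "s \<le> e"
    and C: "\<And>i. i \<le> h \<Longrightarrow> primeideal (C i) A" "\<And>i. i < h \<Longrightarrow> C i \<subset> C (Suc i)"
  shows "h \<le> e"
proof -
  obtain N2 where N2: "\<forall>n\<ge>N2. \<forall>a\<in>\<A> n. \<exists>b q. b \<in> carrier A \<and> q \<in> p \<and> a = b \<otimes> z \<oplus> q"
    using large_degree_decomposition[OF z_degree z(2)] by blast
  define N0 where "N0 = Suc (max N1 N2)"
  obtain D where D: "set D \<subseteq> carrier A" "\<And>n. n < N0 \<Longrightarrow> \<A> n \<subseteq> Span k D" using low_degree_span by blast
  have "\<exists>L. set L \<subseteq> carrier A \<and> length L \<le> (length D * Suc m) * (N + 1) ^ e \<and> (\<forall>n\<le>N. \<A> n \<subseteq> Span k L)" for N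
  proof -
    define I where "I = {0} \<times> box s N \<union> {..N} \<times> (box s N \<inter> G)"
    define S where "S = (\<lambda>(d, i, \<alpha>). d \<otimes> z [^] i \<otimes> gp \<alpha>) ` (set D \<times> I)"
    have finI: "finite I" using finite_box by (auto simp: I_def)
    have "card I \<le> card ({0::nat} \<times> box s N) + card ({..N} \<times> (box s N \<inter> G))"
      unfolding I_def by (rule card_Un_le)
    also have "\<dots> = (N + 1) ^ s + card (box s N \<inter> G) * (N + 1)"
      using card_box by (simp add: card_cartesian_product)
    also have "\<dots> \<le> (N + 1) ^ e + m * (N + 1) ^ e"
      using cardG[of N] power_increasing[OF se, of "N + 1"] by simp
    finally have cI: "card I \<le> Suc m * (N + 1) ^ e" by simp
    have finS: "finite S" unfolding S_def using finI by simp
    have "card S \<le> card (set D \<times> I)" unfolding S_def using finI by (intro card_image_le) simp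
    also have "\<dots> \<le> length D * (Suc m * (N + 1) ^ e)"
      unfolding card_cartesian_product using cI by (intro mult_le_mono card_length)
    finally have cS: "card S \<le> (length D * Suc m) * (N + 1) ^ e" by (simp only: mult.assoc)
    obtain T where T: "set T = S" "distinct T" using finite_distinct_list[OF finS] by blast
    have Tc: "set T \<subseteq> carrier A" using D(1) by (auto simp: T(1) S_def)
    have "\<A> n \<subseteq> Span k T" if n: "n \<le> N" for n
    proof (rule spanning_products[where G = G and D = D and ?N0.0 = N0, OF _ D _ _ Tc _ n])
      show "N0 > 0" by (simp add: N0_def)
      show "\<exists>b q. b \<in> carrier A \<and> q \<in> p \<and> a = b \<otimes> z \<oplus> q" if "n \<ge> N0" "a \<in> \<A> n" for n a
      proof -
        have "n \<ge> N2" using that(1) by (simp add: N0_def)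
        then show ?thesis using N2 that(2) by blast
      qed
      show "a \<otimes> gp \<alpha> \<in> higher g s \<alpha>" if "\<alpha> \<in> exps s" "\<alpha> \<notin> G" "n \<ge> N0" "a \<in> \<A> n" for \<alpha> n a
        using G[OF that(1,2) _ that(4)] that(3) by (simp add: N0_def)
      show "d \<otimes> z [^] i \<otimes> gp \<alpha> \<in> set T"
        if "d \<in> set D" "i \<le> N" "\<alpha> \<in> exps s" "deg \<alpha> \<le> N" "\<alpha> \<in> G \<or> i = 0" for d i \<alpha>
      proof -
        have "(i, \<alpha>) \<in> I" using that deg_box by (auto simp: I_def)
        then show ?thesis unfolding T(1) S_def using that(1) by force
      qed
    qed
    moreover have "length T \<le> (length D * Suc m) * (N + 1) ^ e"
      using cS T distinct_card by metis
    ultimately show ?thesis using Tc by blast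
  qed
  then show ?thesis by (rule prime_chain_length_le[where C = C and h = h, OF _ C])
qed

text \<open>The trivial count: the growth is at most that of polynomials in \<open>z\<close> and the \<open>g i\<close>.\<close>
lemma prime_chain_length_le_Suc:
  assumes C: "\<And>i. i \<le> h \<Longrightarrow> primeideal (C i) A" "\<And>i. i < h \<Longrightarrow> C i \<subset> C (Suc i)"
  shows "h \<le> Suc s"
  by (rule growth_bound[where G = UNIV and m = 1 and C = C and h = h, OF _ _ _ C])
     (use card_box in \<open>auto simp: mult.commute\<close>)

text \<open>If a chain of primes of the maximal possible length \<open>s + 1\<close> exists, then the monomials in \<open>g\<close>
  are analytically independent at \<open>p\<close>. Indeed, let \<open>a g\<^sup>\<beta>\<close> be a combination of later monomials with \<open>a\<close>
  outside \<open>p\<close>. Modulo \<open>p\<close>, all elements of large degree are multiples of (a component of) \<open>a\<close>; so at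
  multiples of \<open>\<beta>\<close> no powers of \<open>z\<close> are needed. The exponents that are not multiples of \<open>\<beta>\<close> have an
  entry below that of \<open>\<beta>\<close> and are fewer by one order of magnitude. The growth would then be \<open>O(N\<^sup>s)\<close>.\<close>
lemma no_initial_relation:
  assumes C: "\<And>i. i \<le> Suc s \<Longrightarrow> primeideal (C i) A" "\<And>i. i < Suc s \<Longrightarrow> C i \<subset> C (Suc i)"
    and a: "a \<in> carrier A" "a \<notin> p" and \<beta>: "\<beta> \<in> exps s"
  shows "a \<otimes> gp \<beta> \<notin> higher g s \<beta>"
proof
  assume rel: "a \<otimes> gp \<beta> \<in> higher g s \<beta>"
  obtain d where d: "component d a \<notin> p"
    using ideal_contains_components_imp[OF p.ideal_axioms a(1)] a(2) by blast
  define e where "e = component d a"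
  have e: "e \<in> \<A> d" "e \<notin> p" "e \<in> carrier A" using d a component_in by (auto simp: e_def)
  have "component (d + deg \<beta>) (a \<otimes> gp \<beta>) = e \<otimes> gp \<beta>"
    using component_mult_homogeneous[OF a(1) gp_degree] by (simp add: e_def)
  then have rel': "e \<otimes> gp \<beta> \<in> higher g s \<beta>" using homogeneous_idealD[OF higher_homogeneous rel] by metis
  obtain N1 where N1: "\<forall>n\<ge>N1. \<forall>a\<in>\<A> n. \<exists>b q. b \<in> carrier A \<and> q \<in> p \<and> a = b \<otimes> e \<oplus> q"
    using large_degree_decomposition[OF e(1,2)] by blast
  define G where "G = {\<alpha>. \<not> \<beta> \<subseteq># \<alpha>}"
  have "Suc s \<le> s"
  proof (rule growth_bound[where G = G and C = C and h = "Suc s" and m = "\<Sum>i<s. count \<beta> i", OF _ _ order_refl C])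
    fix \<alpha> n x assume \<alpha>: "\<alpha> \<in> exps s" "\<alpha> \<notin> G" and n: "N1 \<le> n" "x \<in> \<A> n"
    obtain b q where b: "b \<in> carrier A" "q \<in> p" "x = b \<otimes> e \<oplus> q" using N1 n by blast
    have sub: "\<beta> + (\<alpha> - \<beta>) = \<alpha>" using \<alpha>(2) by (simp add: G_def)
    have al: "gp \<alpha> = gp \<beta> \<otimes> gp (\<alpha> - \<beta>)" using gp_simps(3)[of \<beta> "\<alpha> - \<beta>"] sub by simp
    interpret J: ideal "higher g s \<alpha>" A using higher_ideal[OF g_fun] .
    have 1: "e \<otimes> gp \<beta> \<otimes> gp (\<alpha> - \<beta>) \<in> higher g s \<alpha>"
      using higher_shift[OF g_fun rel' exps_diff[OF \<alpha>(1)], of \<beta>] sub by simp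
    define B D where "B = gp \<beta>" and "D = gp (\<alpha> - \<beta>)"
    have BD: "B \<in> carrier A" "D \<in> carrier A" by (auto simp: B_def D_def)
    have "x \<otimes> gp \<alpha> = b \<otimes> (e \<otimes> B \<otimes> D) \<oplus> q \<otimes> gp \<alpha>"
      unfolding b(3) al B_def[symmetric] D_def[symmetric] using b(1) p.Icarr[OF b(2)] e(3) BD by algebra
    then show "x \<otimes> gp \<alpha> \<in> higher g s \<alpha>"
      using 1 prime_mult_in_higher[OF b(2) \<alpha>(1)] J.I_l_closed b(1) J.a_closed unfolding B_def D_def by simp
  next
    fix N
    have "box s N \<inter> G \<subseteq> (\<Union>i\<in>{..<s}. {\<alpha> \<in> box s N. count \<alpha> i < count \<beta> i})"
    proof
      fix \<alpha> assume \<alpha>: "\<alpha> \<in> box s N \<inter> G"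
      then obtain i where i: "count \<alpha> i < count \<beta> i" by (auto simp: G_def subseteq_mset_def not_le)
      then have "i < s" using exps_count[OF \<beta>, of i] by (cases "i < s") auto
      then show "\<alpha> \<in> (\<Union>i\<in>{..<s}. {\<alpha> \<in> box s N. count \<alpha> i < count \<beta> i})" using \<alpha> i by blast
    qed
    then have "card (box s N \<inter> G) \<le> card (\<Union>i\<in>{..<s}. {\<alpha> \<in> box s N. count \<alpha> i < count \<beta> i})"
      using finite_box by (intro card_mono) auto
    also have "\<dots> \<le> (\<Sum>i<s. card {\<alpha> \<in> box s N. count \<alpha> i < count \<beta> i})" by (rule card_UN_le) simp
    finally have "card (box s N \<inter> G) * (N + 1) \<le> (\<Sum>i<s. card {\<alpha> \<in> box s N. count \<alpha> i < count \<beta> i} * (N + 1))"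
      by (simp only: sum_distrib_right[symmetric] mult_le_mono1)
    also have "\<dots> \<le> (\<Sum>i<s. count \<beta> i * (N + 1) ^ s)"
    proof (rule sum_mono)
      fix i assume "i \<in> {..<s}"
      then have i: "i < s" by simp
      have "card {\<alpha> \<in> box s N. count \<alpha> i < count \<beta> i} * (N + 1) \<le> (count \<beta> i * (N + 1) ^ (s - 1)) * (N + 1)"
        by (intro mult_le_mono1 card_box_restricted i)
      also have "\<dots> = count \<beta> i * (N + 1) ^ Suc (s - 1)" by (simp only: power_Suc2 mult.assoc)
      also have "Suc (s - 1) = s" using i by simp
      finally show "card {\<alpha> \<in> box s N. count \<alpha> i < count \<beta> i} * (N + 1) \<le> count \<beta> i * (N + 1) ^ s" .
    qed
    finally show "card (box s N \<inter> G) * (N + 1) \<le> (\<Sum>i<s. count \<beta> i) * (N + 1) ^ s"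
      by (simp only: sum_distrib_right)
  qed
  then show False by simp
qed

end

section \<open>Expansions in powers of the generators\<close>

context maximal_relevant
begin

definition k_subspace :: "'a set \<Rightarrow> bool" where
  "k_subspace V \<longleftrightarrow> additive_subgroup V A \<and> (\<forall>\<kappa>\<in>k. \<forall>a\<in>V. \<kappa> \<otimes> a \<in> V)"

text \<open>The usual maximality argument, for complements that contain a given subspace.\<close>
lemma k_subspace_complement:
  assumes U: "k_subspace U" "U \<subseteq> \<A> n" "U \<inter> p \<subseteq> {\<zero>}"
  shows "\<exists>V. k_subspace V \<and> U \<subseteq> V \<and> V \<subseteq> \<A> n \<and> V \<inter> p \<subseteq> {\<zero>} \<and> (\<forall>a\<in>\<A> n. \<exists>w\<in>V. \<exists>q\<in>p. a = w \<oplus> q)"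
proof -
  define F where "F = {V. k_subspace V \<and> U \<subseteq> V \<and> V \<subseteq> \<A> n \<and> V \<inter> p \<subseteq> {\<zero>}}"
  have "\<exists>V\<in>F. \<forall>V'\<in>F. V \<subseteq> V' \<longrightarrow> V' = V"
  proof (rule subset_Zorn_nonempty)
    show "F \<noteq> {}" using U by (auto simp: F_def)
    fix C assume C: "C \<noteq> {}" "subset.chain F C"
    have CF: "V \<in> F" if "V \<in> C" for V using C that by (auto simp: subset.chain_def)
    have Csub: "additive_subgroup V A" if "V \<in> C" for V using CF[OF that] by (simp add: F_def k_subspace_def)
    have two: "\<exists>V\<in>C. a \<in> V \<and> b \<in> V" if "a \<in> \<Union>C" "b \<in> \<Union>C" for a b
      using that C(2) unfolding subset.chain_def by blast
    obtain V0 where V0: "V0 \<in> C" using C(1) by blast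
    have "additive_subgroup (\<Union>C) A"
    proof (intro additive_subgroup.intro add.subgroupI)
      show "\<Union>C \<subseteq> carrier A" using Csub additive_subgroup.a_subset by blast
      show "\<Union>C \<noteq> {}" using V0 additive_subgroup.zero_closed[OF Csub[OF V0]] by blast
      show "\<ominus> a \<in> \<Union>C" if aC: "a \<in> \<Union>C" for a
      proof -
        obtain V where "V \<in> C" "a \<in> V" using aC by blast
        then have "\<ominus> a \<in> V" by (intro additive_subgroup.a_inv_closed[OF Csub])
        then show ?thesis using \<open>V \<in> C\<close> by blast
      qed
      show "a \<oplus> b \<in> \<Union>C" if abC: "a \<in> \<Union>C" "b \<in> \<Union>C" for a b
      proof -
        obtain V where "V \<in> C" "a \<in> V" "b \<in> V" using two[OF abC] by blast
        then have "a \<oplus> b \<in> V" by (intro additive_subgroup.a_closed[OF Csub])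
        then show ?thesis using \<open>V \<in> C\<close> by blast
      qed
    qed
    moreover have "\<kappa> \<otimes> a \<in> \<Union>C" if "\<kappa> \<in> k" "a \<in> \<Union>C" for \<kappa> a
      using that CF unfolding F_def k_subspace_def by blast
    ultimately have "k_subspace (\<Union>C)" by (simp add: k_subspace_def)
    then show "\<Union>C \<in> F" using CF V0 unfolding F_def by blast
  qed
  then obtain V where VF: "V \<in> F" and max: "\<And>V'. V' \<in> F \<Longrightarrow> V \<subseteq> V' \<Longrightarrow> V' = V" by blast
  then have V: "k_subspace V" "U \<subseteq> V" "V \<subseteq> \<A> n" "V \<inter> p \<subseteq> {\<zero>}" by (auto simp: F_def)
  interpret V: additive_subgroup V A using V(1) by (simp add: k_subspace_def)
  interpret An: additive_subgroup "\<A> n" A by (rule component_subgroup)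
  have Vk: "\<kappa> \<otimes> a \<in> V" if "\<kappa> \<in> k" "a \<in> V" for \<kappa> a using V(1) that by (simp add: k_subspace_def)
  have "\<exists>w\<in>V. \<exists>q\<in>p. a = w \<oplus> q" if a: "a \<in> \<A> n" for a
  proof (rule ccontr)
    assume neg: "\<not> ?thesis"
    have ac: "a \<in> carrier A" using a comp_carrier by blast
    define V' where "V' = {w \<oplus> \<kappa> \<otimes> a |w \<kappa>. w \<in> V \<and> \<kappa> \<in> k}"
    have kc: "\<kappa> \<in> carrier A" if "\<kappa> \<in> k" for \<kappa> using that k_props(1) by blast
    have Vc: "w \<in> carrier A" if "w \<in> V" for w using that by simp
    have VV': "V \<subseteq> V'"
    proof
      fix w assume w: "w \<in> V"
      then have "w = w \<oplus> \<zero> \<otimes> a" using ac by simp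
      then show "w \<in> V'" unfolding V'_def using w k_props(2) by blast
    qed
    have aV': "a \<in> V'"
    proof -
      have "a = \<zero> \<oplus> \<one> \<otimes> a" using ac by simp
      then show ?thesis unfolding V'_def using V.zero_closed k_props(3) by blast
    qed
    have sub: "additive_subgroup V' A"
    proof (intro additive_subgroup.intro add.subgroupI)
      show "V' \<subseteq> carrier A" unfolding V'_def using kc ac by auto
      show "V' \<noteq> {}" using aV' by blast
      fix x assume "x \<in> V'"
      then obtain w \<kappa> where x: "x = w \<oplus> \<kappa> \<otimes> a" "w \<in> V" "\<kappa> \<in> k" unfolding V'_def by blast
      have "\<ominus> x = \<ominus> w \<oplus> (\<ominus> \<kappa>) \<otimes> a" unfolding x(1) using Vc[OF x(2)] kc[OF x(3)] ac by algebra
      then show "\<ominus> x \<in> V'" unfolding V'_def using V.a_inv_closed[OF x(2)] k_props(5)[OF x(3)] by blast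
      fix y assume "y \<in> V'"
      then obtain w' \<kappa>' where y: "y = w' \<oplus> \<kappa>' \<otimes> a" "w' \<in> V" "\<kappa>' \<in> k" unfolding V'_def by blast
      have "x \<oplus> y = (w \<oplus> w') \<oplus> (\<kappa> \<oplus> \<kappa>') \<otimes> a"
        unfolding x(1) y(1) using Vc[OF x(2)] kc[OF x(3)] Vc[OF y(2)] kc[OF y(3)] ac by algebra
      then show "x \<oplus> y \<in> V'" unfolding V'_def
        using V.a_closed[OF x(2) y(2)] k_props(7)[OF x(3) y(3)] by blast
    qed
    have "\<kappa>' \<otimes> x \<in> V'" if \<kappa>': "\<kappa>' \<in> k" and "x \<in> V'" for \<kappa>' x
    proof -
      from that obtain w \<kappa> where x: "x = w \<oplus> \<kappa> \<otimes> a" "w \<in> V" "\<kappa> \<in> k" unfolding V'_def by blast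
      have "\<kappa>' \<otimes> x = \<kappa>' \<otimes> w \<oplus> (\<kappa>' \<otimes> \<kappa>) \<otimes> a"
        unfolding x(1) using Vc[OF x(2)] kc[OF x(3)] kc[OF \<kappa>'] ac by algebra
      then show ?thesis unfolding V'_def using Vk[OF \<kappa>' x(2)] k_props(6)[OF \<kappa>' x(3)] by blast
    qed
    then have "k_subspace V'" using sub by (simp add: k_subspace_def)
    moreover have "V' \<subseteq> \<A> n"
    proof -
      have "\<kappa> \<otimes> a \<in> \<A> n" if "\<kappa> \<in> k" for \<kappa> using component_mult[of \<kappa> 0 a n] that component_0 a by simp
      then show ?thesis unfolding V'_def using V(3) An.a_closed by blast
    qed
    moreover have "V' \<inter> p \<subseteq> {\<zero>}"
    proof
      fix x assume "x \<in> V' \<inter> p"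
      then obtain w \<kappa> where x: "x = w \<oplus> \<kappa> \<otimes> a" "w \<in> V" "\<kappa> \<in> k" "x \<in> p" unfolding V'_def by blast
      have \<kappa>0: "\<kappa> = \<zero>"
      proof (rule ccontr)
        assume "\<kappa> \<noteq> \<zero>"
        then have i: "inv \<kappa> \<in> k" "inv \<kappa> \<otimes> \<kappa> = \<one>" using k_unit x(3) by auto
        have "a = (\<ominus> (inv \<kappa> \<otimes> w)) \<oplus> inv \<kappa> \<otimes> x"
        proof -
          have "inv \<kappa> \<otimes> x = inv \<kappa> \<otimes> w \<oplus> (inv \<kappa> \<otimes> \<kappa>) \<otimes> a"
            unfolding x(1) using Vc[OF x(2)] kc[OF x(3)] kc[OF i(1)] ac by (simp add: r_distr m_assoc)
          then show ?thesis using i(2) Vc[OF x(2)] kc[OF i(1)] ac by (simp add: a_assoc[symmetric] l_neg)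
        qed
        moreover have "\<ominus> (inv \<kappa> \<otimes> w) \<in> V" using Vk[OF i(1) x(2)] V.a_inv_closed by blast
        moreover have "inv \<kappa> \<otimes> x \<in> p" using x(4) kc[OF i(1)] p.I_l_closed by blast
        ultimately show False using neg by blast
      qed
      then have "x = w" using x(1) Vc[OF x(2)] ac by simp
      then show "x \<in> {\<zero>}" using x V(4) by blast
    qed
    ultimately have "V' \<in> F" using VV' V(2) unfolding F_def by blast
    then have "a \<in> V" using max VV' aV' by blast
    moreover have "a = a \<oplus> \<zero>" using ac by simp
    ultimately show False using neg p.zero_closed by blast
  qed
  then show ?thesis using V by blast
qed

lemma k_subspace_mult_z:
  assumes V: "k_subspace V"
  shows "k_subspace ((\<otimes>) z ` V)"
proof -
  interpret V: additive_subgroup V A using V by (simp add: k_subspace_def)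
  have Vk: "\<kappa> \<otimes> a \<in> V" if "\<kappa> \<in> k" "a \<in> V" for \<kappa> a using V that by (simp add: k_subspace_def)
  have "additive_subgroup ((\<otimes>) z ` V) A"
  proof (intro additive_subgroup.intro add.subgroupI)
    show "(\<otimes>) z ` V \<subseteq> carrier A" by auto
    show "(\<otimes>) z ` V \<noteq> {}" using V.zero_closed by blast
    fix x assume "x \<in> (\<otimes>) z ` V"
    then obtain v where v: "x = z \<otimes> v" "v \<in> V" by blast
    then have "\<ominus> x = z \<otimes> (\<ominus> v)" by (simp add: r_minus)
    then show "\<ominus> x \<in> (\<otimes>) z ` V" using v(2) by blast
    fix y assume "y \<in> (\<otimes>) z ` V"
    then obtain v' where v': "y = z \<otimes> v'" "v' \<in> V" by blast
    then have "x \<oplus> y = z \<otimes> (v \<oplus> v')" using v by (simp add: r_distr)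
    then show "x \<oplus> y \<in> (\<otimes>) z ` V" using v(2) v'(2) V.a_closed by blast
  qed
  moreover have "\<kappa> \<otimes> x \<in> (\<otimes>) z ` V" if \<kappa>: "\<kappa> \<in> k" and "x \<in> (\<otimes>) z ` V" for \<kappa> x
  proof -
    from that obtain v where v: "x = z \<otimes> v" "v \<in> V" by blast
    then have "\<kappa> \<otimes> x = z \<otimes> (\<kappa> \<otimes> v)" using \<kappa> k_props(1) by (simp add: m_lcomm subset_iff)
    then show ?thesis using Vk[OF \<kappa> v(2)] by blast
  qed
  ultimately show ?thesis by (simp add: k_subspace_def)
qed

text \<open>Degree by degree: as \<open>z\<close> is not in the prime \<open>p\<close>, the multiples by \<open>z\<close> of a complement in
  degree \<open>n\<close> still meet \<open>p\<close> trivially, and extend to a complement in degree \<open>n + 1\<close>.\<close>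
lemma graded_complement_exists:
  "\<exists>W. \<forall>n. additive_subgroup (W n) A \<and> W n \<subseteq> \<A> n \<and> W n \<inter> p \<subseteq> {\<zero>} \<and>
     (\<forall>a\<in>\<A> n. \<exists>w\<in>W n. \<exists>q\<in>p. a = w \<oplus> q) \<and> (\<otimes>) z ` W n \<subseteq> W (Suc n)"
proof -
  let ?P = "\<lambda>n V. k_subspace V \<and> V \<subseteq> \<A> n \<and> V \<inter> p \<subseteq> {\<zero>} \<and> (\<forall>a\<in>\<A> n. \<exists>w\<in>V. \<exists>q\<in>p. a = w \<oplus> q)"
  have "k_subspace {\<zero>}"
    unfolding k_subspace_def using ideal.axioms(1)[OF zeroideal] k_props(1) by auto
  then have "\<exists>V. ?P 0 V" using k_subspace_complement[of "{\<zero>}" 0] by auto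
  moreover have "\<exists>V'. ?P (Suc n) V' \<and> (\<otimes>) z ` V \<subseteq> V'" if V: "?P n V" for V n
  proof -
    have "(\<otimes>) z ` V \<subseteq> \<A> (Suc n)" using V component_mult[OF z_degree, of _ n] by auto
    moreover have "(\<otimes>) z ` V \<inter> p \<subseteq> {\<zero>}"
    proof
      fix x assume "x \<in> (\<otimes>) z ` V \<inter> p"
      then obtain v where v: "x = z \<otimes> v" "v \<in> V" "z \<otimes> v \<in> p" by blast
      then have "v \<in> p" using p.I_prime z(2) V comp_carrier z_carrier by blast
      then have "v = \<zero>" using v(2) V by blast
      then show "x \<in> {\<zero>}" using v(1) by simp
    qed
    moreover have "k_subspace ((\<otimes>) z ` V)" using k_subspace_mult_z V by blast
    ultimately have "\<exists>V'. k_subspace V' \<and> (\<otimes>) z ` V \<subseteq> V' \<and> V' \<subseteq> \<A> (Suc n) \<and> V' \<inter> p \<subseteq> {\<zero>} \<and>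
      (\<forall>a\<in>\<A> (Suc n). \<exists>w\<in>V'. \<exists>q\<in>p. a = w \<oplus> q)"
      by (intro k_subspace_complement)
    then show ?thesis by (elim exE conjE) (intro exI conjI)
  qed
  ultimately have "\<exists>W. \<forall>n. ?P n (W n) \<and> (\<otimes>) z ` W n \<subseteq> W (Suc n)"
    by (rule dependent_nat_choice[of ?P "\<lambda>n V V'. (\<otimes>) z ` V \<subseteq> V'"])
  then obtain W where "\<forall>n. ?P n (W n) \<and> (\<otimes>) z ` W n \<subseteq> W (Suc n)" by (elim exE)
  then have "\<forall>n. additive_subgroup (W n) A \<and> W n \<subseteq> \<A> n \<and> W n \<inter> p \<subseteq> {\<zero>} \<and>
     (\<forall>a\<in>\<A> n. \<exists>w\<in>W n. \<exists>q\<in>p. a = w \<oplus> q) \<and> (\<otimes>) z ` W n \<subseteq> W (Suc n)"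
    unfolding k_subspace_def by blast
  then show ?thesis by (rule exI[where x = W])
qed

end

text \<open>Independence of monomials and a \<open>z\<close>-stable complement of \<open>p\<close> in each degree; together they
  identify the algebra, as a module, with the polynomials in the \<open>g i\<close> with coefficients in \<open>W\<close>.\<close>
locale expansion = maximal_relevant +
  fixes W :: "nat \<Rightarrow> 'a set"
  assumes independence: "\<lbrakk>a \<in> carrier A; a \<notin> p; \<beta> \<in> exps s\<rbrakk> \<Longrightarrow> a \<otimes> gp \<beta> \<notin> higher g s \<beta>"
    and W_subgroup: "additive_subgroup (W n) A"
    and W_degree: "W n \<subseteq> \<A> n"
    and W_Int_p: "W n \<inter> p \<subseteq> {\<zero>}"
    and W_decomposition: "a \<in> \<A> n \<Longrightarrow> \<exists>w\<in>W n. \<exists>q\<in>p. a = w \<oplus> q"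
    and W_z: "(\<otimes>) z ` W n \<subseteq> W (Suc n)"
begin

text \<open>The direct sum of the spaces \<open>W n\<close>.\<close>
definition Wsum :: "'a set" where
  "Wsum = {a \<in> carrier A. \<forall>n. component n a \<in> W n}"

lemma Wsum_carrier: "w \<in> Wsum \<Longrightarrow> w \<in> carrier A"
  by (simp add: Wsum_def)

lemma W_zero [simp]: "\<zero> \<in> W n"
  using W_subgroup additive_subgroup.zero_closed by blast

lemma Wsum_subgroup: "additive_subgroup Wsum A"
proof (intro additive_subgroup.intro add.subgroupI)
  show "Wsum \<subseteq> carrier A" by (auto simp: Wsum_def)
  have "\<zero> \<in> Wsum" by (simp add: Wsum_def)
  then show "Wsum \<noteq> {}" by blast
  show "\<ominus> a \<in> Wsum" if "a \<in> Wsum" for a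
    using that additive_subgroup.a_inv_closed[OF W_subgroup] by (auto simp: Wsum_def component_neg)
  show "a \<oplus> b \<in> Wsum" if "a \<in> Wsum" "b \<in> Wsum" for a b
    using that additive_subgroup.a_closed[OF W_subgroup] by (auto simp: Wsum_def component_add)
qed

lemma W_subset_Wsum: "W n \<subseteq> Wsum"
proof
  fix w assume w: "w \<in> W n"
  then have "w \<in> \<A> n" using W_degree by blast
  then show "w \<in> Wsum" using w comp_carrier by (auto simp: Wsum_def component_homogeneous)
qed

lemma Wsum_Int_p:
  assumes "w \<in> Wsum" "w \<in> p" shows "w = \<zero>"
proof (rule component_eq_zeroD)
  show "w \<in> carrier A" using assms Wsum_carrier by blast
  fix n
  have "component n w \<in> W n \<inter> p"
    using assms homogeneous_idealD[OF relevant_primesD(2)[OF relevant]] by (auto simp: Wsum_def)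
  then show "component n w = \<zero>" using W_Int_p by blast
qed

lemma Wsum_z:
  assumes "w \<in> Wsum" shows "z \<otimes> w \<in> Wsum"
proof -
  have wc: "w \<in> carrier A" using assms Wsum_carrier by blast
  have "component n (z \<otimes> w) \<in> W n" for n
  proof (cases n)
    case 0
    then show ?thesis
      using component_mult_homogeneous[OF wc z_degree, of 0] m_comm[OF z_carrier wc] by simp
  next
    case (Suc m)
    have "component n (z \<otimes> w) = z \<otimes> component m w"
      using component_mult_homogeneous[OF wc z_degree, of n] m_comm[OF z_carrier wc]
        m_comm[OF z_carrier, of "component m w"] wc Suc by simp
    moreover have "component m w \<in> W m" using assms by (simp add: Wsum_def)
    ultimately show ?thesis using W_z[of m] Suc by auto
  qed
  then show ?thesis using wc by (simp add: Wsum_def)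
qed

sublocale Wsum: additive_subgroup Wsum A
  by (rule Wsum_subgroup)

lemma zpow_carrier [simp]: "z [^] (i::nat) \<in> carrier A"
  by simp

lemma Wsum_zpow: "w \<in> Wsum \<Longrightarrow> z [^] (i::nat) \<otimes> w \<in> Wsum"
proof (induction i)
  case (Suc i)
  have "z [^] Suc i \<otimes> w = z \<otimes> (z [^] i \<otimes> w)" using Suc(2) by (simp add: m_ac)
  then show ?case using Wsum_z Suc by simp
qed simp

lemma zpow_notin_p: "z [^] (i::nat) \<notin> p"
proof (induction i)
  case 0
  then show ?case using p.one_imp_carrier p.I_notcarr by auto
next
  case (Suc i)
  then show ?case using p.I_prime[of "z [^] i" z] z(2) by auto
qed

lemma zpow_cancel:
  assumes "w \<in> Wsum" "z [^] (i::nat) \<otimes> w = \<zero>" shows "w = \<zero>"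
proof -
  have "z [^] i \<otimes> w \<in> p" using assms(2) by simp
  then have "w \<in> p" using p.I_prime[of "z [^] i" w] zpow_notin_p assms(1) by auto
  then show ?thesis using Wsum_Int_p assms(1) by blast
qed

text \<open>Split off the component in \<open>W\<close>; the remainder is a combination of the \<open>g i\<close> with coefficients
  of smaller degree, because the \<open>g i\<close> have positive degree.\<close>
lemma homogeneous_expansion:
  "a \<in> \<A> N \<Longrightarrow> a \<in> add_span {w \<otimes> gp \<alpha> |w \<alpha>. w \<in> Wsum \<and> \<alpha> \<in> exps s}"
proof (induction N arbitrary: a rule: less_induct)
  case (less N)
  let ?S = "{w \<otimes> gp \<alpha> |w \<alpha>. w \<in> Wsum \<and> \<alpha> \<in> exps s}"
  have Sc: "?S \<subseteq> carrier A" by auto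
  have shift: "x \<otimes> g i \<in> add_span ?S" if "x \<in> add_span ?S" "i < s" for x i
    using that(1)
  proof (induction rule: add_span.induct)
    case zero
    then show ?case using g_fun by (simp add: add_span.zero Pi_def)
  next
    case (step x r)
    obtain w \<alpha> where x: "x = w \<otimes> gp \<alpha>" "w \<in> Wsum" "\<alpha> \<in> exps s" using step(1) by blast
    have gi: "g i \<in> carrier A" using g_fun by blast
    have "x \<otimes> g i = w \<otimes> gp (add_mset i \<alpha>)" unfolding x(1) gp_simps using x(2) gi by (simp add: m_ac)
    moreover have "add_mset i \<alpha> \<in> exps s" using x(3) that(2) by simp
    ultimately have "x \<otimes> g i \<in> ?S" using x(2) by blast
    moreover have "(x \<oplus> r) \<otimes> g i = x \<otimes> g i \<oplus> r \<otimes> g i"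
      using x(1,2) gi add_span_carrier[OF Sc step(2)] by (simp add: l_distr)
    ultimately show ?case using step(3) by (simp only: add_span.step)
  qed
  obtain w q where w: "w \<in> W N" "q \<in> p" "a = w \<oplus> q" using W_decomposition[OF less(2)] by blast
  have Y: "g ` {..<s} \<subseteq> homogeneous_elements \<A>" using g_degree by (auto simp: homogeneous_elements_def)
  have "component N q \<in> add_span {b \<otimes> y |b y d. y \<in> g ` {..<s} \<inter> \<A> d \<and> d \<le> N \<and> b \<in> \<A> (N - d)}"
    using component_Idl_homogeneous[OF Y] w(2) p_gen by blast
  then have q: "component N q \<in> add_span ?S"
  proof (induction rule: add_span.induct)
    case zero
    then show ?case by (rule add_span.zero)
  next
    case (step x r)
    obtain b i d where x: "x = b \<otimes> g i" "i < s" "g i \<in> \<A> d" "d \<le> N" "b \<in> \<A> (N - d)" using step(1) by blast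
    have "x \<in> add_span ?S"
    proof (cases "g i = \<zero>")
      case True
      then show ?thesis using x(1,5) comp_carrier add_span.zero by simp
    next
      case False
      then have "d = c i"
        using component_homogeneous[OF x(3), of "c i"] component_homogeneous[OF g_degree[of i], of "c i"]
        by (auto split: if_splits)
      then have "N - d < N" using c_pos[of i] x(4) by simp
      then show ?thesis unfolding x(1) using less(1) x(5) shift[OF _ x(2)] by blast
    qed
    then show ?case using step(3) add_span_add[OF Sc] by blast
  qed
  have wN: "w \<in> \<A> N" using w(1) W_degree by blast
  have "a = component N (w \<oplus> q)" using component_homogeneous[OF less(2), of N] w(3) by simp
  also have "\<dots> = w \<oplus> component N q"
    using wN w(2) comp_carrier component_homogeneous[OF wN, of N] by (simp add: component_add)
  finally have aeq: "a = w \<oplus> component N q" .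
  have "w = w \<otimes> gp {#}" using wN comp_carrier gp_simps(1) by simp
  moreover have "w \<in> Wsum" using w(1) W_subset_Wsum by blast
  ultimately have "w \<in> ?S" using exps_empty by blast
  then show ?case unfolding aeq using q by (rule add_span.step)
qed

text \<open>Additive statements need to be checked on the terms \<open>w g\<^sup>\<alpha>\<close> only.\<close>
lemma expansion_induct [consumes 1, case_names zero add]:
  assumes "a \<in> carrier A" "P \<zero>"
    and "\<And>w \<alpha> y. \<lbrakk>w \<in> Wsum; \<alpha> \<in> exps s; y \<in> carrier A; P y\<rbrakk> \<Longrightarrow> P (w \<otimes> gp \<alpha> \<oplus> y)"
  shows "P a"
proof -
  let ?S = "{w \<otimes> gp \<alpha> |w \<alpha>. w \<in> Wsum \<and> \<alpha> \<in> exps s}"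
  have Sc: "?S \<subseteq> carrier A" by auto
  have "a \<in> add_span ?S" using assms(1)
  proof (induction rule: graded_induct)
    case zero
    then show ?case by (rule add_span.zero)
  next
    case (add n x y)
    then show ?case using add_span_add[OF Sc homogeneous_expansion] by blast
  qed
  then show ?thesis
  proof (induction rule: add_span.induct)
    case zero
    then show ?case by (rule assms(2))
  next
    case (step x y)
    obtain w \<alpha> where "x = w \<otimes> gp \<alpha>" "w \<in> Wsum" "\<alpha> \<in> exps s" using step(1) by blast
    then show ?case using assms(3) step(3) add_span_carrier[OF Sc step(2)] by blast
  qed
qed

text \<open>The possible families of coefficients of an expansion.\<close>
definition families :: "(nat multiset \<Rightarrow> 'a) set" where
  "families = {x. finite {\<alpha>. x \<alpha> \<noteq> \<zero>} \<and> {\<alpha>. x \<alpha> \<noteq> \<zero>} \<subseteq> exps s \<and> (\<forall>\<alpha>. x \<alpha> \<in> Wsum)}"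

definition eval_family :: "(nat multiset \<Rightarrow> 'a) \<Rightarrow> 'a" where
  "eval_family x = (\<Oplus>\<alpha>\<in>{\<alpha>. x \<alpha> \<noteq> \<zero>}. x \<alpha> \<otimes> gp \<alpha>)"

lemma eval_family_superset:
  assumes "x \<in> families" "finite F" "{\<alpha>. x \<alpha> \<noteq> \<zero>} \<subseteq> F"
  shows "eval_family x = (\<Oplus>\<alpha>\<in>F. x \<alpha> \<otimes> gp \<alpha>)"
  unfolding eval_family_def
  by (rule add.finprod_mono_neutral_cong_left) (use assms in \<open>auto simp: families_def\<close>)

lemma families_add:
  assumes "x \<in> families" "y \<in> families"
  shows "(\<lambda>\<alpha>. x \<alpha> \<oplus> y \<alpha>) \<in> families" "eval_family (\<lambda>\<alpha>. x \<alpha> \<oplus> y \<alpha>) = eval_family x \<oplus> eval_family y"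
proof -
  let ?F = "{\<alpha>. x \<alpha> \<noteq> \<zero>} \<union> {\<alpha>. y \<alpha> \<noteq> \<zero>}"
  have F: "finite ?F" using assms by (simp add: families_def)
  have sub: "{\<alpha>. x \<alpha> \<oplus> y \<alpha> \<noteq> \<zero>} \<subseteq> ?F" by auto
  have c: "x \<alpha> \<in> carrier A" "y \<alpha> \<in> carrier A" for \<alpha> using assms by (auto simp: families_def)
  show mem: "(\<lambda>\<alpha>. x \<alpha> \<oplus> y \<alpha>) \<in> families"
    using finite_subset[OF sub F] sub assms by (auto simp: families_def)
  have "eval_family (\<lambda>\<alpha>. x \<alpha> \<oplus> y \<alpha>) = (\<Oplus>\<alpha>\<in>?F. (x \<alpha> \<oplus> y \<alpha>) \<otimes> gp \<alpha>)" by (rule eval_family_superset[OF mem F sub])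
  also have "\<dots> = (\<Oplus>\<alpha>\<in>?F. x \<alpha> \<otimes> gp \<alpha> \<oplus> y \<alpha> \<otimes> gp \<alpha>)"
    using c by (intro finsum_cong') (auto simp: l_distr)
  also have "\<dots> = (\<Oplus>\<alpha>\<in>?F. x \<alpha> \<otimes> gp \<alpha>) \<oplus> (\<Oplus>\<alpha>\<in>?F. y \<alpha> \<otimes> gp \<alpha>)"
    using c by (intro finsum_addf) auto
  also have "\<dots> = eval_family x \<oplus> eval_family y" using eval_family_superset[OF assms(1) F] eval_family_superset[OF assms(2) F] by simp
  finally show "eval_family (\<lambda>\<alpha>. x \<alpha> \<oplus> y \<alpha>) = eval_family x \<oplus> eval_family y" .
qed

lemma families_neg:
  assumes "x \<in> families"
  shows "(\<lambda>\<alpha>. \<ominus> x \<alpha>) \<in> families"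
proof -
  have c: "x \<alpha> \<in> carrier A" for \<alpha> using assms by (auto simp: families_def)
  then have "{\<alpha>. \<ominus> x \<alpha> \<noteq> \<zero>} = {\<alpha>. x \<alpha> \<noteq> \<zero>}" by auto
  then show ?thesis using assms by (auto simp: families_def)
qed

lemma families_single:
  assumes "w \<in> Wsum" "\<alpha> \<in> exps s"
  shows "(\<lambda>\<beta>. if \<beta> = \<alpha> then w else \<zero>) \<in> families" "eval_family (\<lambda>\<beta>. if \<beta> = \<alpha> then w else \<zero>) = w \<otimes> gp \<alpha>"
proof -
  let ?x = "\<lambda>\<beta>. if \<beta> = \<alpha> then w else \<zero>"
  have sub: "{\<beta>. ?x \<beta> \<noteq> \<zero>} \<subseteq> {\<alpha>}" by auto
  show mem: "?x \<in> families" using assms finite_subset[OF sub] by (auto simp: families_def)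
  show "eval_family ?x = w \<otimes> gp \<alpha>" using eval_family_superset[OF mem _ sub] assms by (simp add: finsum_insert)
qed

text \<open>In a nontrivial relation the smallest exponent \<open>\<beta>\<close> would have a coefficient in \<open>W\<close>, hence
  outside \<open>p\<close>, and its term would be a combination of later monomials.\<close>
lemma eval_family_eq_zero:
  assumes x: "x \<in> families" "eval_family x = \<zero>"
  shows "x \<alpha> = \<zero>"
proof (rule ccontr)
  assume "x \<alpha> \<noteq> \<zero>"
  let ?F = "{\<alpha>. x \<alpha> \<noteq> \<zero>}"
  have F: "finite ?F" "?F \<subseteq> exps s" "?F \<noteq> {}" using x(1) \<open>x \<alpha> \<noteq> \<zero>\<close> by (auto simp: families_def)
  define \<beta> where "\<beta> = Min ?F"
  have \<beta>: "\<beta> \<in> ?F" unfolding \<beta>_def using F by (intro Min_in)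
  have c: "x \<alpha> \<in> carrier A" for \<alpha> using x(1) by (auto simp: families_def)
  interpret J: ideal "higher g s \<beta>" A using higher_ideal[OF g_fun] .
  have rest: "(\<Oplus>\<gamma>\<in>?F - {\<beta>}. x \<gamma> \<otimes> gp \<gamma>) \<in> higher g s \<beta>"
  proof (rule finsum_additive_subgroup[OF J.additive_subgroup_axioms])
    fix \<gamma> assume \<gamma>: "\<gamma> \<in> ?F - {\<beta>}"
    then have "\<beta> \<le> \<gamma>" unfolding \<beta>_def using F(1) by (intro Min_le) auto
    then have "\<beta> < \<gamma>" using \<gamma> by auto
    then show "x \<gamma> \<otimes> gp \<gamma> \<in> higher g s \<beta>"
      using powprod_in_higher[OF g_fun] \<gamma> F(2) c J.I_l_closed by blast
  qed
  have "eval_family x = x \<beta> \<otimes> gp \<beta> \<oplus> (\<Oplus>\<gamma>\<in>?F - {\<beta>}. x \<gamma> \<otimes> gp \<gamma>)"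
  proof -
    have ins: "?F = insert \<beta> (?F - {\<beta>})" using \<beta> by blast
    show ?thesis unfolding eval_family_def by (subst ins, rule finsum_insert) (use F(1) c in auto)
  qed
  then have sum0: "x \<beta> \<otimes> gp \<beta> \<oplus> (\<Oplus>\<gamma>\<in>?F - {\<beta>}. x \<gamma> \<otimes> gp \<gamma>) = \<zero>" using x(2) by simp
  have "x \<beta> \<otimes> gp \<beta> = \<ominus> (\<Oplus>\<gamma>\<in>?F - {\<beta>}. x \<gamma> \<otimes> gp \<gamma>)"
    using minus_equality[OF sum0] J.Icarr[OF rest] c by auto
  then have "x \<beta> \<otimes> gp \<beta> \<in> higher g s \<beta>" using rest J.a_inv_closed by simp
  then have "x \<beta> \<in> p" using independence c \<beta> F(2) by blast
  then have "x \<beta> = \<zero>" using Wsum_Int_p x(1) by (auto simp: families_def)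
  then show False using \<beta> by blast
qed

lemma expansion_exists: "a \<in> carrier A \<Longrightarrow> \<exists>x\<in>families. eval_family x = a"
proof (induction rule: expansion_induct)
  case zero
  have "eval_family (\<lambda>\<beta>. if \<beta> = {#} then \<zero> else \<zero>) = \<zero> \<otimes> gp {#}" by (rule families_single(2)) auto
  then show ?case using families_single(1)[of \<zero> "{#}"] by force
next
  case (add w \<alpha> y)
  obtain x where x: "x \<in> families" "eval_family x = y" using add(4) by blast
  note f = families_single[OF add(1,2)]
  show ?case using families_add[OF f(1) x(1)] f(2) x(2) by metis
qed

lemma expansion_unique:
  assumes "x \<in> families" "y \<in> families" "eval_family x = eval_family y" shows "x = y"
proof
  fix \<alpha>
  note n = families_neg[OF assms(2)]
  have c: "x \<alpha> \<in> carrier A" "y \<alpha> \<in> carrier A" for \<alpha> using assms by (auto simp: families_def)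
  have z1: "(\<lambda>\<alpha>. y \<alpha> \<oplus> \<ominus> y \<alpha>) = (\<lambda>\<alpha>. \<zero>)" using c by (simp add: r_neg)
  have "eval_family y \<oplus> eval_family (\<lambda>\<alpha>. \<ominus> y \<alpha>) = eval_family (\<lambda>\<alpha>. \<zero>)"
    using families_add(2)[OF assms(2) n] unfolding z1 by simp
  also have "\<dots> = \<zero>" by (simp add: eval_family_def)
  finally have "eval_family (\<lambda>\<alpha>. x \<alpha> \<oplus> \<ominus> y \<alpha>) = \<zero>" using families_add(2)[OF assms(1) n] assms(3) by simp
  then have "x \<alpha> \<oplus> \<ominus> y \<alpha> = \<zero>" using eval_family_eq_zero[OF families_add(1)[OF assms(1) n]] by simp
  then show "x \<alpha> = y \<alpha>" using c[of \<alpha>] by (simp add: minus_eq[symmetric] r_right_minus_eq)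
qed

definition coeff :: "nat multiset \<Rightarrow> 'a \<Rightarrow> 'a" where
  "coeff \<alpha> a = (THE x. x \<in> families \<and> eval_family x = a) \<alpha>"

lemma coeff_eval_family:
  assumes "x \<in> families" shows "coeff \<alpha> (eval_family x) = x \<alpha>"
proof -
  have "(THE y. y \<in> families \<and> eval_family y = eval_family x) = x"
    by (rule the_equality) (use assms expansion_unique in auto)
  then show ?thesis by (simp add: coeff_def)
qed

lemma coeff_Wsum [simp]:
  assumes "a \<in> carrier A" shows "coeff \<alpha> a \<in> Wsum"
proof -
  obtain x where "x \<in> families" "eval_family x = a" using expansion_exists[OF assms] by blast
  then show ?thesis using coeff_eval_family by (auto simp: families_def)
qed

lemma coeff_carrier [simp]: "a \<in> carrier A \<Longrightarrow> coeff \<alpha> a \<in> carrier A"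
  by (rule Wsum_carrier[OF coeff_Wsum])

lemma coeff_add:
  assumes "a \<in> carrier A" "b \<in> carrier A" shows "coeff \<alpha> (a \<oplus> b) = coeff \<alpha> a \<oplus> coeff \<alpha> b"
proof -
  obtain x y where x: "x \<in> families" "eval_family x = a" and y: "y \<in> families" "eval_family y = b"
    using expansion_exists assms by blast
  have "coeff \<alpha> (eval_family (\<lambda>\<alpha>. x \<alpha> \<oplus> y \<alpha>)) = x \<alpha> \<oplus> y \<alpha>" by (rule coeff_eval_family[OF families_add(1)[OF x(1) y(1)]])
  then show ?thesis using families_add(2)[OF x(1) y(1)] coeff_eval_family[OF x(1)] coeff_eval_family[OF y(1)] x(2) y(2) by simp
qed

lemma coeff_single:
  assumes "w \<in> Wsum" "\<alpha> \<in> exps s"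
  shows "coeff \<beta> (w \<otimes> gp \<alpha>) = (if \<beta> = \<alpha> then w else \<zero>)"
  using coeff_eval_family[OF families_single(1)[OF assms], of \<beta>] families_single(2)[OF assms] by simp

lemma coeff_zero [simp]: "coeff \<alpha> \<zero> = \<zero>"
  using coeff_single[of \<zero> "{#}" \<alpha>] by (auto split: if_splits)

lemma coeff_neg: "a \<in> carrier A \<Longrightarrow> coeff \<alpha> (\<ominus> a) = \<ominus> coeff \<alpha> a"
  using coeff_add[of "\<ominus> a" a \<alpha>] by (simp add: l_neg minus_equality)

lemma coeff_finsum:
  assumes "f \<in> F \<rightarrow> carrier A" shows "coeff \<alpha> (\<Oplus>i\<in>F. f i) = (\<Oplus>i\<in>F. coeff \<alpha> (f i))"
  using assms
proof (induction F rule: infinite_finite_induct)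
  case (insert i F)
  then have "f \<in> F \<rightarrow> carrier A" "f i \<in> carrier A" by auto
  moreover have "(\<lambda>i. coeff \<alpha> (f i)) \<in> F \<rightarrow> carrier A"
    using \<open>f \<in> F \<rightarrow> carrier A\<close> coeff_carrier by blast
  ultimately show ?case using insert by (simp add: coeff_add)
qed auto

lemma coeff_shift:
  assumes "a \<in> carrier A" "\<gamma> \<in> exps s"
  shows "coeff \<beta> (z [^] (i::nat) \<otimes> gp \<gamma> \<otimes> a) = (if \<gamma> \<subseteq># \<beta> then z [^] i \<otimes> coeff (\<beta> - \<gamma>) a else \<zero>)"
  using assms(1)
proof (induction rule: expansion_induct)
  case zero
  then show ?case by simp
next
  case (add w \<alpha> y)
  have "z [^] i \<otimes> gp \<gamma> \<otimes> (w \<otimes> gp \<alpha>) = (z [^] i \<otimes> w) \<otimes> gp (\<gamma> + \<alpha>)"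
    unfolding gp_simps using add(1) by (simp add: m_ac)
  then have "coeff \<beta> (z [^] i \<otimes> gp \<gamma> \<otimes> (w \<otimes> gp \<alpha>)) = (if \<beta> = \<gamma> + \<alpha> then z [^] i \<otimes> w else \<zero>)"
    using coeff_single[OF Wsum_zpow[OF add(1)], of "\<gamma> + \<alpha>" \<beta> i] add(2) assms(2) by simp
  also have "\<dots> = (if \<gamma> \<subseteq># \<beta> then z [^] i \<otimes> coeff (\<beta> - \<gamma>) (w \<otimes> gp \<alpha>) else \<zero>)"
    using coeff_single[OF add(1,2), of "\<beta> - \<gamma>"] by auto
  finally show ?case using add by (simp add: r_distr coeff_add)
qed

text \<open>The constant coefficient is the residue modulo \<open>p\<close>, since all other terms contain some \<open>g i\<close>.\<close>
lemma coeff_empty_mod_p: "a \<in> carrier A \<Longrightarrow> coeff {#} a \<ominus> a \<in> p"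
proof (induction rule: expansion_induct)
  case zero
  then show ?case by simp
next
  case (add w \<alpha> y)
  define u v where "u = coeff {#} (w \<otimes> gp \<alpha>)" and "v = w \<otimes> gp \<alpha>"
  have uv: "u \<in> carrier A" "v \<in> carrier A" using add(1) by (auto simp: u_def v_def)
  have "u \<ominus> v \<in> p"
  proof (cases "\<alpha> = {#}")
    case True
    then show ?thesis unfolding u_def v_def using coeff_single[OF add(1,2)] add(1) gp_simps(1) by simp
  next
    case False
    then obtain i \<beta> where \<alpha>: "\<alpha> = add_mset i \<beta>" by (meson multiset_cases)
    have "g i \<in> p" unfolding p_gen using \<alpha> add(2) genideal_self[of "g ` {..<s}"] g_fun by auto
    then have "gp \<alpha> \<in> p" unfolding \<alpha> gp_simps by (rule p.I_r_closed) simp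
    then have "v \<in> p" unfolding v_def using add(1) p.I_l_closed by simp
    then show ?thesis unfolding u_def using coeff_single[OF add(1,2), of "{#}"] False p.a_inv_closed
      by (simp add: minus_eq)
  qed
  moreover have "coeff {#} (v \<oplus> y) \<ominus> (v \<oplus> y) = (u \<ominus> v) \<oplus> (coeff {#} y \<ominus> y)"
  proof -
    define t where "t = coeff {#} y"
    have "t \<in> carrier A" using add(3) by (simp add: t_def)
    moreover have "coeff {#} (v \<oplus> y) = u \<oplus> t" using uv add(3) by (simp add: coeff_add u_def v_def t_def)
    ultimately show ?thesis unfolding t_def[symmetric] using uv add(3) by (simp, algebra)
  qed
  ultimately show ?case using add(4) p.a_closed unfolding v_def by simp
qed

lemma coeff_empty_in_p: "a \<in> carrier A \<Longrightarrow> coeff {#} a = \<zero> \<Longrightarrow> a \<in> p"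
proof -
  assume a: "a \<in> carrier A" "coeff {#} a = \<zero>"
  then have "\<ominus> a \<in> p" using coeff_empty_mod_p[OF a(1)] by (simp add: minus_eq)
  then show "a \<in> p" using p.a_inv_closed[of "\<ominus> a"] a(1) by simp
qed

end

section \<open>A homogenised monomial curve\<close>

text \<open>Three generators are available to carry the curve.\<close>
locale monomial_curve = expansion +
  assumes three_le: "3 \<le> s"
begin

text \<open>The index \<open>i\<close> has weight \<open>i + 3\<close>; so the first three generators get the weights 3, 4 and 5 of
  the curve \<open>(\<lambda>\<^sup>3, \<lambda>\<^sup>4, \<lambda>\<^sup>5)\<close>.\<close>
definition weight :: "nat multiset \<Rightarrow> nat" where
  "weight \<alpha> = sum_mset (image_mset (\<lambda>i. i + 3) \<alpha>)"

lemma weight_simps [simp]: "weight {#} = 0" "weight (add_mset i \<alpha>) = i + 3 + weight \<alpha>" "weight (\<alpha> + \<beta>) = weight \<alpha> + weight \<beta>"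
  by (auto simp: weight_def)

definition exps_of_weight :: "nat \<Rightarrow> nat multiset set" where
  "exps_of_weight n = {\<alpha> \<in> exps 3. weight \<alpha> = n}"

lemma count_le_weight: "count \<alpha> i \<le> weight \<alpha>"
  by (induction \<alpha>) auto

lemma finite_exps_of_weight: "finite (exps_of_weight n)"
proof (rule finite_subset[OF _ finite_box])
  show "exps_of_weight n \<subseteq> box 3 n" using count_le_weight by (auto simp: exps_of_weight_def box_def)
qed

lemma exps_3: "\<alpha> \<in> exps 3 \<Longrightarrow> \<alpha> \<in> exps s"
  using three_le by (auto simp: exps_def)

text \<open>The coefficient of \<open>\<lambda>\<^sup>n\<close> after substituting \<open>g i = z\<^bsup>c i\<^esup>\<lambda>\<^bsup>i + 3\<^esup>\<close> for \<open>i < 3\<close> and \<open>g i = 0\<close> for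
  the other indices into the expansion. The powers of \<open>z\<close> make the substitution respect degrees.\<close>
definition Phi :: "nat \<Rightarrow> 'a \<Rightarrow> 'a" where
  "Phi n a = (\<Oplus>\<alpha>\<in>exps_of_weight n. z [^] deg \<alpha> \<otimes> coeff \<alpha> a)"

lemma Phi_Wsum: "a \<in> carrier A \<Longrightarrow> Phi n a \<in> Wsum"
  unfolding Phi_def by (intro finsum_additive_subgroup[OF Wsum_subgroup] Wsum_zpow coeff_Wsum)

lemma Phi_carrier [simp]: "a \<in> carrier A \<Longrightarrow> Phi n a \<in> carrier A"
  by (rule Wsum_carrier[OF Phi_Wsum])

lemma Phi_zero [simp]: "Phi n \<zero> = \<zero>"
  unfolding Phi_def by (intro add.finprod_one_eqI) simp

lemma Phi_add:
  assumes "a \<in> carrier A" "b \<in> carrier A" shows "Phi n (a \<oplus> b) = Phi n a \<oplus> Phi n b"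
proof -
  have "Phi n (a \<oplus> b) = (\<Oplus>\<alpha>\<in>exps_of_weight n. z [^] deg \<alpha> \<otimes> coeff \<alpha> a \<oplus> z [^] deg \<alpha> \<otimes> coeff \<alpha> b)"
    unfolding Phi_def using assms by (intro finsum_cong') (auto simp: coeff_add r_distr)
  also have "\<dots> = Phi n a \<oplus> Phi n b" unfolding Phi_def using assms by (intro finsum_addf) auto
  finally show ?thesis .
qed

lemma Phi_neg: "a \<in> carrier A \<Longrightarrow> Phi n (\<ominus> a) = \<ominus> Phi n a"
  using Phi_add[of "\<ominus> a" a n] by (simp add: l_neg minus_equality)

lemma Phi_single:
  assumes "w \<in> Wsum" "\<alpha> \<in> exps s"
  shows "Phi n (w \<otimes> gp \<alpha>) = (if \<alpha> \<in> exps_of_weight n then z [^] deg \<alpha> \<otimes> w else \<zero>)"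
proof -
  have *: "Phi n (w \<otimes> gp \<alpha>) = (\<Oplus>\<beta>\<in>exps_of_weight n. if \<alpha> = \<beta> then z [^] deg \<beta> \<otimes> w else \<zero>)"
    unfolding Phi_def using assms coeff_single[OF assms] by (intro finsum_cong') auto
  show ?thesis
  proof (cases "\<alpha> \<in> exps_of_weight n")
    case True
    then show ?thesis unfolding * using finite_exps_of_weight assms(1) by (subst add.finprod_singleton) auto
  next
    case False
    then show ?thesis unfolding * by (subst add.finprod_one_eqI) auto
  qed
qed

text \<open>The substitution is linear over the polynomials in \<open>z\<close> and the \<open>g i\<close>.\<close>
lemma Phi_shift:
  assumes "a \<in> carrier A" "\<gamma> \<in> exps s"
  shows "Phi n (z [^] (i::nat) \<otimes> gp \<gamma> \<otimes> a) =
    (if \<gamma> \<in> exps 3 \<and> weight \<gamma> \<le> n then z [^] (deg \<gamma> + i) \<otimes> Phi (n - weight \<gamma>) a else \<zero>)"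
  using assms(1)
proof (induction rule: expansion_induct)
  case zero
  then show ?case by simp
next
  case (add w \<alpha> y)
  have "z [^] i \<otimes> gp \<gamma> \<otimes> (w \<otimes> gp \<alpha>) = (z [^] i \<otimes> w) \<otimes> gp (\<gamma> + \<alpha>)"
    unfolding gp_simps using add(1) by (simp add: m_ac)
  then have "Phi n (z [^] i \<otimes> gp \<gamma> \<otimes> (w \<otimes> gp \<alpha>)) =
      (if \<gamma> + \<alpha> \<in> exps_of_weight n then z [^] deg (\<gamma> + \<alpha>) \<otimes> (z [^] i \<otimes> w) else \<zero>)"
    using Phi_single[OF Wsum_zpow[OF add(1)], of "\<gamma> + \<alpha>" n i] add(2) assms(2) by simp
  moreover have "\<gamma> + \<alpha> \<in> exps_of_weight n \<longleftrightarrow> (\<gamma> \<in> exps 3 \<and> weight \<gamma> \<le> n) \<and> \<alpha> \<in> exps_of_weight (n - weight \<gamma>)" by (auto simp: exps_of_weight_def)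
  moreover have "z [^] deg (\<gamma> + \<alpha>) \<otimes> (z [^] i \<otimes> w) = z [^] (deg \<gamma> + i) \<otimes> (z [^] deg \<alpha> \<otimes> w)"
    using add(1) by (simp add: nat_pow_mult[symmetric] m_ac)
  ultimately have "Phi n (z [^] i \<otimes> gp \<gamma> \<otimes> (w \<otimes> gp \<alpha>)) =
     (if \<gamma> \<in> exps 3 \<and> weight \<gamma> \<le> n then z [^] (deg \<gamma> + i) \<otimes> Phi (n - weight \<gamma>) (w \<otimes> gp \<alpha>) else \<zero>)"
    using Phi_single[OF add(1,2), of "n - weight \<gamma>"] by simp
  then show ?case using add by (simp add: r_distr Phi_add)
qed

lemma Phi_mult_z:
  assumes "a \<in> carrier A"
  shows "Phi n (z [^] (i::nat) \<otimes> a) = z [^] i \<otimes> Phi n a"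
  using Phi_shift[OF assms, of "{#}" n i] assms gp_simps(1) by simp

text \<open>The substitution is not multiplicative, since a product of two elements of \<open>W\<close> need not lie in
  \<open>W\<close>. But by linearity over the polynomials in \<open>z\<close> and the \<open>g i\<close>, one factor may be replaced by its
  image, which is what the right hand side says.\<close>
lemma Phi_mult:
  assumes "a \<in> carrier A" "b \<in> carrier A"
  shows "Phi n (a \<otimes> b) = (\<Oplus>u\<in>{..n}. Phi (n - u) (Phi u a \<otimes> b))"
  using assms(1)
proof (induction rule: expansion_induct)
  case zero
  then show ?case using assms(2) by (simp add: add.finprod_one_eqI)
next
  case (add w \<alpha> y)
  have wc: "w \<in> carrier A" using add(1) by simp
  have "Phi n (w \<otimes> gp \<alpha> \<otimes> b) = Phi n (z [^] (0::nat) \<otimes> gp \<alpha> \<otimes> (w \<otimes> b))"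
    using wc assms(2) by (simp add: m_ac)
  also have "\<dots> = (if \<alpha> \<in> exps 3 \<and> weight \<alpha> \<le> n then z [^] deg \<alpha> \<otimes> Phi (n - weight \<alpha>) (w \<otimes> b) else \<zero>)"
    using Phi_shift[of "w \<otimes> b" \<alpha> n 0] wc assms(2) add(2) by simp
  also have "\<dots> = (\<Oplus>u\<in>{..n}. Phi (n - u) (Phi u (w \<otimes> gp \<alpha>) \<otimes> b))"
  proof (cases "\<alpha> \<in> exps 3 \<and> weight \<alpha> \<le> n")
    case True
    have "(\<Oplus>u\<in>{..n}. Phi (n - u) (Phi u (w \<otimes> gp \<alpha>) \<otimes> b)) =
        (\<Oplus>u\<in>{..n}. if weight \<alpha> = u then Phi (n - u) (z [^] deg \<alpha> \<otimes> w \<otimes> b) else \<zero>)"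
      using Phi_single[OF add(1,2)] True wc assms(2) by (intro finsum_cong') (auto simp: exps_of_weight_def)
    also have "\<dots> = Phi (n - weight \<alpha>) (z [^] deg \<alpha> \<otimes> w \<otimes> b)"
      using True wc assms(2) by (subst add.finprod_singleton) auto
    also have "\<dots> = z [^] deg \<alpha> \<otimes> Phi (n - weight \<alpha>) (w \<otimes> b)"
      using Phi_mult_z[of "w \<otimes> b"] wc assms(2) by (simp add: m_assoc)
    finally show ?thesis using True by simp
  next
    case False
    then have "(\<Oplus>u\<in>{..n}. Phi (n - u) (Phi u (w \<otimes> gp \<alpha>) \<otimes> b)) = \<zero>"
      using Phi_single[OF add(1,2)] assms(2) by (intro add.finprod_one_eqI) (auto simp: exps_of_weight_def)
    then show ?thesis unfolding if_not_P[OF False] by simp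
  qed
  finally have 1: "Phi n (w \<otimes> gp \<alpha> \<otimes> b) = (\<Oplus>u\<in>{..n}. Phi (n - u) (Phi u (w \<otimes> gp \<alpha>) \<otimes> b))" .
  have "(\<Oplus>u\<in>{..n}. Phi (n - u) (Phi u (w \<otimes> gp \<alpha> \<oplus> y) \<otimes> b)) =
     (\<Oplus>u\<in>{..n}. Phi (n - u) (Phi u (w \<otimes> gp \<alpha>) \<otimes> b) \<oplus> Phi (n - u) (Phi u y \<otimes> b))"
    using wc add(3) assms(2) by (intro finsum_cong') (auto simp: Phi_add l_distr)
  also have "\<dots> = Phi n (w \<otimes> gp \<alpha> \<otimes> b) \<oplus> Phi n (y \<otimes> b)"
    unfolding 1 add(4) using wc add(3) assms(2) by (intro finsum_addf) auto
  also have "\<dots> = Phi n ((w \<otimes> gp \<alpha> \<oplus> y) \<otimes> b)"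
    using wc add(3) assms(2) by (simp add: Phi_add l_distr)
  finally show ?case by simp
qed

text \<open>Degrees are respected, so the ideal of the curve is homogeneous.\<close>
lemma Phi_component:
  assumes "a \<in> carrier A"
  shows "Phi n (component N a) = component N (Phi n a)"
  using assms
proof (induction rule: expansion_induct)
  case zero
  then show ?case by simp
next
  case (add w \<alpha> y)
  have wc: "w \<in> carrier A" using add(1) by simp
  have "Phi n (component N (w \<otimes> gp \<alpha>)) = component N (Phi n (w \<otimes> gp \<alpha>))"
  proof (cases "deg \<alpha> \<le> N")
    case True
    have cW: "component (N - deg \<alpha>) w \<in> Wsum" using add(1) W_subset_Wsum unfolding Wsum_def by blast
    have "component N (z [^] deg \<alpha> \<otimes> w) = z [^] deg \<alpha> \<otimes> component (N - deg \<alpha>) w"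
      using component_mult_homogeneous[OF wc zpow_degree[of "deg \<alpha>"], of N] True wc by (simp add: m_comm)
    then show ?thesis
      using component_mult_homogeneous[OF wc gp_degree[of \<alpha>], of N] True
        Phi_single[OF add(1,2)] Phi_single[OF cW add(2)] by simp
  next
    case False
    have "component N (z [^] deg \<alpha> \<otimes> w) = \<zero>"
      using component_mult_homogeneous[OF wc zpow_degree[of "deg \<alpha>"], of N] False wc by (simp add: m_comm)
    then show ?thesis
      using component_mult_homogeneous[OF wc gp_degree[of \<alpha>], of N] False Phi_single[OF add(1,2)] by simp
  qed
  then show ?case using add wc by (simp add: component_add Phi_add)
qed

text \<open>The ideal of the curve: the elements that vanish under the substitution.\<close>
definition curve :: "'a set" where
  "curve = {a \<in> carrier A. \<forall>n. Phi n a = \<zero>}"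

lemma curve_ideal: "ideal curve A"
proof (rule idealI[OF ring_axioms])
  show "subgroup curve (add_monoid A)"
  proof (rule add.subgroupI)
    show "curve \<subseteq> carrier A" by (auto simp: curve_def)
    have "\<zero> \<in> curve" by (simp add: curve_def)
    then show "curve \<noteq> {}" by blast
    show "\<ominus> a \<in> curve" if "a \<in> curve" for a using that by (auto simp: curve_def Phi_neg)
    show "a \<oplus> b \<in> curve" if "a \<in> curve" "b \<in> curve" for a b using that by (auto simp: curve_def Phi_add)
  qed
  fix a x assume a: "a \<in> curve" and x: "x \<in> carrier A"
  then have ac: "a \<in> carrier A" "\<And>n. Phi n a = \<zero>" by (auto simp: curve_def)
  have "Phi n (a \<otimes> x) = \<zero>" for n
    unfolding Phi_mult[OF ac(1) x] using ac x by (intro add.finprod_one_eqI) simp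
  then show "a \<otimes> x \<in> curve" using ac x by (simp add: curve_def)
  then show "x \<otimes> a \<in> curve" using m_comm[OF ac(1) x] by simp
qed

lemma exps_of_weight_0: "exps_of_weight 0 = {{#}}"
proof -
  have "\<alpha> = {#}" if "weight \<alpha> = 0" for \<alpha> using that by (cases \<alpha>) auto
  then show ?thesis by (auto simp: exps_of_weight_def)
qed

lemma Phi_0: "a \<in> carrier A \<Longrightarrow> Phi 0 a = coeff {#} a"
  unfolding Phi_def exps_of_weight_0 by simp

lemma Phi_0_eq_zeroD: "a \<in> carrier A \<Longrightarrow> Phi 0 a = \<zero> \<Longrightarrow> a \<in> p"
  using Phi_0 coeff_empty_in_p by simp

lemma curve_subset_p: "curve \<subseteq> p"
  using Phi_0_eq_zeroD by (auto simp: curve_def)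

lemma first_weight:
  assumes "a \<in> carrier A" "a \<notin> curve"
  obtains n where "Phi n a \<noteq> \<zero>" "\<And>u. u < n \<Longrightarrow> Phi u a = \<zero>"
proof -
  have "\<exists>n. Phi n a \<noteq> \<zero>" using assms by (auto simp: curve_def)
  then show ?thesis using that[of "LEAST n. Phi n a \<noteq> \<zero>"] not_less_Least LeastI_ex[of "\<lambda>n. Phi n a \<noteq> \<zero>"] by blast
qed

text \<open>If nothing of weight below \<open>n\<close> and \<open>m\<close> is present, only the product of the lowest
  parts contributes to weight \<open>n + m\<close>. It is taken modulo \<open>p\<close>, as \<open>Phi 0\<close> is the projection to \<open>W\<close>.\<close>
lemma Phi_mult_lowest:
  assumes a: "a \<in> carrier A" "\<And>u. u < n \<Longrightarrow> Phi u a = \<zero>"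
    and b: "b \<in> carrier A" "\<And>u. u < m \<Longrightarrow> Phi u b = \<zero>"
  shows "Phi (n + m) (a \<otimes> b) = Phi 0 (Phi n a \<otimes> Phi m b)"
proof -
  have inner: "Phi (n + m - u) (Phi u a \<otimes> b) = (if n = u then Phi 0 (Phi n a \<otimes> Phi m b) else \<zero>)"
    if u: "u \<le> n + m" for u
  proof (cases "u < n")
    case True
    then show ?thesis using a b by simp
  next
    case False
    define l where "l = n + m - u"
    have l: "l \<le> m" using False by (simp add: l_def)
    have "Phi l (Phi u a \<otimes> b) = Phi l (b \<otimes> Phi u a)" using a b by (simp add: m_comm)
    also have "\<dots> = (\<Oplus>v\<in>{..l}. Phi (l - v) (Phi v b \<otimes> Phi u a))" using a b by (intro Phi_mult) auto
    also have "\<dots> = (\<Oplus>v\<in>{..l}. if m = v then Phi 0 (Phi m b \<otimes> Phi u a) else \<zero>)"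
      using a b l by (intro finsum_cong') (auto simp: le_less)
    also have "\<dots> = (if l = m then Phi 0 (Phi m b \<otimes> Phi u a) else \<zero>)"
    proof (cases "l = m")
      case True
      then show ?thesis using a b by (subst add.finprod_singleton) auto
    next
      case False
      then show ?thesis using l by (subst add.finprod_one_eqI) auto
    qed
    also have "\<dots> = (if n = u then Phi 0 (Phi n a \<otimes> Phi m b) else \<zero>)"
      using a b u False by (auto simp: l_def m_comm)
    finally show ?thesis by (simp add: l_def)
  qed
  have "Phi (n + m) (a \<otimes> b) = (\<Oplus>u\<in>{..n + m}. Phi (n + m - u) (Phi u a \<otimes> b))" by (rule Phi_mult[OF a(1) b(1)])
  also have "\<dots> = (\<Oplus>u\<in>{..n + m}. if n = u then Phi 0 (Phi n a \<otimes> Phi m b) else \<zero>)"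
    using inner a b by (intro finsum_cong') auto
  also have "\<dots> = Phi 0 (Phi n a \<otimes> Phi m b)" using a b by (subst add.finprod_singleton) auto
  finally show ?thesis .
qed

text \<open>The lowest parts of two elements outside the ideal are nonzero elements of \<open>W\<close>, hence outside the
  prime \<open>p\<close>; so is their product, and \<open>Phi 0\<close> kills nothing outside \<open>p\<close>.\<close>
lemma curve_prime: "primeideal curve A"
proof (rule primeidealI[OF curve_ideal cring_axioms])
  show "carrier A \<noteq> curve" using curve_subset_p p.I_notcarr p.Icarr by blast
  fix a b assume ab: "a \<in> carrier A" "b \<in> carrier A" "a \<otimes> b \<in> curve"
  show "a \<in> curve \<or> b \<in> curve"
  proof (rule ccontr)
    assume "\<not> ?thesis"
    then obtain n m where n: "Phi n a \<noteq> \<zero>" "\<And>u. u < n \<Longrightarrow> Phi u a = \<zero>"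
      and m: "Phi m b \<noteq> \<zero>" "\<And>u. u < m \<Longrightarrow> Phi u b = \<zero>"
      using first_weight[OF ab(1)] first_weight[OF ab(2)] by metis
    have "Phi 0 (Phi n a \<otimes> Phi m b) = \<zero>"
      using Phi_mult_lowest[OF ab(1) n(2) ab(2) m(2)] ab(3) by (simp add: curve_def)
    then have "Phi n a \<otimes> Phi m b \<in> p" using ab by (intro Phi_0_eq_zeroD) auto
    then have "Phi n a \<in> p \<or> Phi m b \<in> p" using p.I_prime ab by auto
    then show False using Wsum_Int_p Phi_Wsum ab n(1) m(1) by blast
  qed
qed

lemma curve_homogeneous: "homogeneous_ideal A \<A> curve"
  by (rule homogeneous_idealI[OF curve_ideal]) (auto simp: curve_def Phi_component)

lemma curve_relevant: "curve \<in> relevant_primes A \<A> xs"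
  using curve_prime curve_homogeneous curve_subset_p relevant_primesD(3)[OF relevant] by (auto simp: relevant_primes_def)

lemma Phi_0_one: "Phi 0 \<one> \<notin> p"
proof
  assume "Phi 0 \<one> \<in> p"
  moreover have "Phi 0 \<one> \<in> Wsum" by (rule Phi_Wsum) simp
  ultimately have "Phi 0 \<one> = \<zero>" by (rule Wsum_Int_p[rotated])
  then have "\<one> \<in> p" by (intro Phi_0_eq_zeroD) auto
  then show False using p.one_imp_carrier p.I_notcarr by auto
qed

lemma curve_psubset_p: "curve \<subset> p"
proof -
  have "g ` {..<s} \<subseteq> p" unfolding p_gen using g_fun by (intro genideal_self) blast
  then have g0: "g 0 \<in> p" using three_le by auto
  have "g 0 = z [^] (0::nat) \<otimes> gp {#0#} \<otimes> \<one>"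
    using powprod_single[OF g_fun] gp_carrier[of "{#0#}"] by simp
  then have "Phi 3 (g 0) = Phi 3 (z [^] (0::nat) \<otimes> gp {#0#} \<otimes> \<one>)" by simp
  also have "\<dots> = z [^] c 0 \<otimes> Phi 0 \<one>" using Phi_shift[of \<one> "{#0#}" 3 0] three_le by simp
  finally have eq: "Phi 3 (g 0) = z [^] c 0 \<otimes> Phi 0 \<one>" .
  have "z [^] c 0 \<otimes> Phi 0 \<one> \<notin> p"
    using p.I_prime[of "z [^] c 0" "Phi 0 \<one>"] zpow_notin_p[of "c 0"] Phi_0_one by auto
  then have "Phi 3 (g 0) \<noteq> \<zero>" unfolding eq using p.zero_closed by metis
  then have "g 0 \<notin> curve" by (auto simp: curve_def)
  then show ?thesis using g0 curve_subset_p by blast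
qed

text \<open>Below 6 each weight is attained by at most one exponent. This is the reason why the ideal of
  the curve contains no element with a term linear in \<open>g 0\<close>, \<open>g 1\<close> or \<open>g 2\<close>.\<close>
lemma exps_of_weight_4: "exps_of_weight 4 = {{#1#}}" and exps_of_weight_5: "exps_of_weight 5 = {{#2#}}"
proof -
  have wt3: "\<alpha> = {#} \<or> weight \<alpha> \<ge> 3" for \<alpha> by (cases \<alpha>) auto
  have *: "\<alpha> = {#m#}" if "weight \<alpha> = m + 3" "0 < m" "m < 3" for \<alpha> m
  proof -
    have "\<alpha> \<noteq> {#}" using that(1) by auto
    then obtain i \<beta> where \<alpha>: "\<alpha> = add_mset i \<beta>" by (meson multiset_cases)
    then have "\<beta> = {#}" using wt3[of \<beta>] that by auto
    then show ?thesis using \<alpha> that by simp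
  qed
  show "exps_of_weight 4 = {{#1#}}" using *[of _ 1] by (auto simp: exps_of_weight_def)
  show "exps_of_weight 5 = {{#2#}}" using *[of _ 2] by (auto simp: exps_of_weight_def)
qed

lemma curve_coeff:
  assumes "q \<in> curve" shows "coeff {#} q = \<zero>" "coeff {#1#} q = \<zero>" "coeff {#2#} q = \<zero>"
proof -
  have q: "q \<in> carrier A" "\<And>n. Phi n q = \<zero>" using assms by (auto simp: curve_def)
  show "coeff {#} q = \<zero>" using Phi_0[OF q(1)] q(2) by simp
  have "z [^] deg {#1#} \<otimes> coeff {#1#} q = \<zero>" using q(2)[of 4] q(1) unfolding Phi_def exps_of_weight_4 by simp
  then show "coeff {#1#} q = \<zero>" using zpow_cancel[OF coeff_Wsum[OF q(1)]] by blast
  have "z [^] deg {#2#} \<otimes> coeff {#2#} q = \<zero>" using q(2)[of 5] q(1) unfolding Phi_def exps_of_weight_5 by simp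
  then show "coeff {#2#} q = \<zero>" using zpow_cancel[OF coeff_Wsum[OF q(1)]] by blast
qed

text \<open>Up to powers of \<open>z\<close>, the ideal of the curve contains \<open>g\<^sub>1\<^sup>2 - g\<^sub>0g\<^sub>2\<close>, \<open>g\<^sub>1g\<^sub>2 - g\<^sub>0\<^sup>3\<close>,
  \<open>g\<^sub>2\<^sup>2 - g\<^sub>0\<^sup>2g\<^sub>1\<close>, of weights 8, 9 and 10, and the remaining generators. The first terms can be told
  from all second terms because the latter contain \<open>g\<^sub>0\<close>.\<close>
definition leading :: "nat \<Rightarrow> nat multiset" where
  "leading i = (if i = 0 then {#1, 1#} else if i = 1 then {#1, 2#} else if i = 2 then {#2, 2#} else {#i#})"

definition trailing :: "nat \<Rightarrow> nat multiset" where
  "trailing i = (if i = 0 then {#0, 2#} else if i = 1 then {#0, 0, 0#} else {#0, 0, 1#})"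

lemma leading_trailing:
  "weight (trailing i) = weight (leading i)" "0 \<in># trailing i" "trailing i \<in> exps 3" "leading i \<in> exps 3" if "i < 3" for i
  using that by (auto simp: leading_def trailing_def less_Suc_eq numeral_3_eq_3)

lemma leading_exps: "i < s \<Longrightarrow> leading i \<in> exps s"
  using three_le by (auto simp: leading_def)

lemma zero_notin_leading: "0 \<notin># leading i"
  by (auto simp: leading_def)

lemma leading_antichain: "leading i \<subseteq># leading j \<Longrightarrow> i = j"
proof -
  assume sub: "leading i \<subseteq># leading j"
  have "set_mset (leading i) \<subseteq> set_mset (leading j)" "size (leading i) \<le> size (leading j)"
    and "\<And>a. count (leading i) a \<le> count (leading j) a"
    using sub by (auto simp: set_mset_mono size_mset_mono subseteq_mset_def)
  note f = this(1,2) this(3)[of 1] this(3)[of 2]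
  show "i = j" using f by (auto simp: leading_def split: if_splits)
qed

lemma leading_minus:
  assumes "i \<in># leading j" shows "leading j - {#i#} \<in> {{#}, {#1#}, {#2#}}"
  using assms by (auto simp: leading_def add_mset_commute split: if_splits)

text \<open>Each monomial is multiplied by the power of \<open>z\<close> given by the degree of the other one, which
  makes the equation homogeneous.\<close>
definition curve_eqn :: "nat \<Rightarrow> 'a" where
  "curve_eqn i = (if i < 3 then z [^] deg (trailing i) \<otimes> gp (leading i) \<ominus> z [^] deg (leading i) \<otimes> gp (trailing i) else gp (leading i))"

lemma curve_eqn_mem:
  assumes "i < s" shows "curve_eqn i \<in> curve"
proof -
  have "Phi n (curve_eqn i) = \<zero>" for n
  proof (cases "i < 3")
    case True
    note co = leading_trailing[OF True]
    let ?B = "z [^] deg (trailing i) \<otimes> gp (leading i)" and ?C = "z [^] deg (leading i) \<otimes> gp (trailing i)"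
    have "Phi n ?B = Phi n ?C"
      using Phi_shift[of \<one> "leading i" n "deg (trailing i)"] Phi_shift[of \<one> "trailing i" n "deg (leading i)"]
        co exps_3 by (simp add: add.commute)
    then show ?thesis using True by (simp add: curve_eqn_def minus_eq Phi_add Phi_neg r_neg)
  next
    case False
    then have "leading i \<notin> exps 3" by (simp add: leading_def)
    then show ?thesis using False Phi_shift[of \<one> "leading i" n 0] leading_exps[OF assms] by (simp add: curve_eqn_def)
  qed
  moreover have "curve_eqn i \<in> carrier A" by (simp add: curve_eqn_def)
  ultimately show ?thesis by (simp add: curve_def)
qed

text \<open>The coefficient at a leading exponent sees one equation only, and of its factor \<open>\<kappa>\<close> only the
  residue modulo \<open>p\<close>: leading exponents do not divide each other, and no trailing exponent divides one.\<close>
lemma coeff_curve_eqn: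
  assumes i: "i < s" and \<kappa>: "\<kappa> \<in> carrier A"
  shows "coeff (leading j) (\<kappa> \<otimes> curve_eqn i) = (if j = i then z [^] (if i < 3 then deg (trailing i) else 0) \<otimes> coeff {#} \<kappa> else \<zero>)"
proof -
  have lead: "coeff (leading j) (z [^] n \<otimes> gp (leading i) \<otimes> \<kappa>) = (if j = i then z [^] n \<otimes> coeff {#} \<kappa> else \<zero>)" for n :: nat
  proof -
    have "leading i \<subseteq># leading j \<longleftrightarrow> j = i" using leading_antichain by auto
    then show ?thesis using coeff_shift[OF \<kappa> leading_exps[OF i], of "leading j" n] by simp
  qed
  show ?thesis
  proof (cases "i < 3")
    case True
    let ?B = "z [^] deg (trailing i) \<otimes> gp (leading i)" and ?C = "z [^] deg (leading i) \<otimes> gp (trailing i)"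
    have "\<not> trailing i \<subseteq># leading j"
      using mset_subset_eqD[OF _ leading_trailing(2)[OF True], of "leading j"] zero_notin_leading[of j] by (rule contrapos_nn[rotated])
    then have "coeff (leading j) (?C \<otimes> \<kappa>) = \<zero>"
      using coeff_shift[OF \<kappa> exps_3[OF leading_trailing(3)[OF True]], of "leading j"] by simp
    moreover have "\<kappa> \<otimes> curve_eqn i = ?B \<otimes> \<kappa> \<oplus> \<ominus> (?C \<otimes> \<kappa>)"
    proof -
      define B C where "B = ?B" and "C = ?C"
      have "B \<in> carrier A" "C \<in> carrier A" by (auto simp: B_def C_def)
      moreover have "curve_eqn i = B \<ominus> C" using True by (simp add: curve_eqn_def B_def C_def)
      ultimately show ?thesis unfolding B_def[symmetric] C_def[symmetric] using \<kappa> by (simp, algebra)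
    qed
    ultimately show ?thesis using lead \<kappa> True by (simp add: coeff_add coeff_neg)
  next
    case False
    then have "\<kappa> \<otimes> curve_eqn i = z [^] (0::nat) \<otimes> gp (leading i) \<otimes> \<kappa>" using \<kappa> by (simp add: curve_eqn_def m_comm)
    then show ?thesis using lead[of 0] False by simp
  qed
qed

text \<open>With fewer than \<open>s\<close> generators, the \<open>s\<close> equations would be dependent modulo \<open>p\<close> times the ideal.
  An element of the ideal has no terms of exponent \<open>0\<close>, \<open>g\<^sub>1\<close> or \<open>g\<^sub>2\<close>, so an element of \<open>p\<close> times the
  ideal has vanishing coefficients at all leading exponents; these read off from a dependence that
  all its coefficients lie in \<open>p\<close>.\<close>
lemma curve_not_generated:
  assumes qs: "set qs \<subseteq> carrier A" "curve = Idl (set qs)" shows "s \<le> length qs"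
proof (rule ccontr)
  assume "\<not> ?thesis"
  then have len: "length qs < card {..<s}" by simp
  interpret curve: ideal curve A by (rule curve_ideal)
  define X where "X = {a \<in> carrier A. \<forall>j<s. coeff (leading j) a = \<zero>}"
  have X: "additive_subgroup X A"
  proof (intro additive_subgroup.intro add.subgroupI)
    show "X \<subseteq> carrier A" by (auto simp: X_def)
    have "\<zero> \<in> X" by (simp add: X_def)
    then show "X \<noteq> {}" by blast
    show "\<ominus> a \<in> X" if "a \<in> X" for a using that by (auto simp: X_def coeff_neg)
    show "a \<oplus> b \<in> X" if "a \<in> X" "b \<in> X" for a b using that by (auto simp: X_def coeff_add)
  qed
  have pX: "a \<otimes> q \<in> X" if a: "a \<in> p" and q: "q \<in> curve" for a q
  proof -
    have Y: "g ` {..<s} \<subseteq> carrier A" using g_fun by auto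
    have "a \<in> Idl (g ` {..<s})" using a p_gen by simp
    with Y show ?thesis
    proof (induction rule: Idl_induct)
      case zero
      then show ?case using curve.Icarr[OF q] by (simp add: X_def)
    next
      case (add b y r)
      define x where "x = b \<otimes> y"
      obtain i where "y = g i" "i < s" using add(2) by blast
      with add(1) x_def have x: "x = b \<otimes> g i" "b \<in> carrier A" "i < s" by auto
      have gi: "g i \<in> carrier A" using g_fun by blast
      have qc: "q \<in> carrier A" "b \<otimes> q \<in> curve" "b \<otimes> q \<in> carrier A" using curve.Icarr[OF q] curve.I_l_closed[OF q x(2)] x(2) by auto
      have eq: "x \<otimes> q = z [^] (0::nat) \<otimes> gp {#i#} \<otimes> (b \<otimes> q)"
        unfolding x(1) powprod_single[OF g_fun] using x(2) gi qc by (simp add: m_ac)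
      have "coeff (leading j) (x \<otimes> q) = \<zero>" for j
      proof (cases "i \<in># leading j")
        case True
        then have "coeff (leading j - {#i#}) (b \<otimes> q) = \<zero>" using leading_minus[OF True] curve_coeff[OF qc(2)] by auto
        then show ?thesis unfolding eq using coeff_shift[OF qc(3), of "{#i#}" "leading j" 0] x(3) by simp
      next
        case False
        then show ?thesis unfolding eq using coeff_shift[OF qc(3), of "{#i#}" "leading j" 0] x(3) by simp
      qed
      then have "x \<otimes> q \<in> X" using x gi qc by (simp add: X_def)
      moreover have "(x \<oplus> r) \<otimes> q = x \<otimes> q \<oplus> r \<otimes> q"
        using x gi qc add(3) by (simp add: l_distr)
      ultimately show ?case using add(4) additive_subgroup.a_closed[OF X] unfolding x_def by simp
    qed
  qed
  have "\<exists>\<kappa>. (\<forall>i. \<kappa> i \<in> carrier A) \<and> (\<exists>i\<in>{..<s}. \<kappa> i \<notin> p) \<and> (\<Oplus>i\<in>{..<s}. \<kappa> i \<otimes> curve_eqn i) \<in> X"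
    by (rule dependent_modulo_prime[OF p.primeideal X qs(1) _ len]) (use curve_eqn_mem pX qs(2) in auto)
  then obtain \<kappa> j where \<kappa>: "\<And>i. \<kappa> i \<in> carrier A" "j < s" "\<kappa> j \<notin> p" "(\<Oplus>i\<in>{..<s}. \<kappa> i \<otimes> curve_eqn i) \<in> X" by blast
  have ec: "curve_eqn i \<in> carrier A" for i by (simp add: curve_eqn_def)
  let ?n = "if j < 3 then deg (trailing j) else 0"
  have "\<zero> = coeff (leading j) (\<Oplus>i\<in>{..<s}. \<kappa> i \<otimes> curve_eqn i)" using \<kappa>(2,4) by (simp add: X_def)
  also have "\<dots> = (\<Oplus>i\<in>{..<s}. coeff (leading j) (\<kappa> i \<otimes> curve_eqn i))"
    using \<kappa>(1) ec by (intro coeff_finsum) auto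
  also have "\<dots> = (\<Oplus>i\<in>{..<s}. if j = i then z [^] ?n \<otimes> coeff {#} (\<kappa> j) else \<zero>)"
    using \<kappa>(1) coeff_curve_eqn by (intro finsum_cong') auto
  also have "\<dots> = z [^] ?n \<otimes> coeff {#} (\<kappa> j)" using \<kappa>(1,2) by (subst add.finprod_singleton) auto
  finally have "z [^] ?n \<otimes> coeff {#} (\<kappa> j) = \<zero>" by simp
  then have "coeff {#} (\<kappa> j) = \<zero>" using zpow_cancel[OF coeff_Wsum[OF \<kappa>(1)]] by blast
  then have "\<kappa> j \<in> p" by (rule coeff_empty_in_p[OF \<kappa>(1)])
  then show False using \<kappa>(3) by simp
qed

end

section \<open>The dimension bound\<close>

text \<open>The numbers fit together as follows: \<open>s \<le> ht p\<close> by Nakayama, \<open>ht p + 1 \<le> s + 1\<close> by growth,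
  and \<open>4 \<le> s + 1\<close> by growth again. So the monomials are independent, the curve exists, and its ideal has
  height less than \<open>ht p = s\<close>.\<close>
lemma (in gr_shimoda_ring) no_prime_chain_of_length_4:
  assumes C: "\<And>i. i \<le> 4 \<Longrightarrow> primeideal (C i) A" "\<And>i. i < 4 \<Longrightarrow> C i \<subset> C (Suc i)"
  shows False
proof -
  have "relevant_primes A \<A> xs \<noteq> {}"
    using relevant_prime_exists[OF C(1)[of 0] C(1)[of 1]] C(2)[of 0] by simp
  then obtain p' where "p' \<in> relevant_primes A \<A> xs" by blast
  from maximal_relevant_prime_exists[OF this] obtain p where p: "p \<in> relevant_primes A \<A> xs"
    and max: "\<And>p'. p' \<in> relevant_primes A \<A> xs \<Longrightarrow> p \<subseteq> p' \<Longrightarrow> p' = p" by (elim bexE) simp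
  note pd = relevant_primesD[OF p]
  interpret p: primeideal p A by (rule pd(1))
  obtain gs where gs: "set gs \<subseteq> carrier A" "enat (length gs) = height A p" "p = Idl (set gs)"
    using relevant_prime_generated[OF p] by blast
  obtain hs where hs: "set hs \<subseteq> homogeneous_elements \<A>" "p = Idl (set hs)" "length hs \<le> length gs"
    using homogeneous_generators[OF p gs(1,3)] by blast
  have hsc: "set hs \<subseteq> carrier A" using hs(1) homogeneous_elements_carrier by blast
  define s where "s = length hs"
  define g where "g i = (if i < s then hs ! i else \<zero>)" for i
  have "\<exists>d>0. g i \<in> \<A> d" for i
  proof (cases "i < s")
    case True
    then have gi: "g i \<in> set hs" "g i \<in> p" using genideal_self[OF hsc] hs(2) by (auto simp: g_def s_def)
    then obtain d where d: "g i \<in> \<A> d" using hs(1) by (auto simp: homogeneous_elements_def)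
    show ?thesis
    proof (cases "d = 0")
      case True
      then have "g i = \<zero>" using d component_0 prime_Int_k[OF pd(1) _ gi(2)] by simp
      then show ?thesis using zero_comp by auto
    next
      case False
      then show ?thesis using d by auto
    qed
  next
    case False
    then show ?thesis using zero_comp by (auto simp: g_def)
  qed
  then obtain c where c: "\<And>i. c i > 0" "\<And>i. g i \<in> \<A> (c i)" by metis
  have "g ` {..<s} = set hs" by (auto simp: g_def s_def in_set_conv_nth image_iff)
  then have p_gen: "p = Idl (g ` {..<s})" using hs(2) by simp
  have "\<not> set xs \<subseteq> p"
    using pd(3) genideal_minimal[OF pd(4), of "set xs"] by (auto simp: irrelevant_ideal_def)
  then obtain z where z: "z \<in> set xs" "z \<notin> p" by blast
  interpret maximal_relevant A \<A> k xs p g c s z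
    by unfold_locales (fact p max c p_gen z)+
  have s3: "3 \<le> s" using prime_chain_length_le_Suc[of 4 C] C by simp
  define r where "r = length gs"
  have hr: "height A p = enat r" using gs(2) by (simp add: r_def)
  have "{P. primeideal P A \<and> P \<subseteq> p} \<noteq> {}" using pd(1) by blast
  then obtain D where D: "\<And>i. i \<le> r \<Longrightarrow> D i \<in> {P. primeideal P A \<and> P \<subseteq> p}" "\<And>i. i < r \<Longrightarrow> D i \<subset> D (Suc i)"
    using chain_dim_attained[of "{P. primeideal P A \<and> P \<subseteq> p}" r] hr unfolding height_def by blast
  \<comment> \<open>A chain that realises the height of \<open>p\<close>, lengthened by the irrelevant ideal.\<close>
  define E where "E i = (if i \<le> r then D i else mm)" for i
  have E: "primeideal (E i) A" if "i \<le> Suc r" for i using D(1) primeideal_mm by (auto simp: E_def)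
  have Es: "E i \<subset> E (Suc i)" if "i < Suc r" for i
  proof (cases "i = r")
    case True
    have "D r \<subseteq> p" using D(1) by blast
    then have "D r \<subset> mm" using pd(3) by blast
    then show ?thesis using True by (simp add: E_def)
  next
    case False
    then show ?thesis using D(2)[of i] that by (simp add: E_def)
  qed
  have "Suc r \<le> Suc s" by (rule prime_chain_length_le_Suc[where C = E]) (use E Es in blast)+
  then have rs: "r = s" using hs(3) by (simp add: r_def s_def)
  obtain W where W: "\<forall>n. additive_subgroup (W n) A \<and> W n \<subseteq> \<A> n \<and> W n \<inter> p \<subseteq> {\<zero>} \<and>
     (\<forall>a\<in>\<A> n. \<exists>w\<in>W n. \<exists>q\<in>p. a = w \<oplus> q) \<and> (\<otimes>) z ` W n \<subseteq> W (Suc n)"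
    using graded_complement_exists by (rule exE)
  interpret monomial_curve A \<A> k xs p g c s z W
  proof (intro monomial_curve.intro expansion.intro expansion_axioms.intro monomial_curve_axioms.intro)
    show "maximal_relevant A \<A> k xs p g c s z" by (rule maximal_relevant_axioms)
    show "a \<otimes> powprod g \<beta> \<notin> higher g s \<beta>" if "a \<in> carrier A" "a \<notin> p" "\<beta> \<in> exps s" for a \<beta>
      by (rule no_initial_relation[where C = E]) (use E Es rs that in auto)
    show "3 \<le> s" by (rule s3)
    fix n
    show "additive_subgroup (W n) A" "W n \<subseteq> \<A> n" "W n \<inter> p \<subseteq> {\<zero>}" "(\<otimes>) z ` W n \<subseteq> W (Suc n)"
      using W by simp_all
    show "\<exists>w\<in>W n. \<exists>q\<in>p. a = w \<oplus> q" if "a \<in> \<A> n" for a using W that by simp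
  qed
  obtain r' where r': "r' < r" "height A curve = enat r'"
    using height_strict_mono[OF curve_prime pd(1) curve_psubset_p hr] by blast
  obtain qs where qs: "set qs \<subseteq> carrier A" "enat (length qs) = height A curve" "curve = Idl (set qs)"
    using relevant_prime_generated[OF curve_relevant] by blast
  have "s \<le> length qs" by (rule curve_not_generated[OF qs(1,3)])
  then show False using qs(2) r' rs by simp
qed

lemma (in gr_shimoda_ring) krull_dim_le_3: "krull_dim A \<le> 3"
proof -
  have "krull_dim A \<le> enat 3"
    unfolding krull_dim_def
  proof (rule chain_dim_leI)
    fix C :: "nat \<Rightarrow> 'a set"
    assume "\<And>i. i \<le> Suc 3 \<Longrightarrow> C i \<in> {P. primeideal P A}" "\<And>i. i < Suc 3 \<Longrightarrow> C i \<subset> C (Suc i)"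
    then show False using no_prime_chain_of_length_4[of C] by simp
  qed
  then show ?thesis by (simp add: numeral_eq_enat)
qed

context standard_graded_algebra
begin

lemma closedin_Proj:
  "closedin (Proj A \<A> xs) C \<longleftrightarrow>
     (\<exists>S\<subseteq>homogeneous_elements \<A>. C = {p \<in> relevant_primes A \<A> xs. S \<subseteq> p})"
proof
  assume "closedin (Proj A \<A> xs) C"
  then have C: "C \<subseteq> relevant_primes A \<A> xs" "openin (Proj A \<A> xs) (relevant_primes A \<A> xs - C)"
    by (auto simp: closedin_def topspace_Proj)
  then obtain S where S: "S \<subseteq> homogeneous_elements \<A>"
    "relevant_primes A \<A> xs - C = {p \<in> relevant_primes A \<A> xs. \<not> S \<subseteq> p}" unfolding openin_Proj by blast
  then have "C = {p \<in> relevant_primes A \<A> xs. S \<subseteq> p}" using C(1) by blast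
  then show "\<exists>S\<subseteq>homogeneous_elements \<A>. C = {p \<in> relevant_primes A \<A> xs. S \<subseteq> p}" using S(1) by blast
next
  assume "\<exists>S\<subseteq>homogeneous_elements \<A>. C = {p \<in> relevant_primes A \<A> xs. S \<subseteq> p}"
  then obtain S where S: "S \<subseteq> homogeneous_elements \<A>" "C = {p \<in> relevant_primes A \<A> xs. S \<subseteq> p}" by blast
  have "openin (Proj A \<A> xs) {p \<in> relevant_primes A \<A> xs. \<not> S \<subseteq> p}" unfolding openin_Proj using S(1) by blast
  moreover have "relevant_primes A \<A> xs - C = {p \<in> relevant_primes A \<A> xs. \<not> S \<subseteq> p}" using S(2) by blast
  ultimately show "closedin (Proj A \<A> xs) C" using S(2) by (auto simp: closedin_def topspace_Proj)
qed

text \<open>The generic point of an irreducible closed set is the intersection of its points. Irreducibility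
  is applied to the closed sets of two homogeneous elements whose product lies in the intersection.\<close>
lemma irreducible_closed_Inter:
  assumes C: "closedin (Proj A \<A> xs) C" "irreducible_in (Proj A \<A> xs) C"
  shows "\<Inter>C \<in> relevant_primes A \<A> xs" "C = {p \<in> relevant_primes A \<A> xs. \<Inter>C \<subseteq> p}"
proof -
  obtain S where S: "S \<subseteq> homogeneous_elements \<A>" "C = {p \<in> relevant_primes A \<A> xs. S \<subseteq> p}"
    using C(1) unfolding closedin_Proj by (elim exE conjE)
  have ne: "C \<noteq> {}" using C(2) by (simp add: irreducible_in_def)
  then obtain p where p: "p \<in> C" by blast
  have CR: "C \<subseteq> relevant_primes A \<A> xs" using S(2) by blast
  have SI: "S \<subseteq> \<Inter>C" using S(2) by blast
  then show "C = {p \<in> relevant_primes A \<A> xs. \<Inter>C \<subseteq> p}" using S(2) by blast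
  have ide: "ideal (\<Inter>C) A" by (rule i_Intersect[OF _ ne], rule relevant_primesD(4)) (use CR in blast)
  have hom: "homogeneous_ideal A \<A> (\<Inter>C)"
  proof (rule homogeneous_idealI[OF ide], rule InterI)
    fix a n q assume a: "a \<in> \<Inter>C" and q: "q \<in> C"
    show "component n a \<in> q" by (rule homogeneous_idealD[OF relevant_primesD(2)]) (use a q CR in blast)+
  qed
  have "primeideal (\<Inter>C) A"
  proof (rule homogeneous_primeideal[OF hom])
    have "\<Inter>C \<subseteq> p" "p \<subset> mm" "mm \<subseteq> carrier A"
      using p CR relevant_primesD(3) ideal.Icarr[OF ideal_mm] by blast+
    then show "\<Inter>C \<noteq> carrier A" by blast
    fix i j a b assume ab: "a \<in> \<A> i" "b \<in> \<A> j" "a \<otimes> b \<in> \<Inter>C"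
    have cl: "closedin (Proj A \<A> xs) {p \<in> relevant_primes A \<A> xs. {x} \<subseteq> p}" if "x \<in> \<A> l" for x l
      unfolding closedin_Proj using that by (intro exI[where x = "{x}"]) (auto simp: homogeneous_elements_def)
    have "C \<subseteq> {p \<in> relevant_primes A \<A> xs. {a} \<subseteq> p} \<union> {p \<in> relevant_primes A \<A> xs. {b} \<subseteq> p}"
    proof
      fix q assume q: "q \<in> C"
      then have "primeideal q A" "a \<otimes> b \<in> q" using CR relevant_primesD(1) ab(3) by auto
      then have "a \<in> q \<or> b \<in> q"
        by (rule primeideal.I_prime[OF _ comp_carrier[OF ab(1)] comp_carrier[OF ab(2)]])
      then show "q \<in> {p \<in> relevant_primes A \<A> xs. {a} \<subseteq> p} \<union> {p \<in> relevant_primes A \<A> xs. {b} \<subseteq> p}"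
        using q CR by blast
    qed
    then have "C \<subseteq> {p \<in> relevant_primes A \<A> xs. {a} \<subseteq> p} \<or> C \<subseteq> {p \<in> relevant_primes A \<A> xs. {b} \<subseteq> p}"
      using C(2) cl[OF ab(1)] cl[OF ab(2)] unfolding irreducible_in_def by blast
    then show "a \<in> \<Inter>C \<or> b \<in> \<Inter>C" by blast
  qed
  moreover have "\<not> mm \<subseteq> \<Inter>C" using p relevant_primesD(3)[of p] CR by blast
  ultimately show "\<Inter>C \<in> relevant_primes A \<A> xs" using hom by (simp add: relevant_primes_def)
qed

text \<open>Passing to generic points reverses inclusions, and the irrelevant ideal lengthens the resulting
  chain of primes by one.\<close>
lemma pr_dim_le:
  assumes "krull_dim A \<le> enat (Suc n)"
  shows "pr_dim A \<A> xs \<le> enat n"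
  unfolding pr_dim_def top_dim_def
proof (rule chain_dim_leI)
  fix C
  assume C: "\<And>i. i \<le> Suc n \<Longrightarrow> C i \<in> {C. closedin (Proj A \<A> xs) C \<and> irreducible_in (Proj A \<A> xs) C}"
    and Cs: "\<And>i. i < Suc n \<Longrightarrow> C i \<subset> C (Suc i)"
  define P where "P i = (if i \<le> Suc n then \<Inter>(C (Suc n - i)) else mm)" for i
  have rel: "\<Inter>(C i) \<in> relevant_primes A \<A> xs" "C i = {p \<in> relevant_primes A \<A> xs. \<Inter>(C i) \<subseteq> p}"
    if "i \<le> Suc n" for i
    using irreducible_closed_Inter C[OF that] by auto
  have "enat (Suc (Suc n)) \<le> krull_dim A" unfolding krull_dim_def
  proof (rule length_le_chain_dim)
    show "P i \<in> {P. primeideal P A}" if "i \<le> Suc (Suc n)" for i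
      using relevant_primesD(1)[OF rel(1)] primeideal_mm by (simp add: P_def)
    show "P i \<subset> P (Suc i)" if "i < Suc (Suc n)" for i
    proof (cases "i = Suc n")
      case True
      then show ?thesis using relevant_primesD(3)[OF rel(1)[of 0]] by (simp add: P_def)
    next
      case False
      define j where "j = n - i"
      have j: "Suc n - i = Suc j" "Suc n - Suc i = j" "j < Suc n" using False that by (auto simp: j_def)
      have "\<Inter>(C (Suc j)) \<subseteq> \<Inter>(C j)" using Cs[OF j(3)] by blast
      moreover have "\<Inter>(C (Suc j)) \<noteq> \<Inter>(C j)" using Cs[OF j(3)] rel(2)[of j] rel(2)[of "Suc j"] j(3) by auto
      ultimately show ?thesis using False that j by (auto simp: P_def)
    qed
  qed
  then have "enat (Suc (Suc n)) \<le> enat (Suc n)" using assms by (rule order_trans)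
  then show False by simp
qed

end

theorem theorem3p6:
  fixes A :: "('a, 'b) ring_scheme" and \<A> :: "nat \<Rightarrow> 'a set"
    and k :: "'a set" and xs :: "'a list"
  assumes "gr_shimoda_ring A \<A> k xs"
    and "krull_dim A \<ge> 2"
    and "char_zero_ring (A\<lparr>carrier := k\<rparr>)"
  shows "pr_dim A \<A> xs \<le> 2 \<and> krull_dim A \<le> 3"
proof -
  interpret gr_shimoda_ring A \<A> k xs by fact
  have "krull_dim A \<le> enat (Suc 2)" using krull_dim_le_3 by (simp add: numeral_eq_enat)
  from pr_dim_le[OF this] krull_dim_le_3 show ?thesis by (simp add: numeral_eq_enat)
qed

end
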